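(* Let $\mathbb{K}$ be a field of characteristic zero, $V$ a $\mathbb{K}$-vector space of finite dimension $n\ge 2$, $\mathfrak{L}$ a Lie subalgebra of $\mathfrak{gl}_{\mathbb{K}}(V)$, and $\mathcal{K}=\sum_{p\ge 2}\mathcal{K}_{-p}$ a $\mathbb{Z}$-graded ideal of the free Lie algebra $\mathfrak{f}(V)$ contained in $\mathfrak{f}_{[2]}(V)$. Let $$\mathfrak{N}(\mathcal{K},\mathfrak{L})=\{\xi\in\mathfrak{F}(V,\mathfrak{L})\mid[\xi,\mathcal{K}]\subseteq\mathcal{K}\}$$ be the normalizer of $\mathcal{K}$ in $\mathfrak{F}(V,\mathfrak{L})$ and let $\mathfrak{g}(\mathcal{K},\mathfrak{L})=\mathfrak{N}(\mathcal{K},\mathfrak{L})/\mathcal{K}$ with the induced $\mathbb{Z}$-grading. Then the inclusion $\mathfrak{f}(V)\hookrightarrow\mathfrak{N}(\mathcal{K},\mathfrak{L})$ induces an injective homomorphism $\mathfrak{m}(\mathcal{K})=\mathfrak{f}(V)/\mathcal{K}\hookrightarrow\mathfrak{g}(\mathcal{K},\mathfrak{L})$ which defines on $\mathfrak{g}(\mathcal{K},\mathfrak{L})$ the structure of an effective prolongation of type $\mathfrak{L}$ of the fundamental graded Lie algebra $\mathfrak{m}(\mathcal{K})$, and $\mathfrak{g}(\mathcal{K},\mathfrak{L})$ is, modulo isomorphisms, the maximal effective prolongation of type $\mathfrak{L}$ of $\mathfrak{m}(\mathcal{K})$.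
   Context: $\mathfrak{f}(V)=\sum_{p\ge1}\mathfrak{f}_{-p}(V)$ is the free Lie $\mathbb{K}$-algebra generated by $V$, graded so that $\mathfrak{f}_{-1}(V)=V$; $\mathfrak{f}_{[2]}(V)=\sum_{p\ge 2}\mathfrak{f}_{-p}(V)$. A $\mathbb{Z}$-graded Lie algebra $\mathfrak{m}=\sum_{p\ge1}\mathfrak{g}_{-p}$ is fundamental (an FGLA) if $\mathfrak{g}_{-1}$ is finite dimensional and generates $\mathfrak{m}$. A $\mathbb{Z}$-graded Lie algebra $\mathfrak{g}=\sum_{p\in\mathbb{Z}}\mathfrak{g}_p$ is an effective prolongation of the FGLA $\mathfrak{m}$ if $\mathfrak{g}_{<0}=\sum_{p<0}\mathfrak{g}_p$ equals $\mathfrak{m}$ and $\{X\in\sum_{p\ge0}\mathfrak{g}_p\mid[X,\mathfrak{g}_{-1}]=\{0\}\}=\{0\}$. For a Lie subalgebra $\mathfrak{L}\subseteq\mathfrak{gl}_{\mathbb{K}}(\mathfrak{g}_{-1})$, it is of type $\mathfrak{L}$ if for each $A\in\mathfrak{g}_0$ the map $v\mapsto[A,v]$ on $\mathfrak{g}_{-1}$ belongs to $\mathfrak{L}$. It is the maximal one of type $\mathfrak{L}$ if every effective prolongation of type $\mathfrak{L}$ of $\mathfrak{m}$ admits an injective graded Lie algebra homomorphism into it which is the identity on $\mathfrak{m}$. $\mathfrak{F}(V)=\sum_{p\in\mathbb{Z}}\mathfrak{f}_p(V)$ is the graded Lie algebra containing $\mathfrak{f}(V)$ as its negative part, with $\mathfrak{f}_p(V)=V\otimes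 T^{p+1}(V^* )$ for $p\ge0$ (the space of $(p+1)$-linear $V$-valued maps on $V$; $\mathfrak{f}_0(V)=\mathfrak{gl}_{\mathbb{K}}(V)$), whose bracket is determined by $[\xi,v_0](v_1,\dots,v_p)=\xi(v_0,v_1,\dots,v_p)$ for $\xi\in\mathfrak{f}_p(V)$, $p\ge0$, $v_i\in V$, by $[\xi,[X,Y]]=[[\xi,X],Y]-[[\xi,Y],X]$ for $X,Y\in\mathfrak{f}(V)$, and recursively, for $\xi,\eta$ of nonnegative degree, by $[[\xi,\eta],v]=[[\xi,v],\eta]+[\xi,[\eta,v]]$ for $v\in V$. $\mathfrak{F}(V,\mathfrak{L})=\mathfrak{f}(V)\oplus\mathfrak{L}\oplus\sum_{p\ge1}\mathfrak{f}_p(V,\mathfrak{L})$, where $\mathfrak{f}_p(V,\mathfrak{L})$ is the set of $\xi\in\mathfrak{f}_p(V)$ such that for all $v_1,\dots,v_p\in V$ the endomorphism $v\mapsto\xi(v_1,\dots,v_p,v)$ belongs to $\mathfrak{L}$; it is a graded Lie subalgebra of $\mathfrak{F}(V)$. *)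

theory Defs
  imports "HOL-Algebra.Algebraic_Closure_Type" "HOL-Algebra.AbelCoset" "HOL-Algebra.Module"
begin

section \<open>Graded Lie algebras over a field\<close>

text \<open>
  The scalars are the elements of a type \<open>'k\<close> of class \<open>field\<close>, made into a ring record by
  \<^const>\<open>ring_of_type_algebra\<close>. Lie algebras are module records with a carrier set and an
  additional bracket. The fields \<open>mult\<close> and \<open>one\<close>, which module records inherit from
  ring records, are never used.
\<close>

record ('k, 'g) lie_struct = "('k, 'g) module" +
  bracket :: "'g \<Rightarrow> 'g \<Rightarrow> 'g"

record ('k, 'g) graded_struct = "('k, 'g) lie_struct" +
  grade :: "int \<Rightarrow> 'g set"

locale lie_algebra = Module.module "ring_of_type_algebra :: 'k ring" G
  for G :: "('k::field, 'g, 'm) lie_struct_scheme" (structure) +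
  assumes bracket_closed:
      "\<lbrakk>x \<in> carrier G; y \<in> carrier G\<rbrakk> \<Longrightarrow> bracket G x y \<in> carrier G"
    and bracket_add_left:
      "\<lbrakk>x \<in> carrier G; y \<in> carrier G; z \<in> carrier G\<rbrakk> \<Longrightarrow>
        bracket G (x \<oplus> y) z = bracket G x z \<oplus> bracket G y z"
    and bracket_add_right:
      "\<lbrakk>x \<in> carrier G; y \<in> carrier G; z \<in> carrier G\<rbrakk> \<Longrightarrow>
        bracket G x (y \<oplus> z) = bracket G x y \<oplus> bracket G x z"
    and bracket_smult_left:
      "\<lbrakk>x \<in> carrier G; y \<in> carrier G\<rbrakk> \<Longrightarrow> bracket G (a \<odot> x) y = a \<odot> bracket G x y"
    and bracket_smult_right:
      "\<lbrakk>x \<in> carrier G; y \<in> carrier G\<rbrakk> \<Longrightarrow> bracket G x (a \<odot> y) = a \<odot> bracket G x y"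
    and bracket_self: "x \<in> carrier G \<Longrightarrow> bracket G x x = \<zero>"
    and jacobi:
      "\<lbrakk>x \<in> carrier G; y \<in> carrier G; z \<in> carrier G\<rbrakk> \<Longrightarrow>
        bracket G x (bracket G y z) \<oplus> bracket G y (bracket G z x) \<oplus> bracket G z (bracket G x y)
          = \<zero>"

locale graded_lie_algebra = lie_algebra G
  for G :: "('k::field, 'g, 'm) graded_struct_scheme" (structure) +
  assumes grade_submodule: "Module.submodule (grade G p) (ring_of_type_algebra :: 'k ring) G"
    and decomposition: "x \<in> carrier G \<Longrightarrow>
      \<exists>!c. (\<forall>p. c p \<in> grade G p) \<and> finite {p. c p \<noteq> \<zero>} \<and> x = (\<Oplus>p\<in>{p. c p \<noteq> \<zero>}. c p)"
    and bracket_grade: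
      "\<lbrakk>x \<in> grade G p; y \<in> grade G q\<rbrakk> \<Longrightarrow> bracket G x y \<in> grade G (p + q)"

definition graded_part :: "('k, 'g, 'm) graded_struct_scheme \<Rightarrow> int set \<Rightarrow> 'g set" where
  "graded_part G P = {finsum G c A | c A. finite A \<and> A \<subseteq> P \<and> (\<forall>p\<in>A. c p \<in> grade G p)}"

definition lie_subalgebra :: "'g set \<Rightarrow> ('k::field, 'g, 'm) lie_struct_scheme \<Rightarrow> bool" where
  "lie_subalgebra H G \<longleftrightarrow> Module.submodule H (ring_of_type_algebra :: 'k ring) G \<and>
     (\<forall>x\<in>H. \<forall>y\<in>H. bracket G x y \<in> H)"

definition lie_ideal :: "'g set \<Rightarrow> ('k::field, 'g, 'm) lie_struct_scheme \<Rightarrow> bool" where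
  "lie_ideal I G \<longleftrightarrow> Module.submodule I (ring_of_type_algebra :: 'k ring) G \<and>
     (\<forall>x\<in>carrier G. \<forall>y\<in>I. bracket G x y \<in> I)"

definition graded_ideal :: "'g set \<Rightarrow> ('k::field, 'g, 'm) graded_struct_scheme \<Rightarrow> bool" where
  "graded_ideal I G \<longleftrightarrow> lie_ideal I G \<and>
     (\<forall>x\<in>I. \<exists>c A. finite A \<and> (\<forall>p\<in>A. c p \<in> I \<inter> grade G p) \<and> x = finsum G c A)"

definition graded_lie_hom ::
  "('k, 'g, 'm) graded_struct_scheme \<Rightarrow> ('k, 'h, 'n) graded_struct_scheme \<Rightarrow> ('g \<Rightarrow> 'h) set" where
  "graded_lie_hom G H = {f \<in> carrier G \<rightarrow> carrier H.
     (\<forall>x\<in>carrier G. \<forall>y\<in>carrier G. f (x \<oplus>\<^bsub>G\<^esub> y) = f x \<oplus>\<^bsub>H\<^esub> f y) \<and>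
     (\<forall>a. \<forall>x\<in>carrier G. f (a \<odot>\<^bsub>G\<^esub> x) = a \<odot>\<^bsub>H\<^esub> f x) \<and>
     (\<forall>x\<in>carrier G. \<forall>y\<in>carrier G. f (bracket G x y) = bracket H (f x) (f y)) \<and>
     (\<forall>p. f ` grade G p \<subseteq> grade H p)}"

definition graded_restrict ::
  "('k, 'g) graded_struct \<Rightarrow> 'g set \<Rightarrow> ('k, 'g) graded_struct" where
  "graded_restrict G H = G\<lparr>carrier := H, grade := (\<lambda>p. grade G p \<inter> H)\<rparr>"

definition lie_quotient ::
  "('k, 'g) graded_struct \<Rightarrow> 'g set \<Rightarrow> ('k, 'g set) graded_struct" where
  "lie_quotient G I =
    \<lparr>carrier = a_rcosets\<^bsub>G\<^esub> I, monoid.mult = undefined, one = undefined, ring.zero = I, add = set_add G,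
     module.smult = (\<lambda>a P. \<Union>x\<in>P. I +>\<^bsub>G\<^esub> (a \<odot>\<^bsub>G\<^esub> x)),
     bracket = (\<lambda>P Q. \<Union>x\<in>P. \<Union>y\<in>Q. I +>\<^bsub>G\<^esub> bracket G x y),
     grade = (\<lambda>p. (\<lambda>x. I +>\<^bsub>G\<^esub> x) ` grade G p)\<rparr>"

section \<open>Effective prolongations\<close>

definition fgla :: "('k::field, 'g, 'm) graded_struct_scheme \<Rightarrow> bool" where
  "fgla M \<longleftrightarrow> graded_lie_algebra M \<and> (\<forall>p\<ge>0. grade M p = {\<zero>\<^bsub>M\<^esub>}) \<and>
     (\<exists>S. finite S \<and> S \<subseteq> grade M (-1) \<and>
        (\<forall>U. Module.submodule U (ring_of_type_algebra :: 'k ring) M \<and> S \<subseteq> U \<longrightarrow> grade M (-1) \<subseteq> U)) \<and>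
     (\<forall>H. lie_subalgebra H M \<and> grade M (-1) \<subseteq> H \<longrightarrow> carrier M \<subseteq> H)"

text \<open>
  The identification of \<open>M\<close> with the negative part of a prolongation is made explicit as
  an injective graded homomorphism \<open>i\<close>.
\<close>

definition effective_prolongation ::
  "('k::field, 'a) graded_struct \<Rightarrow> ('a \<Rightarrow> 'g) \<Rightarrow> ('k, 'g) graded_struct \<Rightarrow> bool" where
  "effective_prolongation M i G \<longleftrightarrow> fgla M \<and> graded_lie_algebra G \<and>
     i \<in> graded_lie_hom M G \<and> inj_on i (carrier M) \<and> i ` carrier M = graded_part G {..<0} \<and>
     {P \<in> graded_part G {0..}. \<forall>Q\<in>grade G (-1). bracket G P Q = \<zero>\<^bsub>G\<^esub>} = {\<zero>\<^bsub>G\<^esub>}"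

text \<open>
  Here \<open>e\<close> is the map that identifies \<open>V\<close> with the part of degree \<open>-1\<close> of \<open>G\<close>; it
  transports \<open>L \<subseteq> gl(V)\<close> to a set of endomorphisms of that part.
\<close>

definition of_type :: "('v \<Rightarrow> 'v) set \<Rightarrow> ('v \<Rightarrow> 'g) \<Rightarrow> ('k, 'g) graded_struct \<Rightarrow> bool" where
  "of_type L e G \<longleftrightarrow> (\<forall>A\<in>grade G 0. \<exists>T\<in>L. \<forall>v. bracket G A (e v) = e (T v))"

text \<open>
  HOL cannot quantify over types inside a formula: the competing prolongations \<open>H\<close> have
  their elements in the type \<open>'h\<close>, which is a parameter.
\<close>

definition maximal_effective_prolongation ::
  "'h itself \<Rightarrow> ('v \<Rightarrow> 'v) set \<Rightarrow> ('v \<Rightarrow> 'a) \<Rightarrow> ('k::field, 'a) graded_struct \<Rightarrow>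
    ('a \<Rightarrow> 'g) \<Rightarrow> ('k, 'g) graded_struct \<Rightarrow> bool" where
  "maximal_effective_prolongation (_ :: 'h itself) L e M i G \<longleftrightarrow>
     effective_prolongation M i G \<and> of_type L (i \<circ> e) G \<and>
     (\<forall>(H :: ('k, 'h) graded_struct) i'.
        effective_prolongation M i' H \<and> of_type L (i' \<circ> e) H \<longrightarrow>
        (\<exists>f\<in>graded_lie_hom H G. inj_on f (carrier H) \<and> (\<forall>x\<in>carrier M. f (i' x) = i x)))"

section \<open>The free Lie algebra of a vector space\<close>

text \<open>
  Lie expressions over \<open>V\<close>, modulo the least congruence that enforces the Lie algebra axioms
  and the linearity of the inclusion \<open>LGen\<close> of \<open>V\<close>.
\<close>

datatype ('k, 'v) lterm =
    LGen 'v
  | LZero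
  | LAdd "('k, 'v) lterm" "('k, 'v) lterm"
  | LSmult 'k "('k, 'v) lterm"
  | LBr "('k, 'v) lterm" "('k, 'v) lterm"

inductive lie_eq :: "('k::field \<Rightarrow> 'v::ab_group_add \<Rightarrow> 'v) \<Rightarrow>
    ('k, 'v) lterm \<Rightarrow> ('k, 'v) lterm \<Rightarrow> bool" for scale where
  refl: "lie_eq scale s s"
| sym: "lie_eq scale s t \<Longrightarrow> lie_eq scale t s"
| trans: "lie_eq scale s t \<Longrightarrow> lie_eq scale t u \<Longrightarrow> lie_eq scale s u"
| cong_add: "lie_eq scale s s' \<Longrightarrow> lie_eq scale t t' \<Longrightarrow> lie_eq scale (LAdd s t) (LAdd s' t')"
| cong_smult: "lie_eq scale s s' \<Longrightarrow> lie_eq scale (LSmult a s) (LSmult a s')"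
| cong_br: "lie_eq scale s s' \<Longrightarrow> lie_eq scale t t' \<Longrightarrow> lie_eq scale (LBr s t) (LBr s' t')"
| add_assoc: "lie_eq scale (LAdd (LAdd s t) u) (LAdd s (LAdd t u))"
| add_comm: "lie_eq scale (LAdd s t) (LAdd t s)"
| add_zero: "lie_eq scale (LAdd LZero s) s"
| add_neg: "lie_eq scale (LAdd (LSmult (-1) s) s) LZero"
| smult_add_right: "lie_eq scale (LSmult a (LAdd s t)) (LAdd (LSmult a s) (LSmult a t))"
| smult_add_left: "lie_eq scale (LSmult (a + b) s) (LAdd (LSmult a s) (LSmult b s))"
| smult_smult: "lie_eq scale (LSmult (a * b) s) (LSmult a (LSmult b s))"
| smult_one: "lie_eq scale (LSmult 1 s) s"
| br_add_left: "lie_eq scale (LBr (LAdd s t) u) (LAdd (LBr s u) (LBr t u))"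
| br_add_right: "lie_eq scale (LBr s (LAdd t u)) (LAdd (LBr s t) (LBr s u))"
| br_smult_left: "lie_eq scale (LBr (LSmult a s) t) (LSmult a (LBr s t))"
| br_smult_right: "lie_eq scale (LBr s (LSmult a t)) (LSmult a (LBr s t))"
| br_self: "lie_eq scale (LBr s s) LZero"
| br_jacobi: "lie_eq scale
    (LAdd (LAdd (LBr s (LBr t u)) (LBr t (LBr u s))) (LBr u (LBr s t))) LZero"
| gen_add: "lie_eq scale (LGen (v + w)) (LAdd (LGen v) (LGen w))"
| gen_smult: "lie_eq scale (LGen (scale a v)) (LSmult a (LGen v))"

inductive lhomogeneous :: "int \<Rightarrow> ('k, 'v) lterm \<Rightarrow> bool" where
  "lhomogeneous (-1) (LGen v)"
| "lhomogeneous p LZero"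
| "lhomogeneous p s \<Longrightarrow> lhomogeneous p t \<Longrightarrow> lhomogeneous p (LAdd s t)"
| "lhomogeneous p s \<Longrightarrow> lhomogeneous p (LSmult a s)"
| "lhomogeneous p s \<Longrightarrow> lhomogeneous q t \<Longrightarrow> lhomogeneous (p + q) (LBr s t)"

definition lcls :: "('k::field \<Rightarrow> 'v::ab_group_add \<Rightarrow> 'v) \<Rightarrow> ('k, 'v) lterm \<Rightarrow> ('k, 'v) lterm set" where
  "lcls scale t = {s. lie_eq scale t s}"

definition lrep :: "('k, 'v) lterm set \<Rightarrow> ('k, 'v) lterm" where
  "lrep P = (SOME t. t \<in> P)"

definition free_lie :: "('k::field \<Rightarrow> 'v::ab_group_add \<Rightarrow> 'v) \<Rightarrow>
    ('k, ('k, 'v) lterm set) graded_struct" where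
  "free_lie scale =
    \<lparr>carrier = range (lcls scale), monoid.mult = undefined, one = undefined,
     ring.zero = lcls scale LZero,
     add = (\<lambda>P Q. lcls scale (LAdd (lrep P) (lrep Q))),
     module.smult = (\<lambda>a P. lcls scale (LSmult a (lrep P))),
     bracket = (\<lambda>P Q. lcls scale (LBr (lrep P) (lrep Q))),
     grade = (\<lambda>p. lcls scale ` {t. lhomogeneous p t})\<rparr>"

section \<open>The Lie algebra of endomorphisms\<close>

definition gl_lie :: "('k::field \<Rightarrow> 'v::ab_group_add \<Rightarrow> 'v) \<Rightarrow> ('k, 'v \<Rightarrow> 'v) lie_struct" where
  "gl_lie scale =
    \<lparr>carrier = {f. Vector_Spaces.linear scale scale f}, monoid.mult = undefined, one = undefined,
     ring.zero = (\<lambda>_. 0),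
     add = (\<lambda>f g v. f v + g v),
     module.smult = (\<lambda>a f v. scale a (f v)),
     bracket = (\<lambda>f g v. f (g v) - g (f v))\<rparr>"

section \<open>The prolongation of the free Lie algebra\<close>

text \<open>
  A \<open>(p+1)\<close>-linear map is encoded as a function on lists that vanishes on lists of any
  other length. A function on lists thus stands for the sum of its restrictions to the lists of
  a given length.
\<close>

definition multilinear_maps ::
  "('k::field \<Rightarrow> 'v::ab_group_add \<Rightarrow> 'v) \<Rightarrow> nat \<Rightarrow> ('v list \<Rightarrow> 'v) set" where
  "multilinear_maps scale p = {\<xi>. (\<forall>vs. length vs \<noteq> p + 1 \<longrightarrow> \<xi> vs = 0) \<and>
     (\<forall>us ws. length us + length ws = p \<longrightarrow>
        Vector_Spaces.linear scale scale (\<lambda>v. \<xi> (us @ v # ws)))}"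

definition multilinear_maps_of_type ::
  "('k::field \<Rightarrow> 'v::ab_group_add \<Rightarrow> 'v) \<Rightarrow> ('v \<Rightarrow> 'v) set \<Rightarrow> nat \<Rightarrow> ('v list \<Rightarrow> 'v) set" where
  "multilinear_maps_of_type scale L p = {\<xi> \<in> multilinear_maps scale p.
     \<forall>vs. length vs = p \<longrightarrow> (\<lambda>v. \<xi> (vs @ [v])) \<in> L}"

definition list_fun_component :: "nat \<Rightarrow> ('v list \<Rightarrow> 'v::zero) \<Rightarrow> 'v list \<Rightarrow> 'v" where
  "list_fun_component p \<xi> = (\<lambda>vs. if length vs = p + 1 then \<xi> vs else 0)"

definition list_fun_sum :: "(nat \<Rightarrow> ('v list \<Rightarrow> 'v::zero) set) \<Rightarrow> ('v list \<Rightarrow> 'v) set" where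
  "list_fun_sum A = {\<xi>. \<xi> [] = 0 \<and> (\<forall>p. list_fun_component p \<xi> \<in> A p) \<and>
     finite {p. list_fun_component p \<xi> \<noteq> (\<lambda>_. 0)}}"

text \<open>
  The part of nonnegative degree of \<open>[\<xi>, v]\<close>. If \<open>\<xi>\<close> has a component of degree \<open>0\<close>,
  then \<open>[\<xi>, v]\<close> also has the component \<open>\<xi> [v]\<close> of degree \<open>-1\<close>.
\<close>

definition contract :: "('v list \<Rightarrow> 'v::zero) \<Rightarrow> 'v \<Rightarrow> 'v list \<Rightarrow> 'v" where
  "contract \<xi> v = (\<lambda>vs. if vs = [] then 0 else \<xi> (v # vs))"

text \<open>
  The bracket \<open>[\<xi>, X]\<close> of \<open>\<xi>\<close> of nonnegative degree with the class \<open>X\<close> of a Lie expression,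
  as a pair of a Lie expression and a part of nonnegative degree. The last equation is
  \<open>[\<xi>, [X, Y]] = [[\<xi>, X], Y] - [[\<xi>, Y], X]\<close>.
\<close>

primrec act :: "('k::field \<Rightarrow> 'v::ab_group_add \<Rightarrow> 'v) \<Rightarrow> ('k, 'v) lterm \<Rightarrow> ('v list \<Rightarrow> 'v) \<Rightarrow>
    ('k, 'v) lterm \<times> ('v list \<Rightarrow> 'v)" where
  "act scale (LGen v) \<xi> = (LGen (\<xi> [v]), contract \<xi> v)"
| "act scale LZero \<xi> = (LZero, \<lambda>_. 0)"
| "act scale (LAdd s t) \<xi> =
    (let (a, \<alpha>) = act scale s \<xi>; (b, \<beta>) = act scale t \<xi> in (LAdd a b, \<lambda>vs. \<alpha> vs + \<beta> vs))"
| "act scale (LSmult c s) \<xi> =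
    (let (a, \<alpha>) = act scale s \<xi> in (LSmult c a, \<lambda>vs. scale c (\<alpha> vs)))"
| "act scale (LBr s t) \<xi> =
    (let (a, \<alpha>) = act scale s \<xi>; (b, \<beta>) = act scale t \<xi>;
         (a', \<alpha>') = act scale t \<alpha>; (b', \<beta>') = act scale s \<beta>
     in (LAdd (LAdd (LBr a t) a') (LSmult (-1) (LAdd (LBr b s) b')), \<lambda>vs. \<alpha>' vs - \<beta>' vs))"

text \<open>
  The bracket of \<open>\<xi>\<close> and \<open>\<eta>\<close> of nonnegative degree, from
  \<open>[[\<xi>, \<eta>], v] = [[\<xi>, v], \<eta>] + [\<xi>, [\<eta>, v]]\<close>: the terms with \<open>\<xi> [v]\<close> and \<open>\<eta> [v]\<close> come
  from the parts of degree \<open>-1\<close> of \<open>[\<xi>, v]\<close> and \<open>[\<eta>, v]\<close>.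
\<close>

primrec nonneg_bracket :: "'v list \<Rightarrow> ('v list \<Rightarrow> 'v::ab_group_add) \<Rightarrow> ('v list \<Rightarrow> 'v) \<Rightarrow> 'v" where
  "nonneg_bracket [] \<xi> \<eta> = 0"
| "nonneg_bracket (v # vs) \<xi> \<eta> =
    (nonneg_bracket vs (contract \<xi> v) \<eta> - \<eta> (\<xi> [v] # vs)) +
    (nonneg_bracket vs \<xi> (contract \<eta> v) + \<xi> (\<eta> [v] # vs))"

definition incl :: "('k, 'v) lterm set \<Rightarrow> ('k, 'v) lterm set \<times> ('v list \<Rightarrow> 'v::zero)" where
  "incl P = (P, \<lambda>_. 0)"

text \<open>
  The graded Lie algebra \<open>F(V)\<close>, with elements \<open>(P, \<xi>)\<close> where \<open>P\<close> is the part of negative degree and \<open>\<xi>\<close> the part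
  of nonnegative degree. The bracket of mixed terms uses \<open>[P, \<eta>] = -[\<eta>, P]\<close>.
\<close>

definition full_prolongation :: "('k::field \<Rightarrow> 'v::ab_group_add \<Rightarrow> 'v) \<Rightarrow>
    ('k, ('k, 'v) lterm set \<times> ('v list \<Rightarrow> 'v)) graded_struct" where
  "full_prolongation scale =
    \<lparr>carrier = carrier (free_lie scale) \<times> list_fun_sum (multilinear_maps scale),
     monoid.mult = undefined, one = undefined,
     ring.zero = (\<zero>\<^bsub>free_lie scale\<^esub>, \<lambda>_. 0),
     add = (\<lambda>(P, \<xi>) (Q, \<eta>). (P \<oplus>\<^bsub>free_lie scale\<^esub> Q, \<lambda>vs. \<xi> vs + \<eta> vs)),
     module.smult = (\<lambda>a (P, \<xi>). (a \<odot>\<^bsub>free_lie scale\<^esub> P, \<lambda>vs. scale a (\<xi> vs))),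
     bracket = (\<lambda>(P, \<xi>) (Q, \<eta>).
       let (a, \<alpha>) = act scale (lrep Q) \<xi>; (b, \<beta>) = act scale (lrep P) \<eta>
       in (bracket (free_lie scale) P Q \<oplus>\<^bsub>free_lie scale\<^esub> lcls scale a \<ominus>\<^bsub>free_lie scale\<^esub> lcls scale b,
           \<lambda>vs. nonneg_bracket vs \<xi> \<eta> + \<alpha> vs - \<beta> vs)),
     grade = (\<lambda>p. if p < 0 then grade (free_lie scale) p \<times> {\<lambda>_. 0}
                  else {\<zero>\<^bsub>free_lie scale\<^esub>} \<times> multilinear_maps scale (nat p))\<rparr>"

definition prolongation_of_type ::
  "('k::field \<Rightarrow> 'v::ab_group_add \<Rightarrow> 'v) \<Rightarrow> ('v \<Rightarrow> 'v) set \<Rightarrow>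
    (('k, 'v) lterm set \<times> ('v list \<Rightarrow> 'v)) set" where
  "prolongation_of_type scale L =
     carrier (free_lie scale) \<times> list_fun_sum (multilinear_maps_of_type scale L)"

definition normalizer_alg ::
  "('k::field \<Rightarrow> 'v::ab_group_add \<Rightarrow> 'v) \<Rightarrow> ('k, 'v) lterm set set \<Rightarrow> ('v \<Rightarrow> 'v) set \<Rightarrow>
    ('k, ('k, 'v) lterm set \<times> ('v list \<Rightarrow> 'v)) graded_struct" where
  "normalizer_alg scale \<K> L = graded_restrict (full_prolongation scale)
     {\<xi> \<in> prolongation_of_type scale L.
        \<forall>k \<in> incl ` \<K>. bracket (full_prolongation scale) \<xi> k \<in> incl ` \<K>}"

definition m_alg ::
  "('k::field \<Rightarrow> 'v::ab_group_add \<Rightarrow> 'v) \<Rightarrow> ('k, 'v) lterm set set \<Rightarrow>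
    ('k, ('k, 'v) lterm set set) graded_struct" where
  "m_alg scale \<K> = lie_quotient (free_lie scale) \<K>"

definition g_alg ::
  "('k::field \<Rightarrow> 'v::ab_group_add \<Rightarrow> 'v) \<Rightarrow> ('k, 'v) lterm set set \<Rightarrow> ('v \<Rightarrow> 'v) set \<Rightarrow>
    ('k, (('k, 'v) lterm set \<times> ('v list \<Rightarrow> 'v)) set) graded_struct" where
  "g_alg scale \<K> L = lie_quotient (normalizer_alg scale \<K> L) (incl ` \<K>)"

definition gen_m ::
  "('k::field \<Rightarrow> 'v::ab_group_add \<Rightarrow> 'v) \<Rightarrow> ('k, 'v) lterm set set \<Rightarrow> 'v \<Rightarrow> ('k, 'v) lterm set set" where
  "gen_m scale \<K> v = \<K> +>\<^bsub>free_lie scale\<^esub> lcls scale (LGen v)"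

definition m_to_g ::
  "('k::field \<Rightarrow> 'v::ab_group_add \<Rightarrow> 'v) \<Rightarrow> ('k, 'v) lterm set set \<Rightarrow> ('v \<Rightarrow> 'v) set \<Rightarrow>
    ('k, 'v) lterm set set \<Rightarrow> (('k, 'v) lterm set \<times> ('v list \<Rightarrow> 'v)) set" where
  "m_to_g scale \<K> L P = (\<Union>x\<in>P. incl ` \<K> +>\<^bsub>normalizer_alg scale \<K> L\<^esub> incl x)"

end

theory Submission
  imports Defs "HOL-Library.Function_Algebras"
begin

text \<open>
  An element \<open>\<xi>\<close> of nonnegative degree of \<open>F(V)\<close> acts on the free Lie algebra through
  \<open>[\<xi>, [s, t]] = [[\<xi>, s], t] - [[\<xi>, t], s]\<close>, which is a commutator of operators; hence the
  action is well defined on the free Lie algebra and \<open>F(V)\<close> satisfies the Jacobi identity. The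
  identity of \<open>V\<close> in degree \<open>0\<close> acts on degree \<open>p\<close> by \<open>p\<close>, up to sign, so in characteristic
  zero the homogeneous parts are eigenspaces and their sum is direct. The normalizer of a graded
  subspace is graded, and the quotient by \<open>\<K>\<close> is effective because \<open>\<K>\<close> does not meet the
  parts of degree \<open>\<ge> -1\<close>. If \<open>H\<close> is another effective prolongation, \<open>h \<in> H\<close> of degree
  \<open>p \<ge> 0\<close> defines the map \<open>\<xi>\<^sub>h(v\<^sub>0, \<dots>, v\<^sub>p) = [\<dots>[h, v\<^sub>0], \<dots>, v\<^sub>p] \<in> V\<close>. The brackets of
  \<open>F(V)\<close> are determined by repeated bracketing with \<open>V\<close>, so \<open>h \<mapsto> \<xi>\<^sub>h\<close> is a homomorphism
  and \<open>\<xi>\<^sub>h\<close> preserves \<open>\<K>\<close>; it is injective by effectivity. An endomorphism of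
  \<open>g(\<K>, L)\<close> over \<open>m(\<K>)\<close> is the identity, again by effectivity, which gives uniqueness.
\<close>



section \<open>A type that contains all Lie algebras over a given type\<close>

text \<open>The degrees of the free Lie algebra are defined on terms, and the relations identify
  homogeneous terms with mixed ones, so that directness of the sum is not visible there. It is
  detected by an element outside \<open>f(V)\<close>; hence F(V) must be known to be a Lie algebra
  before \<open>f(V)\<close> can be graded. Elements of a competitor H need not be homogeneous
  either. Therefore \<xi> collects all degrees in one function on lists, and h is compared with F(V)
  through a splitting \<open>h = img s \<oplus> g\<close> in which the term s is determined only
  modulo \<K>. Such splittings obey the bracket formula of F(V) literally, and the ambiguity of s
  disappears in the quotient. The map attached to h normalizes \<K> because the elements of \<K> are
  zero in H, so that bracketing with them gives zero.\<close>

lemma carrier_ring_of_type [simp]: "carrier (ring_of_type_algebra :: 'k::ring_1 ring) = UNIV"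
  and add_ring_of_type [simp]: "a \<oplus>\<^bsub>ring_of_type_algebra\<^esub> b = (a + b :: 'k)"
  and mult_ring_of_type [simp]: "a \<otimes>\<^bsub>ring_of_type_algebra\<^esub> b = (a * b :: 'k)"
  and one_ring_of_type [simp]: "\<one>\<^bsub>ring_of_type_algebra\<^esub> = (1 :: 'k)"
  and zero_ring_of_type [simp]: "\<zero>\<^bsub>ring_of_type_algebra\<^esub> = (0 :: 'k)"
  by (simp_all add: ring_of_type_algebra_def)

lemma lie_algebra_zero_closed: "lie_algebra G \<Longrightarrow> \<zero>\<^bsub>G\<^esub> \<in> carrier G"
  and lie_algebra_add_closed:
    "lie_algebra G \<Longrightarrow> x \<in> carrier G \<Longrightarrow> y \<in> carrier G \<Longrightarrow> x \<oplus>\<^bsub>G\<^esub> y \<in> carrier G"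
  and lie_algebra_neg_closed: "lie_algebra G \<Longrightarrow> x \<in> carrier G \<Longrightarrow> \<ominus>\<^bsub>G\<^esub> x \<in> carrier G"
  and lie_algebra_minus_closed:
    "lie_algebra G \<Longrightarrow> x \<in> carrier G \<Longrightarrow> y \<in> carrier G \<Longrightarrow> x \<ominus>\<^bsub>G\<^esub> y \<in> carrier G"
  and lie_algebra_smult_closed: "lie_algebra G \<Longrightarrow> x \<in> carrier G \<Longrightarrow> a \<odot>\<^bsub>G\<^esub> x \<in> carrier G"
  and lie_algebra_bracket_closed:
    "lie_algebra G \<Longrightarrow> x \<in> carrier G \<Longrightarrow> y \<in> carrier G \<Longrightarrow> bracket G x y \<in> carrier G"
proof -
  assume G: "lie_algebra G"
  interpret lie_algebra G by (rule G)
  show "\<zero>\<^bsub>G\<^esub> \<in> carrier G" by simp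
  show "x \<in> carrier G \<Longrightarrow> y \<in> carrier G \<Longrightarrow> x \<oplus>\<^bsub>G\<^esub> y \<in> carrier G" by simp
  show "x \<in> carrier G \<Longrightarrow> \<ominus>\<^bsub>G\<^esub> x \<in> carrier G" by simp
  show "x \<in> carrier G \<Longrightarrow> y \<in> carrier G \<Longrightarrow> x \<ominus>\<^bsub>G\<^esub> y \<in> carrier G" by simp
  show "x \<in> carrier G \<Longrightarrow> a \<odot>\<^bsub>G\<^esub> x \<in> carrier G" by (rule smult_closed) auto
  show "x \<in> carrier G \<Longrightarrow> y \<in> carrier G \<Longrightarrow> bracket G x y \<in> carrier G" by (rule bracket_closed)
qed

lemmas lie_algebra_closed = lie_algebra_zero_closed lie_algebra_add_closed lie_algebra_neg_closed
  lie_algebra_minus_closed lie_algebra_smult_closed lie_algebra_bracket_closed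

text \<open>
  The Lie algebras with elements in a given type are subsets of that type. They all embed into
  their product, which is a type: an identity between elements of one of them can then be
  proved by rewriting in a type of class \<^class>\<open>ab_group_add\<close>, without closure conditions.
\<close>

typedef (overloaded) ('k::field, 'g) lie_product =
  "{f :: ('k, 'g) graded_struct \<Rightarrow> 'g. \<forall>G. f G \<in> (if lie_algebra G then carrier G else {undefined})}"
  by (rule exI[of _ "\<lambda>G. if lie_algebra G then \<zero>\<^bsub>G\<^esub> else undefined"])
     (simp add: lie_algebra_closed)

setup_lifting type_definition_lie_product

instantiation lie_product :: (field, type) ab_group_add
begin

text \<open>At an index that is not a Lie algebra the only admissible value is
  \<open>undefined\<close>; equality in the product is thus decided at the genuine Lie algebras, and
  each operation there is the one of the factor.\<close>

lift_definition zero_lie_product :: "('a, 'b) lie_product"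
  is "\<lambda>G. if lie_algebra G then \<zero>\<^bsub>G\<^esub> else undefined"
  by (simp add: lie_algebra_closed)

lift_definition plus_lie_product ::
  "('a, 'b) lie_product \<Rightarrow> ('a, 'b) lie_product \<Rightarrow> ('a, 'b) lie_product"
  is "\<lambda>x y G. if lie_algebra G then x G \<oplus>\<^bsub>G\<^esub> y G else undefined"
  by (metis insertCI lie_algebra_closed(2))

lift_definition uminus_lie_product :: "('a, 'b) lie_product \<Rightarrow> ('a, 'b) lie_product"
  is "\<lambda>x G. if lie_algebra G then \<ominus>\<^bsub>G\<^esub> x G else undefined"
  by (metis insertCI lie_algebra_closed(3))

definition minus_lie_product ::
  "('a, 'b) lie_product \<Rightarrow> ('a, 'b) lie_product \<Rightarrow> ('a, 'b) lie_product" where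
  "minus_lie_product x y = x + - y"

instance
proof
  fix x y z :: "('a, 'b) lie_product"
  have grp: "abelian_group G" if "lie_algebra G" for G :: "('a, 'b) graded_struct"
    using that by (simp add: lie_algebra_def Module.module_def)
  show "x + y + z = x + (y + z)"
    by transfer (auto simp: fun_eq_iff abelian_group.axioms grp intro!: abelian_monoid.a_assoc split: if_splits)
  show "x + y = y + x"
    by transfer (auto simp: fun_eq_iff abelian_group.axioms grp intro!: abelian_monoid.a_comm split: if_splits)
  show "0 + x = x"
    by transfer (auto simp: fun_eq_iff abelian_group.axioms grp intro!: abelian_monoid.l_zero split: if_splits)
  show "- x + x = 0"
    by transfer (auto simp: fun_eq_iff abelian_group.axioms grp intro!: abelian_group.l_neg split: if_splits)
  show "x - y = x + - y"
    by (simp add: minus_lie_product_def)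
qed

end

lift_definition lscale :: "'k::field \<Rightarrow> ('k, 'g) lie_product \<Rightarrow> ('k, 'g) lie_product"
  is "\<lambda>a x G. if lie_algebra G then a \<odot>\<^bsub>G\<^esub> x G else undefined"
  by (metis insertCI lie_algebra_closed(5))

lift_definition lbr ::
  "('k::field, 'g) lie_product \<Rightarrow> ('k, 'g) lie_product \<Rightarrow> ('k, 'g) lie_product"
  is "\<lambda>x y G. if lie_algebra G then bracket G (x G) (y G) else undefined"
  by (metis insertCI lie_algebra_closed(6))

global_interpretation lie_product: vector_space "lscale :: 'k::field \<Rightarrow> ('k, 'g) lie_product \<Rightarrow> _"
proof
  fix a b :: 'k and x y :: "('k, 'g) lie_product"
  have mod: "Module.module (ring_of_type_algebra :: 'k ring) G"
    if "lie_algebra G" for G :: "('k, 'g) graded_struct"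
    using that by (simp add: lie_algebra_def)
  show "lscale a (x + y) = lscale a x + lscale a y"
    by transfer (auto simp: fun_eq_iff intro!: Module.module.smult_r_distr[OF mod] split: if_splits)
  show "lscale (a + b) x = lscale a x + lscale b x"
    by transfer (auto simp: fun_eq_iff
        intro!: Module.module.smult_l_distr[OF mod, simplified] split: if_splits)
  show "lscale a (lscale b x) = lscale (a * b) x"
    by transfer (auto simp: fun_eq_iff
        intro!: Module.module.smult_assoc1[OF mod, simplified, symmetric] split: if_splits)
  show "lscale 1 x = x"
    by transfer (auto simp: fun_eq_iff
        intro!: Module.module.smult_one[OF mod, simplified] split: if_splits)
qed

lemma lbr_add_left: "lbr (x + y) z = lbr x z + lbr y z"
  by transfer (auto simp: fun_eq_iff intro!: lie_algebra.bracket_add_left split: if_splits)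

lemma lbr_add_right: "lbr x (y + z) = lbr x y + lbr x z"
  by transfer (auto simp: fun_eq_iff intro!: lie_algebra.bracket_add_right split: if_splits)

lemma lbr_scale_left: "lbr (lscale a x) y = lscale a (lbr x y)"
  by transfer (auto simp: fun_eq_iff intro!: lie_algebra.bracket_smult_left split: if_splits)

lemma lbr_scale_right: "lbr x (lscale a y) = lscale a (lbr x y)"
  by transfer (auto simp: fun_eq_iff intro!: lie_algebra.bracket_smult_right split: if_splits)

lemma lbr_self [simp]: "lbr x x = 0"
  by transfer (auto simp: fun_eq_iff intro!: lie_algebra.bracket_self split: if_splits)

lemma lbr_jacobi: "lbr x (lbr y z) + lbr y (lbr z x) + lbr z (lbr x y) = 0"
  by transfer (auto simp: fun_eq_iff intro!: lie_algebra.jacobi split: if_splits)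

lemma lbr_zero_left [simp]: "lbr 0 x = 0"
  using lbr_add_left[of 0 0 x] by simp

lemma lbr_zero_right [simp]: "lbr x 0 = 0"
  using lbr_add_right[of x 0 0] by simp

lemma lbr_minus_left: "lbr (- x) y = - lbr x y"
  using lbr_add_left[of "- x" x y] by (simp add: eq_neg_iff_add_eq_0)

lemma lbr_minus_right: "lbr x (- y) = - lbr x y"
  using lbr_add_right[of x "- y" y] by (simp add: eq_neg_iff_add_eq_0)

lemma lbr_diff_left: "lbr (x - y) z = lbr x z - lbr y z"
  by (simp only: diff_conv_add_uminus lbr_add_left lbr_minus_left)

lemma lbr_diff_right: "lbr x (y - z) = lbr x y - lbr x z"
  by (simp only: diff_conv_add_uminus lbr_add_right lbr_minus_right)

lemma lbr_antisym: "lbr x y = - lbr y x"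
proof -
  have "lbr x y + lbr y x = lbr (x + y) (x + y)"
    unfolding lbr_add_left lbr_add_right by simp
  then show ?thesis by (simp add: eq_neg_iff_add_eq_0)
qed

text \<open>Jacobi in the shape in which \<open>act\<close> is defined on \<open>LBr\<close>:
  right-nested brackets become differences of left-normed ones. Rewriting with it reduces the later
  Jacobi-type identities to cancellation in an abelian group.\<close>

lemma lbr_lbr: "lbr x (lbr y z) = lbr (lbr x y) z - lbr (lbr x z) y"
proof -
  have "lbr y (lbr z x) = lbr (lbr x z) y"
    by (subst lbr_antisym, subst lbr_antisym[of z x]) (simp add: lbr_minus_left)
  moreover have "lbr z (lbr x y) = - lbr (lbr x y) z"
    by (rule lbr_antisym)
  ultimately have "lbr x (lbr y z) + lbr (lbr x z) y + - lbr (lbr x y) z = 0"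
    using lbr_jacobi[of x y z] by argo
  then show ?thesis by (simp add: algebra_simps)
qed

lemmas lbr_simps = lbr_add_left lbr_add_right lbr_diff_left lbr_diff_right lbr_minus_left
  lbr_minus_right lbr_scale_left lbr_scale_right

text \<open>The inclusion of one factor, zero in every coordinate other than G. An argument outside
  the carrier is sent to 0, which makes the map total; injectivity and additivity are claimed on the
  carrier.\<close>

lift_definition lemb :: "('k::field, 'g) graded_struct \<Rightarrow> 'g \<Rightarrow> ('k, 'g) lie_product"
  is "\<lambda>G x G'. if lie_algebra G' then if G' = G \<and> x \<in> carrier G then x else \<zero>\<^bsub>G'\<^esub> else undefined"
  by (auto simp: lie_algebra_closed)

context
  fixes G :: "('k::field, 'g) graded_struct"
  assumes G: "lie_algebra G"
begin

text \<open>Read from right to left it moves an equation of G to the product, where the laws of a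
  vector space hold without membership conditions; many identities in an abstract G are proved in
  this way.\<close>

lemma lemb_inject: "x \<in> carrier G \<Longrightarrow> y \<in> carrier G \<Longrightarrow> lemb G x = lemb G y \<longleftrightarrow> x = y"
  using G by (metis lemb.rep_eq)

lemma lemb_zero: "lemb G \<zero>\<^bsub>G\<^esub> = 0"
  by (rule Rep_lie_product_inject[THEN iffD1])
     (simp add: fun_eq_iff lemb.rep_eq zero_lie_product.rep_eq)

lemma lemb_add: "x \<in> carrier G \<Longrightarrow> y \<in> carrier G \<Longrightarrow> lemb G (x \<oplus>\<^bsub>G\<^esub> y) = lemb G x + lemb G y"
  by (rule Rep_lie_product_inject[THEN iffD1])
     (auto simp: fun_eq_iff lemb.rep_eq plus_lie_product.rep_eq lie_algebra_closed lie_algebra_def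
        Module.module_def abelian_group_def abelian_monoid.l_zero abelian_monoid.zero_closed)

lemma lemb_smult: "x \<in> carrier G \<Longrightarrow> lemb G (a \<odot>\<^bsub>G\<^esub> x) = lscale a (lemb G x)"
  by (rule Rep_lie_product_inject[THEN iffD1])
     (auto simp: fun_eq_iff lemb.rep_eq lscale.rep_eq lie_algebra_closed G
        intro!: Module.module.smult_r_null[symmetric] lie_algebra.axioms)

lemma lemb_bracket:
  "x \<in> carrier G \<Longrightarrow> y \<in> carrier G \<Longrightarrow> lemb G (bracket G x y) = lbr (lemb G x) (lemb G y)"
  by (rule Rep_lie_product_inject[THEN iffD1])
     (auto simp: fun_eq_iff lemb.rep_eq lbr.rep_eq lie_algebra_closed G lie_algebra.bracket_self)

interpretation lie_algebra G by (rule G)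

lemma lemb_neg: "x \<in> carrier G \<Longrightarrow> lemb G (\<ominus>\<^bsub>G\<^esub> x) = - lemb G x"
  using lemb_add[of "\<ominus>\<^bsub>G\<^esub> x" x] lemb_zero by (simp add: eq_neg_iff_add_eq_0 l_neg)

lemma lemb_minus: "x \<in> carrier G \<Longrightarrow> y \<in> carrier G \<Longrightarrow> lemb G (x \<ominus>\<^bsub>G\<^esub> y) = lemb G x - lemb G y"
  by (simp add: a_minus_def lemb_add lemb_neg)

lemma lemb_finsum: "finite A \<Longrightarrow> f \<in> A \<rightarrow> carrier G \<Longrightarrow> lemb G (finsum G f A) = (\<Sum>a\<in>A. lemb G (f a))"
proof (induction A rule: finite_induct)
  case (insert a A)
  then show ?case by (simp add: M.finsum_insert lemb_add)
qed (simp add: lemb_zero)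

end

lemmas lemb_simps = lie_algebra_closed lemb_zero lemb_add lemb_smult lemb_bracket lemb_neg lemb_minus

lemma smult_neg_one:
  fixes G :: "('k::field, 'g) graded_struct"
  shows "lie_algebra G \<Longrightarrow> x \<in> carrier G \<Longrightarrow> (- 1) \<odot>\<^bsub>G\<^esub> x = \<ominus>\<^bsub>G\<^esub> x"
  by (subst lemb_inject[of G, symmetric]) (simp_all add: lemb_simps)

lemma lie_algebraI:
  fixes G :: "('k::field, 'g) graded_struct" (structure)
  assumes "\<zero> \<in> carrier G"
    and add: "\<And>x y. x \<in> carrier G \<Longrightarrow> y \<in> carrier G \<Longrightarrow> x \<oplus> y \<in> carrier G"
    and sm: "\<And>a x. x \<in> carrier G \<Longrightarrow> a \<odot> x \<in> carrier G"
    and br: "\<And>x y. x \<in> carrier G \<Longrightarrow> y \<in> carrier G \<Longrightarrow> bracket G x y \<in> carrier G"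
    and assoc: "\<And>x y z. x \<in> carrier G \<Longrightarrow> y \<in> carrier G \<Longrightarrow> z \<in> carrier G \<Longrightarrow>
      (x \<oplus> y) \<oplus> z = x \<oplus> (y \<oplus> z)"
    and comm: "\<And>x y. x \<in> carrier G \<Longrightarrow> y \<in> carrier G \<Longrightarrow> x \<oplus> y = y \<oplus> x"
    and "\<And>x. x \<in> carrier G \<Longrightarrow> \<zero> \<oplus> x = x"
    and neg: "\<And>x. x \<in> carrier G \<Longrightarrow> ((- 1) \<odot> x) \<oplus> x = \<zero>"
    and smr: "\<And>a x y. x \<in> carrier G \<Longrightarrow> y \<in> carrier G \<Longrightarrow> a \<odot> (x \<oplus> y) = (a \<odot> x) \<oplus> (a \<odot> y)"
    and sml: "\<And>a b x. x \<in> carrier G \<Longrightarrow> (a + b) \<odot> x = (a \<odot> x) \<oplus> (b \<odot> x)"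
    and smm: "\<And>a b x. x \<in> carrier G \<Longrightarrow> (a * b) \<odot> x = a \<odot> (b \<odot> x)"
    and sm1: "\<And>x. x \<in> carrier G \<Longrightarrow> 1 \<odot> x = x"
    and "\<And>x y z. x \<in> carrier G \<Longrightarrow> y \<in> carrier G \<Longrightarrow> z \<in> carrier G \<Longrightarrow>
      bracket G (x \<oplus> y) z = bracket G x z \<oplus> bracket G y z"
    and "\<And>x y z. x \<in> carrier G \<Longrightarrow> y \<in> carrier G \<Longrightarrow> z \<in> carrier G \<Longrightarrow>
      bracket G x (y \<oplus> z) = bracket G x y \<oplus> bracket G x z"
    and "\<And>a x y. x \<in> carrier G \<Longrightarrow> y \<in> carrier G \<Longrightarrow> bracket G (a \<odot> x) y = a \<odot> bracket G x y"
    and "\<And>a x y. x \<in> carrier G \<Longrightarrow> y \<in> carrier G \<Longrightarrow> bracket G x (a \<odot> y) = a \<odot> bracket G x y"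
    and "\<And>x. x \<in> carrier G \<Longrightarrow> bracket G x x = \<zero>"
    and "\<And>x y z. x \<in> carrier G \<Longrightarrow> y \<in> carrier G \<Longrightarrow> z \<in> carrier G \<Longrightarrow>
      bracket G x (bracket G y z) \<oplus> bracket G y (bracket G z x) \<oplus> bracket G z (bracket G x y) = \<zero>"
  shows "lie_algebra G"
proof -
  have "abelian_group G"
  proof (rule abelian_groupI)
    show "\<exists>y\<in>carrier G. y \<oplus> x = \<zero>" if "x \<in> carrier G" for x
      using neg sm that by blast
  qed (rule assms; assumption)+
  then have "Module.module (ring_of_type_algebra :: 'k ring) G"
    by (intro moduleI) (simp_all add: sm smr sml smm sm1 cring_from_type_algebra)
  then show ?thesis
    by (rule lie_algebra.intro) (rule lie_algebra_axioms.intro; rule assms; assumption)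
qed


section \<open>Graded Lie algebras\<close>

context
  fixes G :: "('k::field, 'g) graded_struct"
  assumes G: "lie_algebra G"
begin

interpretation lie_algebra G by (rule G)

lemma submodule_of_lieI:
  assumes "H \<subseteq> carrier G" "\<zero>\<^bsub>G\<^esub> \<in> H" "\<And>x y. x \<in> H \<Longrightarrow> y \<in> H \<Longrightarrow> x \<oplus>\<^bsub>G\<^esub> y \<in> H"
    and sm: "\<And>a x. x \<in> H \<Longrightarrow> a \<odot>\<^bsub>G\<^esub> x \<in> H"
  shows "Module.submodule H (ring_of_type_algebra :: 'k ring) G"
proof (rule submoduleI)
  show "\<ominus>\<^bsub>G\<^esub> x \<in> H" if "x \<in> H" for x
    using sm[OF that, of "- 1"] smult_neg_one[OF G, of x] assms(1) that by auto
qed (use assms in auto)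

lemma submodule_of_lieD:
  assumes "Module.submodule H (ring_of_type_algebra :: 'k ring) G"
  shows submodule_of_lie_subset: "H \<subseteq> carrier G"
    and submodule_of_lie_zero: "\<zero>\<^bsub>G\<^esub> \<in> H"
    and submodule_of_lie_add: "\<And>x y. x \<in> H \<Longrightarrow> y \<in> H \<Longrightarrow> x \<oplus>\<^bsub>G\<^esub> y \<in> H"
    and submodule_of_lie_smult: "\<And>a x. x \<in> H \<Longrightarrow> a \<odot>\<^bsub>G\<^esub> x \<in> H"
    and submodule_of_lie_neg: "\<And>x. x \<in> H \<Longrightarrow> \<ominus>\<^bsub>G\<^esub> x \<in> H"
    and submodule_of_lie_minus: "\<And>x y. x \<in> H \<Longrightarrow> y \<in> H \<Longrightarrow> x \<ominus>\<^bsub>G\<^esub> y \<in> H"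
proof -
  note E = submoduleE[OF assms]
  show "H \<subseteq> carrier G" by (rule E)
  show add: "\<And>x y. x \<in> H \<Longrightarrow> y \<in> H \<Longrightarrow> x \<oplus>\<^bsub>G\<^esub> y \<in> H" by (rule E)
  show "\<And>a x. x \<in> H \<Longrightarrow> a \<odot>\<^bsub>G\<^esub> x \<in> H" by (rule E) auto
  show neg: "\<And>x. x \<in> H \<Longrightarrow> \<ominus>\<^bsub>G\<^esub> x \<in> H" by (rule E)
  show "\<And>x y. x \<in> H \<Longrightarrow> y \<in> H \<Longrightarrow> x \<ominus>\<^bsub>G\<^esub> y \<in> H"
    unfolding a_minus_def by (intro add neg)
  obtain x where "x \<in> H" using E(2) by blast
  then have "x \<oplus>\<^bsub>G\<^esub> \<ominus>\<^bsub>G\<^esub> x \<in> H" "x \<in> carrier G" using add neg E(1) by auto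
  then show "\<zero>\<^bsub>G\<^esub> \<in> H" by (simp add: r_neg)
qed

lemma submodule_of_lie_finsum:
  assumes H: "Module.submodule H (ring_of_type_algebra :: 'k ring) G"
    and "finite A" "\<And>a. a \<in> A \<Longrightarrow> c a \<in> H"
  shows "finsum G c A \<in> H"
  using assms(2,3)
proof (induction A rule: finite_induct)
  case empty
  then show ?case using submodule_of_lie_zero[OF H] by simp
next
  case (insert a A)
  then have "c \<in> A \<rightarrow> carrier G" "c a \<in> carrier G" using submodule_of_lie_subset[OF H] by auto
  with insert show ?case using submodule_of_lie_add[OF H] by (simp add: M.finsum_insert)
qed

end

text \<open>The axioms are universally quantified equations, so they survive any surjection q
  compatible with the operations. For a quotient, q sends an element to its coset.\<close>

lemma lie_algebra_image:
  fixes G :: "('k::field, 'g) graded_struct" and Q :: "('k, 'h) graded_struct"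
  assumes G: "lie_algebra G" and Q: "carrier Q = q ` carrier G"
    and Q_zero: "\<zero>\<^bsub>Q\<^esub> = q \<zero>\<^bsub>G\<^esub>"
    and add: "\<And>x y. x \<in> carrier G \<Longrightarrow> y \<in> carrier G \<Longrightarrow> q x \<oplus>\<^bsub>Q\<^esub> q y = q (x \<oplus>\<^bsub>G\<^esub> y)"
    and sm: "\<And>a x. x \<in> carrier G \<Longrightarrow> a \<odot>\<^bsub>Q\<^esub> q x = q (a \<odot>\<^bsub>G\<^esub> x)"
    and br: "\<And>x y. x \<in> carrier G \<Longrightarrow> y \<in> carrier G \<Longrightarrow> bracket Q (q x) (q y) = q (bracket G x y)"
  shows "lie_algebra Q"
proof -
  interpret lie_algebra G by (rule G)
  note closed [simp] = lie_algebra_closed[OF G]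
  note simps [simp] = Q_zero add sm br
  note in_Q [elim!] = imageE[of _ q "carrier G"]
  show ?thesis
  proof (rule lie_algebraI, unfold Q)
    show "\<zero>\<^bsub>Q\<^esub> \<in> q ` carrier G" by simp
    fix x assume x: "x \<in> q ` carrier G"
    show "1 \<odot>\<^bsub>Q\<^esub> x = x"
      using x smult_one by force
    show "\<zero>\<^bsub>Q\<^esub> \<oplus>\<^bsub>Q\<^esub> x = x" "((- 1) \<odot>\<^bsub>Q\<^esub> x) \<oplus>\<^bsub>Q\<^esub> x = \<zero>\<^bsub>Q\<^esub>"
      "bracket Q x x = \<zero>\<^bsub>Q\<^esub>"
      using x by (auto simp: smult_neg_one[OF G] M.l_neg bracket_self)
    fix a b
    show "a \<odot>\<^bsub>Q\<^esub> x \<in> q ` carrier G" using x by auto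
    show "(a + b) \<odot>\<^bsub>Q\<^esub> x = (a \<odot>\<^bsub>Q\<^esub> x) \<oplus>\<^bsub>Q\<^esub> (b \<odot>\<^bsub>Q\<^esub> x)"
      using x smult_l_distr[of a b] by auto
    show "(a * b) \<odot>\<^bsub>Q\<^esub> x = a \<odot>\<^bsub>Q\<^esub> (b \<odot>\<^bsub>Q\<^esub> x)"
      using x smult_assoc1[of a b] by auto
    fix y assume y: "y \<in> q ` carrier G"
    show "x \<oplus>\<^bsub>Q\<^esub> y \<in> q ` carrier G" "bracket Q x y \<in> q ` carrier G"
      using x y by auto
    show "x \<oplus>\<^bsub>Q\<^esub> y = y \<oplus>\<^bsub>Q\<^esub> x"
      using x y M.a_comm by auto
    show "a \<odot>\<^bsub>Q\<^esub> (x \<oplus>\<^bsub>Q\<^esub> y) = (a \<odot>\<^bsub>Q\<^esub> x) \<oplus>\<^bsub>Q\<^esub> (a \<odot>\<^bsub>Q\<^esub> y)"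
      "bracket Q (a \<odot>\<^bsub>Q\<^esub> x) y = a \<odot>\<^bsub>Q\<^esub> bracket Q x y" "bracket Q x (a \<odot>\<^bsub>Q\<^esub> y) = a \<odot>\<^bsub>Q\<^esub> bracket Q x y"
      using x y by (auto simp: smult_r_distr bracket_smult_left bracket_smult_right)
    fix z assume z: "z \<in> q ` carrier G"
    show "x \<oplus>\<^bsub>Q\<^esub> y \<oplus>\<^bsub>Q\<^esub> z = x \<oplus>\<^bsub>Q\<^esub> (y \<oplus>\<^bsub>Q\<^esub> z)"
      using x y z by (auto simp: M.a_assoc)
    show "bracket Q (x \<oplus>\<^bsub>Q\<^esub> y) z = bracket Q x z \<oplus>\<^bsub>Q\<^esub> bracket Q y z"
      "bracket Q x (y \<oplus>\<^bsub>Q\<^esub> z) = bracket Q x y \<oplus>\<^bsub>Q\<^esub> bracket Q x z"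
      using x y z by (auto simp: bracket_add_left bracket_add_right)
    show "bracket Q x (bracket Q y z) \<oplus>\<^bsub>Q\<^esub> bracket Q y (bracket Q z x) \<oplus>\<^bsub>Q\<^esub> bracket Q z (bracket Q x y) = \<zero>\<^bsub>Q\<^esub>"
      using x y z by (auto simp: jacobi)
  qed
qed

lemma finsum_eq_iff_lemb:
  fixes G :: "('k::field, 'g) graded_struct"
  assumes "lie_algebra G" "finite A" "c \<in> A \<rightarrow> carrier G" "x \<in> carrier G"
  shows "x = finsum G c A \<longleftrightarrow> lemb G x = (\<Sum>a\<in>A. lemb G (c a))"
proof -
  interpret lie_algebra G by (rule assms)
  show ?thesis
    using assms by (simp add: lemb_inject[of G x "finsum G c A", symmetric] lemb_finsum)
qed

lemma lbr_sum_left: "lbr (\<Sum>a\<in>A. f a) y = (\<Sum>a\<in>A. lbr (f a) y)"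
  by (induction A rule: infinite_finite_induct) (simp_all add: lbr_add_left)

lemma graded_lie_algebra_lie: "graded_lie_algebra G \<Longrightarrow> lie_algebra G"
  by (simp add: graded_lie_algebra_def)

section \<open>Homogeneous components\<close>

definition component :: "('k, 'g) graded_struct \<Rightarrow> 'g \<Rightarrow> int \<Rightarrow> 'g" where
  "component G x = (THE c. (\<forall>p. c p \<in> grade G p) \<and> finite {p. c p \<noteq> \<zero>\<^bsub>G\<^esub>} \<and>
     x = (\<Oplus>\<^bsub>G\<^esub>p\<in>{p. c p \<noteq> \<zero>\<^bsub>G\<^esub>}. c p))"

context
  fixes G :: "('k::field, 'g) graded_struct"
  assumes graded: "graded_lie_algebra G"
begin

interpretation graded_lie_algebra G by (rule graded)

lemmas G = graded_lie_algebra_lie[OF graded]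

lemma grade_subset: "grade G p \<subseteq> carrier G"
  by (rule submodule_of_lie_subset[OF G grade_submodule])

lemma grade_carrier: "x \<in> grade G p \<Longrightarrow> x \<in> carrier G"
  using grade_subset by blast

lemma zero_grade: "\<zero>\<^bsub>G\<^esub> \<in> grade G p"
  by (rule submodule_of_lie_zero[OF G grade_submodule])

lemma component_props:
  assumes "x \<in> carrier G"
  shows component_grade: "component G x p \<in> grade G p"
    and component_finite: "finite {p. component G x p \<noteq> \<zero>\<^bsub>G\<^esub>}"
    and component_finsum: "x = finsum G (component G x) {p. component G x p \<noteq> \<zero>\<^bsub>G\<^esub>}"
  using theI'[OF decomposition[OF assms], folded component_def] by blast+

lemma component_carrier: "x \<in> carrier G \<Longrightarrow> component G x p \<in> carrier G"
  using component_grade grade_carrier by blast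

lemma lemb_eq_sum_components:
  assumes "x \<in> carrier G" "finite A" "\<And>p. p \<notin> A \<Longrightarrow> component G x p = \<zero>\<^bsub>G\<^esub>"
  shows "lemb G x = (\<Sum>p\<in>A. lemb G (component G x p))"
proof -
  have "lemb G x = (\<Sum>p | component G x p \<noteq> \<zero>\<^bsub>G\<^esub>. lemb G (component G x p))"
    using component_finsum[OF assms(1)] component_finite[OF assms(1)] component_carrier[OF assms(1)]
    by (subst (asm) finsum_eq_iff_lemb) (auto simp: G assms)
  also have "\<dots> = (\<Sum>p\<in>A. lemb G (component G x p))"
    by (rule sum.mono_neutral_left) (use assms in \<open>auto simp: lemb_zero[OF G]\<close>)
  finally show ?thesis .
qed

text \<open>The index set A may exceed the support of c, which allows the supports of several
  elements to be merged before sums are compared. The sum is taken in the product type, where zero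
  summands can be added or dropped freely.\<close>

lemma component_unique:
  assumes x: "x \<in> carrier G" and A: "finite A" and c: "\<And>p. c p \<in> grade G p"
    and out: "\<And>p. p \<notin> A \<Longrightarrow> c p = \<zero>\<^bsub>G\<^esub>"
    and sum: "lemb G x = (\<Sum>p\<in>A. lemb G (c p))"
  shows "component G x = c"
proof -
  have sub: "{p. c p \<noteq> \<zero>\<^bsub>G\<^esub>} \<subseteq> A" using out by blast
  have fin: "finite {p. c p \<noteq> \<zero>\<^bsub>G\<^esub>}" using sub A by (rule finite_subset)
  have "lemb G x = (\<Sum>p | c p \<noteq> \<zero>\<^bsub>G\<^esub>. lemb G (c p))"
    unfolding sum by (rule sum.mono_neutral_right) (use A sub in \<open>auto simp: lemb_zero[OF G]\<close>)
  then have "x = finsum G c {p. c p \<noteq> \<zero>\<^bsub>G\<^esub>}"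
    by (subst finsum_eq_iff_lemb) (use G fin c grade_carrier x in auto)
  with fin c show ?thesis
    unfolding component_def by (intro the1_equality decomposition x) auto
qed

lemma component_homogeneous:
  assumes "x \<in> grade G q"
  shows "component G x p = (if p = q then x else \<zero>\<^bsub>G\<^esub>)"
  by (rule fun_cong[OF component_unique[of _ "{q}"]])
     (use assms grade_carrier zero_grade in auto)

lemma component_zero: "component G \<zero>\<^bsub>G\<^esub> p = \<zero>\<^bsub>G\<^esub>"
  using component_homogeneous[OF zero_grade, of p p] by simp

lemma finite_common_support:
  assumes "x \<in> carrier G" "y \<in> carrier G"
  obtains A where "finite A" "\<And>p. p \<notin> A \<Longrightarrow> component G x p = \<zero>\<^bsub>G\<^esub>" "\<And>p. p \<notin> A \<Longrightarrow> component G y p = \<zero>\<^bsub>G\<^esub>"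
  using component_finite[OF assms(1)] component_finite[OF assms(2)]
  by (intro that[of "{p. component G x p \<noteq> \<zero>\<^bsub>G\<^esub>} \<union> {p. component G y p \<noteq> \<zero>\<^bsub>G\<^esub>}"]) auto

lemma component_add:
  assumes x: "x \<in> carrier G" and y: "y \<in> carrier G"
  shows "component G (x \<oplus>\<^bsub>G\<^esub> y) p = component G x p \<oplus>\<^bsub>G\<^esub> component G y p"
proof -
  obtain A where A: "finite A" "\<And>p. p \<notin> A \<Longrightarrow> component G x p = \<zero>\<^bsub>G\<^esub>" "\<And>p. p \<notin> A \<Longrightarrow> component G y p = \<zero>\<^bsub>G\<^esub>"
    by (rule finite_common_support[OF assms]) (rule that)
  have "component G (x \<oplus>\<^bsub>G\<^esub> y) = (\<lambda>p. component G x p \<oplus>\<^bsub>G\<^esub> component G y p)"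
  proof (rule component_unique)
    show "component G x p \<oplus>\<^bsub>G\<^esub> component G y p \<in> grade G p" for p
      by (intro submodule_of_lie_add[OF G grade_submodule] component_grade assms)
    show "lemb G (x \<oplus>\<^bsub>G\<^esub> y) = (\<Sum>p\<in>A. lemb G (component G x p \<oplus>\<^bsub>G\<^esub> component G y p))"
      using A lemb_eq_sum_components[OF x A(1)] lemb_eq_sum_components[OF y A(1)]
      by (simp add: lemb_add[OF G] component_carrier x y sum.distrib)
  qed (use A x y in auto)
  then show ?thesis by simp
qed

lemma component_smult:
  assumes x: "x \<in> carrier G"
  shows "component G (a \<odot>\<^bsub>G\<^esub> x) p = a \<odot>\<^bsub>G\<^esub> component G x p"
proof -
  obtain A where A: "finite A" "\<And>p. p \<notin> A \<Longrightarrow> component G x p = \<zero>\<^bsub>G\<^esub>"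
    by (rule finite_common_support[OF x x]) (rule that)
  have "component G (a \<odot>\<^bsub>G\<^esub> x) = (\<lambda>p. a \<odot>\<^bsub>G\<^esub> component G x p)"
  proof (rule component_unique)
    show "a \<odot>\<^bsub>G\<^esub> component G x p \<in> grade G p" for p
      by (intro submodule_of_lie_smult[OF G grade_submodule] component_grade assms)
    show "lemb G (a \<odot>\<^bsub>G\<^esub> x) = (\<Sum>p\<in>A. lemb G (a \<odot>\<^bsub>G\<^esub> component G x p))"
      using A lemb_eq_sum_components[OF x A(1)]
      by (simp add: lemb_smult[OF G] component_carrier x lie_product.scale_sum_right)
  qed (use A x in \<open>auto simp: lie_algebra_closed[OF G]\<close>)
  then show ?thesis by simp
qed

text \<open>Bracketing with y shifts every degree by q, so the brackets of the components of x form
  a homogeneous decomposition; uniqueness of components does the rest.\<close>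

lemma component_bracket:
  assumes x: "x \<in> carrier G" and y: "y \<in> grade G q"
  shows "component G (bracket G x y) r = bracket G (component G x (r - q)) y"
proof -
  obtain A where A: "finite A" "\<And>p. p \<notin> A \<Longrightarrow> component G x p = \<zero>\<^bsub>G\<^esub>"
    by (rule finite_common_support[OF x x]) (rule that)
  note y' = grade_carrier[OF y]
  have zero: "bracket G \<zero>\<^bsub>G\<^esub> y = \<zero>\<^bsub>G\<^esub>"
    by (subst lemb_inject[OF G, symmetric]) (simp_all add: lemb_simps[OF G] y')
  have "component G (bracket G x y) = (\<lambda>r. bracket G (component G x (r - q)) y)"
  proof (rule component_unique)
    show "bracket G (component G x (r - q)) y \<in> grade G r" for r
      using bracket_grade[OF component_grade[OF x, of "r - q"] y] by simp
    show "bracket G (component G x (r - q)) y = \<zero>\<^bsub>G\<^esub>" if "r \<notin> (\<lambda>p. p + q) ` A" for r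
    proof -
      have "r - q \<notin> A" using that by (metis diff_add_cancel imageI)
      then show ?thesis using A zero by simp
    qed
    have "lemb G (bracket G x y) = (\<Sum>p\<in>A. lemb G (bracket G (component G x p) y))"
      using A lemb_eq_sum_components[OF x A(1)]
      by (simp add: lemb_bracket[OF G] component_carrier x y' lbr_sum_left)
    also have "\<dots> = (\<Sum>r\<in>(\<lambda>p. p + q) ` A. lemb G (bracket G (component G x (r - q)) y))"
      by (subst sum.reindex) (auto simp: inj_on_def)
    finally show "lemb G (bracket G x y) = (\<Sum>r\<in>(\<lambda>p. p + q) ` A. lemb G (bracket G (component G x (r - q)) y))" .
  qed (use A x y' lie_algebra_closed[OF G] in auto)
  then show ?thesis by simp
qed

lemma eq_zero_of_components:
  assumes "x \<in> carrier G" "\<And>p. component G x p = \<zero>\<^bsub>G\<^esub>"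
  shows "x = \<zero>\<^bsub>G\<^esub>"
  using lemb_eq_sum_components[OF assms(1), of "{}"] assms
  by (simp add: lemb_inject[OF G, of x "\<zero>\<^bsub>G\<^esub>", symmetric] lemb_simps[OF G])

lemma graded_induct:
  assumes x: "x \<in> carrier G" and hom: "\<And>p y. y \<in> grade G p \<Longrightarrow> P y"
    and add: "\<And>y z. y \<in> carrier G \<Longrightarrow> z \<in> carrier G \<Longrightarrow> P y \<Longrightarrow> P z \<Longrightarrow> P (y \<oplus>\<^bsub>G\<^esub> z)"
  shows "P x"
proof -
  have "finsum G (component G x) A \<in> carrier G \<and> P (finsum G (component G x) A)" if "finite A" for A
    using that
  proof (induction A rule: finite_induct)
    case empty
    then show ?case using hom[OF zero_grade] by simp
  next
    case (insert p A)
    then show ?case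
      using hom[OF component_grade[OF x]] add component_carrier[OF x] by (simp add: M.finsum_insert Pi_def)
  qed
  from this[OF component_finite[OF x]] component_finsum[OF x] show ?thesis by simp
qed

lemma component_finsum_homogeneous:
  assumes "finite A" "\<And>p. p \<in> A \<Longrightarrow> c p \<in> grade G p"
  shows "component G (finsum G c A) p = (if p \<in> A then c p else \<zero>\<^bsub>G\<^esub>)"
proof -
  have cc: "c \<in> A \<rightarrow> carrier G" using assms grade_carrier by blast
  then have x: "finsum G c A \<in> carrier G" by auto
  have "component G (finsum G c A) = (\<lambda>p. if p \<in> A then c p else \<zero>\<^bsub>G\<^esub>)"
  proof (rule component_unique)
    show "lemb G (finsum G c A) = (\<Sum>p\<in>A. lemb G (if p \<in> A then c p else \<zero>\<^bsub>G\<^esub>))"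
      using finsum_eq_iff_lemb[OF G \<open>finite A\<close> cc x] by simp
  qed (use assms x zero_grade in auto)
  then show ?thesis by simp
qed

text \<open>Membership is defined by the existence of some homogeneous sum over P. Uniqueness makes
  that sum the canonical one, so only the vanishing of the components outside P has to be
  tested.\<close>

lemma graded_part_iff:
  "x \<in> graded_part G P \<longleftrightarrow> x \<in> carrier G \<and> (\<forall>p. p \<notin> P \<longrightarrow> component G x p = \<zero>\<^bsub>G\<^esub>)"
proof
  assume "x \<in> graded_part G P"
  then obtain c A where *: "x = finsum G c A" "finite A" "A \<subseteq> P" "\<And>p. p \<in> A \<Longrightarrow> c p \<in> grade G p"
    unfolding graded_part_def by blast
  have "c \<in> A \<rightarrow> carrier G" using * grade_carrier by blast
  then have "x \<in> carrier G" unfolding *(1) by (rule M.finsum_closed)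
  with *(3) show "x \<in> carrier G \<and> (\<forall>p. p \<notin> P \<longrightarrow> component G x p = \<zero>\<^bsub>G\<^esub>)"
    using component_finsum_homogeneous[OF *(2,4)] *(1) by auto
next
  assume "x \<in> carrier G \<and> (\<forall>p. p \<notin> P \<longrightarrow> component G x p = \<zero>\<^bsub>G\<^esub>)"
  then show "x \<in> graded_part G P"
    unfolding graded_part_def
    using component_finsum component_finite component_grade by blast
qed

end

section \<open>Criteria for a grading\<close>

lemma ex_sum_homogeneous:
  fixes G :: "('k::field, 'g) graded_struct"
  assumes G: "lie_algebra G"
    and sub: "\<And>p. Module.submodule (grade G p) (ring_of_type_algebra :: 'k ring) G"
    and span: "\<And>U. U \<subseteq> carrier G \<Longrightarrow> (\<And>p. grade G p \<subseteq> U) \<Longrightarrow>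
      (\<And>x y. x \<in> U \<Longrightarrow> y \<in> U \<Longrightarrow> x \<oplus>\<^bsub>G\<^esub> y \<in> U) \<Longrightarrow> carrier G \<subseteq> U"
    and x: "x \<in> carrier G"
  shows "\<exists>A c. finite A \<and> (\<forall>p. c p \<in> grade G p) \<and> (\<forall>p. p \<notin> A \<longrightarrow> c p = \<zero>\<^bsub>G\<^esub>) \<and> lemb G x = (\<Sum>p\<in>A. lemb G (c p))"
proof -
  interpret lie_algebra G by (rule G)
  have gc: "grade G p \<subseteq> carrier G" for p using submodule_of_lie_subset[OF G sub] .
  let ?U = "{x \<in> carrier G. \<exists>A c. finite A \<and> (\<forall>p. c p \<in> grade G p) \<and> (\<forall>p. p \<notin> A \<longrightarrow> c p = \<zero>\<^bsub>G\<^esub>) \<and>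
      lemb G x = (\<Sum>p\<in>A. lemb G (c p))}"
  have "carrier G \<subseteq> ?U"
  proof (rule span)
    show "grade G p \<subseteq> ?U" for p
    proof
      fix x assume x: "x \<in> grade G p"
      let ?c = "\<lambda>q. if q = p then x else \<zero>\<^bsub>G\<^esub>"
      have "finite {p} \<and> (\<forall>q. ?c q \<in> grade G q) \<and> (\<forall>q. q \<notin> {p} \<longrightarrow> ?c q = \<zero>\<^bsub>G\<^esub>) \<and> lemb G x = (\<Sum>q\<in>{p}. lemb G (?c q))"
        using x submodule_of_lie_zero[OF G sub] by auto
      then show "x \<in> ?U" using x gc[of p] by (intro CollectI conjI exI[of _ "{p}"] exI[of _ ?c]) auto
    qed
    fix x y assume "x \<in> ?U" "y \<in> ?U"
    then obtain A c B d where x: "x \<in> carrier G" "finite A" "\<And>p. c p \<in> grade G p" "\<And>p. p \<notin> A \<Longrightarrow> c p = \<zero>\<^bsub>G\<^esub>"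
        "lemb G x = (\<Sum>p\<in>A. lemb G (c p))"
      and y: "y \<in> carrier G" "finite B" "\<And>p. d p \<in> grade G p" "\<And>p. p \<notin> B \<Longrightarrow> d p = \<zero>\<^bsub>G\<^esub>"
        "lemb G y = (\<Sum>p\<in>B. lemb G (d p))" by blast
    have "lemb G x = (\<Sum>p\<in>A \<union> B. lemb G (c p))" "lemb G y = (\<Sum>p\<in>A \<union> B. lemb G (d p))"
      unfolding x(5) y(5) by (rule sum.mono_neutral_left; use x(2,4) y(2,4) in \<open>auto simp: lemb_zero[OF G]\<close>)+
    moreover have "c p \<in> carrier G" "d p \<in> carrier G" for p using x(3) y(3) gc by blast+
    ultimately have "lemb G (x \<oplus>\<^bsub>G\<^esub> y) = (\<Sum>p\<in>A \<union> B. lemb G (c p \<oplus>\<^bsub>G\<^esub> d p))"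
      using x(1) y(1) by (simp add: lemb_add[OF G] sum.distrib)
    moreover have "\<forall>p. c p \<oplus>\<^bsub>G\<^esub> d p \<in> grade G p" using x(3) y(3) submodule_of_lie_add[OF G sub] by blast
    moreover have "\<forall>p. p \<notin> A \<union> B \<longrightarrow> c p \<oplus>\<^bsub>G\<^esub> d p = \<zero>\<^bsub>G\<^esub>" using x(4) y(4) by simp
    moreover have "finite (A \<union> B)" "x \<oplus>\<^bsub>G\<^esub> y \<in> carrier G" using x y by simp_all
    ultimately show "x \<oplus>\<^bsub>G\<^esub> y \<in> ?U"
      by (intro CollectI conjI exI[of _ "A \<union> B"] exI[of _ "\<lambda>p. c p \<oplus>\<^bsub>G\<^esub> d p"])
  qed (rule Collect_restrict)
  from subsetD[OF this x] show ?thesis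
    by (elim CollectE conjE)
qed

text \<open>Spanning is expressed through additive subsets U that contain all homogeneous parts; the
  elements with a homogeneous decomposition form such a U, which gives existence. Independence,
  applied to the differences \<open>c p \<ominus> d p\<close> over the union of both supports, gives
  uniqueness.\<close>

lemma graded_lie_algebraI:
  fixes G :: "('k::field, 'g) graded_struct"
  assumes G: "lie_algebra G"
    and sub: "\<And>p. Module.submodule (grade G p) (ring_of_type_algebra :: 'k ring) G"
    and span: "\<And>U. U \<subseteq> carrier G \<Longrightarrow> (\<And>p. grade G p \<subseteq> U) \<Longrightarrow>
      (\<And>x y. x \<in> U \<Longrightarrow> y \<in> U \<Longrightarrow> x \<oplus>\<^bsub>G\<^esub> y \<in> U) \<Longrightarrow> carrier G \<subseteq> U"
    and indep: "\<And>A c. finite A \<Longrightarrow> (\<And>p. p \<in> A \<Longrightarrow> c p \<in> grade G p) \<Longrightarrow>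
      finsum G c A = \<zero>\<^bsub>G\<^esub> \<Longrightarrow> \<forall>p\<in>A. c p = \<zero>\<^bsub>G\<^esub>"
    and br: "\<And>x y p q. x \<in> grade G p \<Longrightarrow> y \<in> grade G q \<Longrightarrow> bracket G x y \<in> grade G (p + q)"
  shows "graded_lie_algebra G"
proof -
  interpret lie_algebra G by (rule G)
  have gc: "x \<in> carrier G" if "x \<in> grade G p" for x p
    using that submodule_of_lie_subset[OF G sub] by blast
  define good where "good c x \<longleftrightarrow> (\<forall>p. c p \<in> grade G p) \<and> finite {p. c p \<noteq> \<zero>\<^bsub>G\<^esub>} \<and>
      x = (\<Oplus>\<^bsub>G\<^esub>p\<in>{p. c p \<noteq> \<zero>\<^bsub>G\<^esub>}. c p)" for c x
  have goodI: "good c x" if "x \<in> carrier G" "finite A" "\<And>p. c p \<in> grade G p"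
    "\<And>p. p \<notin> A \<Longrightarrow> c p = \<zero>\<^bsub>G\<^esub>" "lemb G x = (\<Sum>p\<in>A. lemb G (c p))" for c x A
  proof -
    have s: "{p. c p \<noteq> \<zero>\<^bsub>G\<^esub>} \<subseteq> A" using that by blast
    have f: "finite {p. c p \<noteq> \<zero>\<^bsub>G\<^esub>}" using s that(2) by (rule finite_subset)
    have "lemb G x = (\<Sum>p | c p \<noteq> \<zero>\<^bsub>G\<^esub>. lemb G (c p))"
      unfolding that(5) by (rule sum.mono_neutral_right) (use that s in \<open>auto simp: lemb_zero[OF G]\<close>)
    then have "x = finsum G c {p. c p \<noteq> \<zero>\<^bsub>G\<^esub>}"
      by (subst finsum_eq_iff_lemb) (use G f gc that in auto)
    then show ?thesis unfolding good_def using f that by blast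
  qed
  have goodD: "lemb G x = (\<Sum>p\<in>A. lemb G (c p))" if "good c x" "finite A" "{p. c p \<noteq> \<zero>\<^bsub>G\<^esub>} \<subseteq> A" for c x A
  proof -
    have c: "c p \<in> carrier G" for p using that gc unfolding good_def by blast
    then have x: "x \<in> carrier G" using that unfolding good_def by auto
    have "lemb G x = (\<Sum>p | c p \<noteq> \<zero>\<^bsub>G\<^esub>. lemb G (c p))"
      using that(1) finsum_eq_iff_lemb[OF G _ _ x, of "{p. c p \<noteq> \<zero>\<^bsub>G\<^esub>}" c] c unfolding good_def by auto
    also have "\<dots> = (\<Sum>p\<in>A. lemb G (c p))"
      by (rule sum.mono_neutral_left) (use that in \<open>auto simp: lemb_zero[OF G]\<close>)
    finally show ?thesis .
  qed
  have ex: "\<exists>c. good c x" if x: "x \<in> carrier G" for x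
  proof -
    obtain A c where "finite A" "\<And>p. c p \<in> grade G p" "\<And>p. p \<notin> A \<Longrightarrow> c p = \<zero>\<^bsub>G\<^esub>" "lemb G x = (\<Sum>p\<in>A. lemb G (c p))"
      using ex_sum_homogeneous[OF G sub span x] by blast
    then show ?thesis using goodI[OF x] by blast
  qed
  have uniq: "c = d" if c: "good c x" and d: "good d x" for c d x
  proof -
    define A where "A = {p. c p \<noteq> \<zero>\<^bsub>G\<^esub>} \<union> {p. d p \<noteq> \<zero>\<^bsub>G\<^esub>}"
    have A: "finite A" using c d unfolding A_def good_def by blast
    have cd: "c p \<in> grade G p" "d p \<in> grade G p" for p using c d unfolding good_def by blast+
    have "(\<Sum>p\<in>A. lemb G (c p \<ominus>\<^bsub>G\<^esub> d p)) = 0"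
      using goodD[OF c A] goodD[OF d A] gc[OF cd(1)] gc[OF cd(2)]
      by (simp add: lemb_minus[OF G] sum_subtractf A_def)
    then have "finsum G (\<lambda>p. c p \<ominus>\<^bsub>G\<^esub> d p) A = \<zero>\<^bsub>G\<^esub>"
      using finsum_eq_iff_lemb[OF G A, of "\<lambda>p. c p \<ominus>\<^bsub>G\<^esub> d p" "\<zero>\<^bsub>G\<^esub>"] gc[OF cd(1)] gc[OF cd(2)]
      by (simp add: lemb_zero[OF G])
    with indep[OF A, of "\<lambda>p. c p \<ominus>\<^bsub>G\<^esub> d p"] have z: "c p \<ominus>\<^bsub>G\<^esub> d p = \<zero>\<^bsub>G\<^esub>" if "p \<in> A" for p
      using submodule_of_lie_minus[OF G sub] cd that by blast
    have "c p = d p" for p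
    proof (cases "p \<in> A")
      case True
      then have "lemb G (c p) - lemb G (d p) = 0"
        using z gc[OF cd(1)] gc[OF cd(2)] by (simp flip: lemb_minus[OF G] lemb_zero[OF G])
      then show ?thesis using lemb_inject[OF G gc[OF cd(1)] gc[OF cd(2)]] by simp
    qed (simp add: A_def)
    then show ?thesis by blast
  qed
  show ?thesis
  proof (intro graded_lie_algebra.intro graded_lie_algebra_axioms.intro G sub br)
    show "\<exists>!c. (\<forall>p. c p \<in> grade G p) \<and> finite {p. c p \<noteq> \<zero>\<^bsub>G\<^esub>} \<and> x = (\<Oplus>\<^bsub>G\<^esub>p\<in>{p. c p \<noteq> \<zero>\<^bsub>G\<^esub>}. c p)"
      if "x \<in> carrier G" for x
      unfolding good_def[symmetric] using ex[OF that] uniq by blast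
  qed
qed


section \<open>Homomorphisms, graded subalgebras and quotients\<close>

context
  fixes G :: "('k::field, 'g) graded_struct" and H :: "('k, 'h) graded_struct" and f :: "'g \<Rightarrow> 'h"
  assumes f: "f \<in> graded_lie_hom G H"
begin

lemma graded_lie_homD:
  shows hom_carrier: "x \<in> carrier G \<Longrightarrow> f x \<in> carrier H"
    and hom_add: "x \<in> carrier G \<Longrightarrow> y \<in> carrier G \<Longrightarrow> f (x \<oplus>\<^bsub>G\<^esub> y) = f x \<oplus>\<^bsub>H\<^esub> f y"
    and hom_smult: "x \<in> carrier G \<Longrightarrow> f (a \<odot>\<^bsub>G\<^esub> x) = a \<odot>\<^bsub>H\<^esub> f x"
    and hom_bracket: "x \<in> carrier G \<Longrightarrow> y \<in> carrier G \<Longrightarrow> f (bracket G x y) = bracket H (f x) (f y)"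
    and hom_grade: "x \<in> grade G p \<Longrightarrow> f x \<in> grade H p"
  using f by (auto simp: graded_lie_hom_def image_subset_iff)

text \<open>Preservation of zero is no clause of \<open>graded_lie_hom\<close>; it follows from
  compatibility with scalars, as zero is 0 times itself.\<close>

lemma hom_zero: "lie_algebra G \<Longrightarrow> lie_algebra H \<Longrightarrow> f \<zero>\<^bsub>G\<^esub> = \<zero>\<^bsub>H\<^esub>"
proof -
  assume G: "lie_algebra G" and H: "lie_algebra H"
  have *: "f \<zero>\<^bsub>G\<^esub> \<in> carrier H" by (simp add: hom_carrier lie_algebra_closed[OF G])
  have "\<zero>\<^bsub>G\<^esub> = 0 \<odot>\<^bsub>G\<^esub> \<zero>\<^bsub>G\<^esub>"
    by (subst lemb_inject[OF G, symmetric]) (simp_all add: lemb_simps[OF G])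
  then have "f \<zero>\<^bsub>G\<^esub> = 0 \<odot>\<^bsub>H\<^esub> f \<zero>\<^bsub>G\<^esub>"
    by (metis hom_smult lie_algebra_zero_closed[OF G])
  also have "\<dots> = \<zero>\<^bsub>H\<^esub>"
    by (subst lemb_inject[OF H, symmetric]) (simp_all add: lemb_simps[OF H] *)
  finally show ?thesis .
qed

lemma hom_minus: "lie_algebra G \<Longrightarrow> lie_algebra H \<Longrightarrow> x \<in> carrier G \<Longrightarrow> y \<in> carrier G \<Longrightarrow>
    f (x \<ominus>\<^bsub>G\<^esub> y) = f x \<ominus>\<^bsub>H\<^esub> f y"
  by (simp add: a_minus_def lie_algebra_closed hom_carrier hom_add hom_smult flip: smult_neg_one)

lemma hom_finsum:
  assumes G: "lie_algebra G" and H: "lie_algebra H" and "finite A" "c \<in> A \<rightarrow> carrier G"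
  shows "f (finsum G c A) = finsum H (\<lambda>a. f (c a)) A"
proof -
  interpret G: lie_algebra G by (rule G)
  interpret H: lie_algebra H by (rule H)
  show ?thesis using assms(3,4)
  proof (induction A rule: finite_induct)
    case empty
    then show ?case using hom_zero[OF G H] by simp
  next
    case (insert a A)
    then have "c \<in> A \<rightarrow> carrier G" "c a \<in> carrier G" "(\<lambda>a. f (c a)) \<in> A \<rightarrow> carrier H" "f (c a) \<in> carrier H"
      "finsum G c A \<in> carrier G"
      using hom_carrier by auto
    with insert show ?case by (simp add: hom_add)
  qed
qed

lemma hom_component:
  assumes G: "graded_lie_algebra G" and H: "graded_lie_algebra H" and x: "x \<in> carrier G"
  shows "component H (f x) p = f (component G x p)"
proof -
  note G' = graded_lie_algebra_lie[OF G] and H' = graded_lie_algebra_lie[OF H]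
  let ?A = "{p. component G x p \<noteq> \<zero>\<^bsub>G\<^esub>}"
  have "f x = finsum H (\<lambda>p. f (component G x p)) ?A"
    using hom_finsum[OF G' H' component_finite[OF G x], of "component G x"]
      component_finsum[OF G x] component_carrier[OF G x] by simp
  then have "component H (f x) p = (if p \<in> ?A then f (component G x p) else \<zero>\<^bsub>H\<^esub>)"
    using component_finsum_homogeneous[OF H component_finite[OF G x], of "\<lambda>p. f (component G x p)"]
      hom_grade component_grade[OF G x] by simp
  then show ?thesis using hom_zero[OF G' H'] by simp
qed

end

lemma graded_lie_hom_comp:
  assumes "f \<in> graded_lie_hom G H" "g \<in> graded_lie_hom H M"
  shows "g \<circ> f \<in> graded_lie_hom G M"
  using assms unfolding graded_lie_hom_def Pi_def by (auto simp: image_subset_iff)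

section \<open>Graded subalgebras\<close>

context
  fixes G :: "('k::field, 'g) graded_struct" and H :: "'g set"
  assumes G: "lie_algebra G" and H: "lie_subalgebra H G"
begin

lemma lie_subalgebraD:
  shows lie_subalgebra_submodule: "Module.submodule H (ring_of_type_algebra :: 'k ring) G"
    and lie_subalgebra_bracket: "x \<in> H \<Longrightarrow> y \<in> H \<Longrightarrow> bracket G x y \<in> H"
  using H by (auto simp: lie_subalgebra_def)

lemmas sub_closed = submodule_of_lie_zero[OF G lie_subalgebra_submodule]
  submodule_of_lie_add[OF G lie_subalgebra_submodule] submodule_of_lie_smult[OF G lie_subalgebra_submodule]
  lie_subalgebra_bracket

lemma graded_restrict_lie_algebra: "lie_algebra (graded_restrict G H)"
proof -
  interpret lie_algebra G by (rule G)
  have sub: "x \<in> carrier G" if "x \<in> H" for x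
    using that submodule_of_lie_subset[OF G lie_subalgebra_submodule] by blast
  show ?thesis
  proof (rule lie_algebraI)
    fix a b x
    assume "x \<in> carrier (graded_restrict G H)"
    then show "(a + b) \<odot>\<^bsub>graded_restrict G H\<^esub> x = (a \<odot>\<^bsub>graded_restrict G H\<^esub> x) \<oplus>\<^bsub>graded_restrict G H\<^esub> (b \<odot>\<^bsub>graded_restrict G H\<^esub> x)"
      "(a * b) \<odot>\<^bsub>graded_restrict G H\<^esub> x = a \<odot>\<^bsub>graded_restrict G H\<^esub> (b \<odot>\<^bsub>graded_restrict G H\<^esub> x)"
      "1 \<odot>\<^bsub>graded_restrict G H\<^esub> x = x"
      using smult_l_distr[of a b x] smult_assoc1[of a b x] smult_one[of x] sub
      by (simp_all add: graded_restrict_def)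
    show "x \<oplus>\<^bsub>graded_restrict G H\<^esub> y = y \<oplus>\<^bsub>graded_restrict G H\<^esub> x"
      if "x \<in> carrier (graded_restrict G H)" "y \<in> carrier (graded_restrict G H)" for x y
      using that sub M.a_comm by (simp add: graded_restrict_def)
    show "x \<oplus>\<^bsub>graded_restrict G H\<^esub> y \<oplus>\<^bsub>graded_restrict G H\<^esub> z = x \<oplus>\<^bsub>graded_restrict G H\<^esub> (y \<oplus>\<^bsub>graded_restrict G H\<^esub> z)"
      if "x \<in> carrier (graded_restrict G H)" "y \<in> carrier (graded_restrict G H)" "z \<in> carrier (graded_restrict G H)" for x y z
      using that sub M.a_assoc by (simp add: graded_restrict_def)
  qed (simp_all add: graded_restrict_def sub_closed sub smult_neg_one[OF G] M.l_neg
      smult_r_distr bracket_add_left bracket_add_right bracket_smult_left bracket_smult_right bracket_self jacobi)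
qed

lemma finsum_graded_restrict:
  assumes "finite A" "c \<in> A \<rightarrow> H"
  shows "finsum (graded_restrict G H) c A = finsum G c A"
proof -
  interpret G: lie_algebra G by (rule G)
  interpret R: lie_algebra "graded_restrict G H" by (rule graded_restrict_lie_algebra)
  have sub: "H \<subseteq> carrier G" by (rule submodule_of_lie_subset[OF G lie_subalgebra_submodule])
  show ?thesis using assms
  proof (induction A rule: finite_induct)
    case empty
    show ?case
      unfolding R.M.finsum_empty G.M.finsum_empty by (simp add: graded_restrict_def)
  next
    case (insert a A)
    then have c: "c \<in> A \<rightarrow> carrier G" "c a \<in> carrier G" "c \<in> A \<rightarrow> carrier (graded_restrict G H)"
      "c a \<in> carrier (graded_restrict G H)"
      using sub by (auto simp: graded_restrict_def)
    moreover have "finsum (graded_restrict G H) c A = finsum G c A" using insert by auto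
    ultimately show ?case
      unfolding R.M.finsum_insert[OF insert(1,2) c(3,4)] G.M.finsum_insert[OF insert(1,2) c(1,2)]
      by (simp add: graded_restrict_def)
  qed
qed

end

text \<open>Closure under components is what makes a subalgebra graded: the decomposition in G then
  takes place inside H, and independence is inherited from G.\<close>

lemma graded_restrict_graded:
  fixes G :: "('k::field, 'g) graded_struct"
  assumes graded: "graded_lie_algebra G" and H: "lie_subalgebra H G"
    and comp: "\<And>x p. x \<in> H \<Longrightarrow> component G x p \<in> H"
  shows "graded_lie_algebra (graded_restrict G H)"
proof -
  interpret graded_lie_algebra G by (rule graded)
  note G = graded_lie_algebra_lie[OF graded]
  note R = graded_restrict_lie_algebra[OF G H]
  note closed = sub_closed[OF G H]
  interpret R: lie_algebra "graded_restrict G H" by (rule R)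
  have sub: "H \<subseteq> carrier G" by (rule submodule_of_lie_subset[OF G lie_subalgebra_submodule[OF G H]])
  have gr: "grade (graded_restrict G H) p = grade G p \<inter> H" for p by (simp add: graded_restrict_def)
  show ?thesis
  proof (rule graded_lie_algebraI[OF R])
    show "Module.submodule (grade (graded_restrict G H) p) (ring_of_type_algebra :: 'k ring) (graded_restrict G H)" for p
      using submodule_of_lie_add[OF G grade_submodule[of p]] submodule_of_lie_smult[OF G grade_submodule[of p]]
      by (intro submodule_of_lieI[OF R])
         (auto simp: graded_restrict_def closed zero_grade[OF graded])
    show "carrier (graded_restrict G H) \<subseteq> U" if U: "U \<subseteq> carrier (graded_restrict G H)"
      "\<And>p. grade (graded_restrict G H) p \<subseteq> U"
      "\<And>x y. x \<in> U \<Longrightarrow> y \<in> U \<Longrightarrow> x \<oplus>\<^bsub>graded_restrict G H\<^esub> y \<in> U" for U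
    proof
      fix x assume "x \<in> carrier (graded_restrict G H)"
      then have x: "x \<in> H" by (simp add: graded_restrict_def)
      then have xG: "x \<in> carrier G" using sub by blast
      have "finsum G (component G x) A \<in> U" if "finite A" for A
        using that
      proof (induction A rule: finite_induct)
        case empty
        then show ?case using U(2)[of 0] zero_grade[OF graded, of 0] closed(1) by (auto simp: gr)
      next
        case (insert p A)
        moreover have "component G x p \<in> U"
          using U(2)[of p] component_grade[OF graded xG] comp[OF x] by (auto simp: gr)
        ultimately show ?case
          using U(3) component_carrier[OF graded xG] by (simp add: M.finsum_insert Pi_def graded_restrict_def)
      qed
      then show "x \<in> U"
        by (subst component_finsum[OF graded xG]) (use component_finite[OF graded xG] in blast)
    qed
    show "\<forall>p\<in>A. c p = \<zero>\<^bsub>graded_restrict G H\<^esub>" if "finite A"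
      "\<And>p. p \<in> A \<Longrightarrow> c p \<in> grade (graded_restrict G H) p" "finsum (graded_restrict G H) c A = \<zero>\<^bsub>graded_restrict G H\<^esub>" for A c
    proof
      fix p assume "p \<in> A"
      have "finsum G c A = \<zero>\<^bsub>G\<^esub>"
        using finsum_graded_restrict[OF G H, of A c] that by (auto simp: graded_restrict_def)
      then have "component G (finsum G c A) p = \<zero>\<^bsub>G\<^esub>" by (simp add: component_zero[OF graded])
      then show "c p = \<zero>\<^bsub>graded_restrict G H\<^esub>"
        using component_finsum_homogeneous[OF graded, of A c p] that \<open>p \<in> A\<close> by (simp add: gr, simp add: graded_restrict_def)
    qed
    show "bracket (graded_restrict G H) x y \<in> grade (graded_restrict G H) (p + q)"
      if "x \<in> grade (graded_restrict G H) p" "y \<in> grade (graded_restrict G H) q" for x y p q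
      using that bracket_grade closed by (auto simp: graded_restrict_def)
  qed
qed

lemma component_graded_restrict:
  fixes G :: "('k::field, 'g) graded_struct"
  assumes graded: "graded_lie_algebra G" and H: "lie_subalgebra H G"
    and comp: "\<And>x p. x \<in> H \<Longrightarrow> component G x p \<in> H" and x: "x \<in> H"
  shows "component (graded_restrict G H) x p = component G x p"
proof -
  have "H \<subseteq> carrier G"
    by (rule submodule_of_lie_subset[OF graded_lie_algebra_lie[OF graded]
        lie_subalgebra_submodule[OF graded_lie_algebra_lie[OF graded] H]])
  then have "(\<lambda>x. x) \<in> graded_lie_hom (graded_restrict G H) G"
    by (auto simp: graded_lie_hom_def graded_restrict_def)
  from hom_component[OF this graded_restrict_graded[OF assms(1-3)] graded, of x p] x
  show ?thesis by (simp add: graded_restrict_def)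
qed

section \<open>Quotients by ideals\<close>

context
  fixes G :: "('k::field, 'g) graded_struct" and I :: "'g set"
  assumes G: "lie_algebra G" and I: "lie_ideal I G"
begin

interpretation lie_algebra G by (rule G)

lemma lie_ideal_submodule: "Module.submodule I (ring_of_type_algebra :: 'k ring) G"
  using I by (simp add: lie_ideal_def)

lemmas lie_ideal_subset = submodule_of_lie_subset[OF G lie_ideal_submodule]

lemma lie_ideal_bracket_right: "x \<in> carrier G \<Longrightarrow> y \<in> I \<Longrightarrow> bracket G x y \<in> I"
  using I by (simp add: lie_ideal_def)

lemma lie_ideal_bracket_left:
  assumes "y \<in> I" "x \<in> carrier G"
  shows "bracket G y x \<in> I"
proof -
  have "bracket G y x = \<ominus>\<^bsub>G\<^esub> bracket G x y"
    using assms lie_ideal_subset lbr_antisym[of "lemb G y" "lemb G x"]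
    by (subst lemb_inject[OF G, symmetric]) (auto simp: lemb_simps[OF G] subset_iff)
  then show ?thesis
    using submodule_of_lie_neg[OF G lie_ideal_submodule lie_ideal_bracket_right[OF assms(2,1)]] by simp
qed

lemma mem_coset_iff: "x \<in> carrier G \<Longrightarrow> z \<in> I +>\<^bsub>G\<^esub> x \<longleftrightarrow> z \<in> carrier G \<and> z \<ominus>\<^bsub>G\<^esub> x \<in> I"
proof safe
  assume x: "x \<in> carrier G"
  { assume "z \<in> I +>\<^bsub>G\<^esub> x"
    then obtain h where h: "h \<in> I" "z = h \<oplus>\<^bsub>G\<^esub> x" by (auto simp: a_r_coset_def')
    then have hc: "h \<in> carrier G" using lie_ideal_subset by blast
    then show "z \<in> carrier G" using h x by simp
    have "z \<ominus>\<^bsub>G\<^esub> x = h"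
      unfolding h(2) using hc x by (subst lemb_inject[OF G, symmetric]) (simp_all add: lemb_simps[OF G])
    then show "z \<ominus>\<^bsub>G\<^esub> x \<in> I" using h by simp }
  assume z: "z \<in> carrier G" "z \<ominus>\<^bsub>G\<^esub> x \<in> I"
  have "z = (z \<ominus>\<^bsub>G\<^esub> x) \<oplus>\<^bsub>G\<^esub> x"
    using z x by (subst lemb_inject[OF G, symmetric]) (simp_all add: lemb_simps[OF G])
  then show "z \<in> I +>\<^bsub>G\<^esub> x" using z by (auto simp: a_r_coset_def')
qed

lemma coset_self: "x \<in> carrier G \<Longrightarrow> x \<in> I +>\<^bsub>G\<^esub> x"
  using submodule_of_lie_zero[OF G lie_ideal_submodule] by (simp add: mem_coset_iff a_minus_def r_neg)

lemma coset_eqI: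
  assumes "x \<in> carrier G" "y \<in> carrier G" "x \<ominus>\<^bsub>G\<^esub> y \<in> I"
  shows "I +>\<^bsub>G\<^esub> x = I +>\<^bsub>G\<^esub> y"
proof -
  have "z \<ominus>\<^bsub>G\<^esub> x = (z \<ominus>\<^bsub>G\<^esub> y) \<ominus>\<^bsub>G\<^esub> (x \<ominus>\<^bsub>G\<^esub> y)" "z \<ominus>\<^bsub>G\<^esub> y = (z \<ominus>\<^bsub>G\<^esub> x) \<oplus>\<^bsub>G\<^esub> (x \<ominus>\<^bsub>G\<^esub> y)"
    if "z \<in> carrier G" for z
    using assms that by (simp_all add: lemb_inject[OF G, symmetric] lemb_simps[OF G])
  then have "z \<ominus>\<^bsub>G\<^esub> x \<in> I \<longleftrightarrow> z \<ominus>\<^bsub>G\<^esub> y \<in> I" if "z \<in> carrier G" for z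
    using that assms(3) submodule_of_lie_minus[OF G lie_ideal_submodule, of "z \<ominus>\<^bsub>G\<^esub> y" "x \<ominus>\<^bsub>G\<^esub> y"]
      submodule_of_lie_add[OF G lie_ideal_submodule, of "z \<ominus>\<^bsub>G\<^esub> x" "x \<ominus>\<^bsub>G\<^esub> y"]
    by (intro iffI) simp_all
  then show ?thesis
    using assms(1,2) by (auto simp: set_eq_iff mem_coset_iff)
qed

lemma coset_eq_iff:
  assumes "x \<in> carrier G" "y \<in> carrier G"
  shows "I +>\<^bsub>G\<^esub> x = I +>\<^bsub>G\<^esub> y \<longleftrightarrow> x \<ominus>\<^bsub>G\<^esub> y \<in> I"
  using coset_eqI[OF assms] coset_self[OF assms(1)] mem_coset_iff[OF assms(2), of x] by auto

lemma minus_zero: "z \<in> carrier G \<Longrightarrow> z \<ominus>\<^bsub>G\<^esub> \<zero>\<^bsub>G\<^esub> = z"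
  by (subst lemb_inject[OF G, symmetric]) (simp_all add: lemb_simps[OF G])

lemma coset_zero: "I +>\<^bsub>G\<^esub> \<zero>\<^bsub>G\<^esub> = I"
  using lie_ideal_subset minus_zero by (auto simp: mem_coset_iff)

lemma coset_eq_ideal_iff: "x \<in> carrier G \<Longrightarrow> I +>\<^bsub>G\<^esub> x = I \<longleftrightarrow> x \<in> I"
  using coset_eq_iff[of x "\<zero>\<^bsub>G\<^esub>"] by (simp add: coset_zero minus_zero)

lemma lie_quotient_carrier: "carrier (lie_quotient G I) = (\<lambda>x. I +>\<^bsub>G\<^esub> x) ` carrier G"
  by (auto simp: lie_quotient_def A_RCOSETS_def')

lemma lie_quotient_zero: "\<zero>\<^bsub>lie_quotient G I\<^esub> = I +>\<^bsub>G\<^esub> \<zero>\<^bsub>G\<^esub>"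
  by (simp add: lie_quotient_def coset_zero)

lemma lie_quotient_add:
  assumes x: "x \<in> carrier G" and y: "y \<in> carrier G"
  shows "(I +>\<^bsub>G\<^esub> x) \<oplus>\<^bsub>lie_quotient G I\<^esub> (I +>\<^bsub>G\<^esub> y) = I +>\<^bsub>G\<^esub> (x \<oplus>\<^bsub>G\<^esub> y)"
proof -
  have "z \<in> (I +>\<^bsub>G\<^esub> x) <+>\<^bsub>G\<^esub> (I +>\<^bsub>G\<^esub> y) \<longleftrightarrow> z \<in> I +>\<^bsub>G\<^esub> (x \<oplus>\<^bsub>G\<^esub> y)" for z
  proof
    assume "z \<in> (I +>\<^bsub>G\<^esub> x) <+>\<^bsub>G\<^esub> (I +>\<^bsub>G\<^esub> y)"
    then obtain h k where hk: "z = h \<oplus>\<^bsub>G\<^esub> k" "h \<in> I +>\<^bsub>G\<^esub> x" "k \<in> I +>\<^bsub>G\<^esub> y"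
      by (auto simp: set_add_def')
    then have c: "h \<in> carrier G" "k \<in> carrier G" "h \<ominus>\<^bsub>G\<^esub> x \<in> I" "k \<ominus>\<^bsub>G\<^esub> y \<in> I"
      by (simp_all add: mem_coset_iff x y)
    have "(h \<oplus>\<^bsub>G\<^esub> k) \<ominus>\<^bsub>G\<^esub> (x \<oplus>\<^bsub>G\<^esub> y) = (h \<ominus>\<^bsub>G\<^esub> x) \<oplus>\<^bsub>G\<^esub> (k \<ominus>\<^bsub>G\<^esub> y)"
      using c x y by (subst lemb_inject[OF G, symmetric]) (simp_all add: lemb_simps[OF G])
    then show "z \<in> I +>\<^bsub>G\<^esub> (x \<oplus>\<^bsub>G\<^esub> y)"
      using c x y hk(1) submodule_of_lie_add[OF G lie_ideal_submodule] by (simp add: mem_coset_iff)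
  next
    assume "z \<in> I +>\<^bsub>G\<^esub> (x \<oplus>\<^bsub>G\<^esub> y)"
    then have z: "z \<in> carrier G" "z \<ominus>\<^bsub>G\<^esub> (x \<oplus>\<^bsub>G\<^esub> y) \<in> I" by (simp_all add: mem_coset_iff x y)
    have e: "(z \<ominus>\<^bsub>G\<^esub> y) \<ominus>\<^bsub>G\<^esub> x = z \<ominus>\<^bsub>G\<^esub> (x \<oplus>\<^bsub>G\<^esub> y)" "z = (z \<ominus>\<^bsub>G\<^esub> y) \<oplus>\<^bsub>G\<^esub> y"
      using z x y by (simp_all add: lemb_inject[OF G, symmetric] lemb_simps[OF G])
    have "z \<ominus>\<^bsub>G\<^esub> y \<in> I +>\<^bsub>G\<^esub> x" using z x y e(1) by (simp add: mem_coset_iff)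
    then show "z \<in> (I +>\<^bsub>G\<^esub> x) <+>\<^bsub>G\<^esub> (I +>\<^bsub>G\<^esub> y)"
      using e(2) coset_self[OF y] by (auto simp: set_add_def')
  qed
  then show ?thesis by (auto simp: lie_quotient_def)
qed

text \<open>\<open>lie_quotient\<close> forms a union over all representatives. The cosets in that
  union coincide, because two representatives differ by an element of I, and the union is not empty,
  because x represents its own coset.\<close>

lemma lie_quotient_smult:
  assumes x: "x \<in> carrier G"
  shows "a \<odot>\<^bsub>lie_quotient G I\<^esub> (I +>\<^bsub>G\<^esub> x) = I +>\<^bsub>G\<^esub> (a \<odot>\<^bsub>G\<^esub> x)"
proof -
  have *: "I +>\<^bsub>G\<^esub> (a \<odot>\<^bsub>G\<^esub> z) = I +>\<^bsub>G\<^esub> (a \<odot>\<^bsub>G\<^esub> x)" if "z \<in> I +>\<^bsub>G\<^esub> x" for z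
  proof (rule coset_eqI)
    have z: "z \<in> carrier G" "z \<ominus>\<^bsub>G\<^esub> x \<in> I" using that x by (simp_all add: mem_coset_iff)
    have "a \<odot>\<^bsub>G\<^esub> z \<ominus>\<^bsub>G\<^esub> a \<odot>\<^bsub>G\<^esub> x = a \<odot>\<^bsub>G\<^esub> (z \<ominus>\<^bsub>G\<^esub> x)"
      using z x by (subst lemb_inject[OF G, symmetric])
        (simp_all add: lemb_simps[OF G] lie_product.scale_right_diff_distrib)
    then show "a \<odot>\<^bsub>G\<^esub> z \<ominus>\<^bsub>G\<^esub> a \<odot>\<^bsub>G\<^esub> x \<in> I"
      using z submodule_of_lie_smult[OF G lie_ideal_submodule] by simp
    show "a \<odot>\<^bsub>G\<^esub> z \<in> carrier G" "a \<odot>\<^bsub>G\<^esub> x \<in> carrier G" using z x by simp_all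
  qed
  have "(\<Union>z\<in>I +>\<^bsub>G\<^esub> x. I +>\<^bsub>G\<^esub> (a \<odot>\<^bsub>G\<^esub> z)) = (\<Union>z\<in>I +>\<^bsub>G\<^esub> x. I +>\<^bsub>G\<^esub> (a \<odot>\<^bsub>G\<^esub> x))"
    by (intro SUP_cong HOL.refl *)
  also have "\<dots> = I +>\<^bsub>G\<^esub> (a \<odot>\<^bsub>G\<^esub> x)"
    using coset_self[OF x] by (simp add: UN_constant) blast
  finally show ?thesis by (simp add: lie_quotient_def)
qed

text \<open>Independence of both representatives comes from
  \<open>[z, w] - [x, y] = [z - x, w] + [x, w - y]\<close>, whose two terms lie in I by the ideal
  property on either side.\<close>

lemma lie_quotient_bracket:
  assumes x: "x \<in> carrier G" and y: "y \<in> carrier G"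
  shows "bracket (lie_quotient G I) (I +>\<^bsub>G\<^esub> x) (I +>\<^bsub>G\<^esub> y) = I +>\<^bsub>G\<^esub> bracket G x y"
proof -
  have *: "I +>\<^bsub>G\<^esub> bracket G z w = I +>\<^bsub>G\<^esub> bracket G x y" if "z \<in> I +>\<^bsub>G\<^esub> x" "w \<in> I +>\<^bsub>G\<^esub> y" for z w
  proof (rule coset_eqI)
    have z: "z \<in> carrier G" "z \<ominus>\<^bsub>G\<^esub> x \<in> I" "w \<in> carrier G" "w \<ominus>\<^bsub>G\<^esub> y \<in> I"
      using that x y by (simp_all add: mem_coset_iff)
    have "bracket G z w \<ominus>\<^bsub>G\<^esub> bracket G x y = bracket G (z \<ominus>\<^bsub>G\<^esub> x) w \<oplus>\<^bsub>G\<^esub> bracket G x (w \<ominus>\<^bsub>G\<^esub> y)"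
      using z x y by (subst lemb_inject[OF G, symmetric]) (simp_all add: lemb_simps[OF G] lbr_simps)
    then show "bracket G z w \<ominus>\<^bsub>G\<^esub> bracket G x y \<in> I"
      using z x submodule_of_lie_add[OF G lie_ideal_submodule] lie_ideal_bracket_left lie_ideal_bracket_right
      by simp
    show "bracket G z w \<in> carrier G" "bracket G x y \<in> carrier G" using z x y by (simp_all add: lie_algebra_closed[OF G])
  qed
  have "(\<Union>z\<in>I +>\<^bsub>G\<^esub> x. \<Union>w\<in>I +>\<^bsub>G\<^esub> y. I +>\<^bsub>G\<^esub> bracket G z w)
      = (\<Union>z\<in>I +>\<^bsub>G\<^esub> x. \<Union>w\<in>I +>\<^bsub>G\<^esub> y. I +>\<^bsub>G\<^esub> bracket G x y)"
    by (intro SUP_cong HOL.refl *)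
  also have "\<dots> = I +>\<^bsub>G\<^esub> bracket G x y"
    using coset_self[OF x] coset_self[OF y] by (simp add: UN_constant) blast
  finally show ?thesis by (simp add: lie_quotient_def)
qed

lemma lie_quotient_lie_algebra: "lie_algebra (lie_quotient G I)"
  by (rule lie_algebra_image[of G _ "\<lambda>x. I +>\<^bsub>G\<^esub> x"])
     (simp_all only: G lie_quotient_carrier lie_quotient_zero lie_quotient_add lie_quotient_smult
      lie_quotient_bracket)

lemma lie_quotient_hom: "(\<lambda>x. I +>\<^bsub>G\<^esub> x) \<in> graded_lie_hom G (lie_quotient G I)"
  unfolding graded_lie_hom_def
  by (auto simp: lie_quotient_carrier lie_quotient_add lie_quotient_smult lie_quotient_bracket)
     (simp add: lie_quotient_def)

end

lemma graded_ideal_lie_ideal: "graded_ideal I G \<Longrightarrow> lie_ideal I G"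
  by (simp add: graded_ideal_def)

lemma graded_ideal_component:
  fixes G :: "('k::field, 'g) graded_struct"
  assumes G: "graded_lie_algebra G" and I: "graded_ideal I G" and x: "x \<in> I"
  shows "component G x p \<in> I"
proof -
  obtain c A where *: "finite A" "\<forall>p\<in>A. c p \<in> I \<inter> grade G p" "x = finsum G c A"
    using I x unfolding graded_ideal_def by blast
  have "component G x p = (if p \<in> A then c p else \<zero>\<^bsub>G\<^esub>)"
    unfolding *(3) by (rule component_finsum_homogeneous[OF G]) (use * in auto)
  then show ?thesis
    using * submodule_of_lie_zero[OF graded_lie_algebra_lie[OF G]
        lie_ideal_submodule[OF graded_lie_algebra_lie[OF G] graded_ideal_lie_ideal[OF I]]] by auto
qed

lemma graded_idealI:
  fixes G :: "('k::field, 'g) graded_struct"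
  assumes G: "graded_lie_algebra G" and I: "lie_ideal I G"
    and comp: "\<And>x p. x \<in> I \<Longrightarrow> component G x p \<in> I"
  shows "graded_ideal I G"
  unfolding graded_ideal_def
proof (intro conjI I ballI)
  fix x assume x: "x \<in> I"
  then have "x \<in> carrier G" using lie_ideal_subset[OF graded_lie_algebra_lie[OF G] I] by blast
  then show "\<exists>c A. finite A \<and> (\<forall>p\<in>A. c p \<in> I \<inter> grade G p) \<and> x = finsum G c A"
    using component_finsum[OF G] component_finite[OF G] component_grade[OF G] comp[OF x]
    by (intro exI[of _ "component G x"] exI[of _ "{p. component G x p \<noteq> \<zero>\<^bsub>G\<^esub>}"]) simp
qed

text \<open>The point is independence. If the cosets of homogeneous \<open>d p\<close> add up to
  zero, then the sum of the \<open>d p\<close> lies in I; since I is graded, each summand lies in I,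
  so each coset is zero.\<close>

lemma lie_quotient_graded:
  fixes G :: "('k::field, 'g) graded_struct"
  assumes graded: "graded_lie_algebra G" and I: "graded_ideal I G"
  shows "graded_lie_algebra (lie_quotient G I)"
proof -
  interpret graded_lie_algebra G by (rule graded)
  note G = graded_lie_algebra_lie[OF graded] and I' = graded_ideal_lie_ideal[OF I]
  note Q = lie_quotient_lie_algebra[OF G I'] and q = lie_quotient_hom[OF G I']
  let ?Q = "lie_quotient G I" and ?q = "\<lambda>x. I +>\<^bsub>G\<^esub> x"
  have gr: "grade ?Q p = ?q ` grade G p" for p by (simp add: lie_quotient_def)
  show ?thesis
  proof (rule graded_lie_algebraI[OF Q])
    show "Module.submodule (grade ?Q p) (ring_of_type_algebra :: 'k ring) ?Q" for p
    proof (rule submodule_of_lieI[OF Q])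
      show "grade ?Q p \<subseteq> carrier ?Q"
        using grade_subset[OF graded] by (auto simp: gr lie_quotient_carrier[OF G I'])
      show "\<zero>\<^bsub>?Q\<^esub> \<in> grade ?Q p"
        using zero_grade[OF graded] by (auto simp: gr lie_quotient_zero[OF G I'])
      show "x \<oplus>\<^bsub>?Q\<^esub> y \<in> grade ?Q p" if "x \<in> grade ?Q p" "y \<in> grade ?Q p" for x y
        using that submodule_of_lie_add[OF G grade_submodule[of p]]
        by (auto simp: gr lie_quotient_add[OF G I'] grade_carrier[OF graded])
      show "a \<odot>\<^bsub>?Q\<^esub> x \<in> grade ?Q p" if "x \<in> grade ?Q p" for a x
        using that submodule_of_lie_smult[OF G grade_submodule[of p]]
        by (auto simp: gr lie_quotient_smult[OF G I'] grade_carrier[OF graded])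
    qed
    show "carrier ?Q \<subseteq> U" if U: "U \<subseteq> carrier ?Q" "\<And>p. grade ?Q p \<subseteq> U"
      "\<And>x y. x \<in> U \<Longrightarrow> y \<in> U \<Longrightarrow> x \<oplus>\<^bsub>?Q\<^esub> y \<in> U" for U
    proof -
      have "?q x \<in> U" if "x \<in> carrier G" for x
        using that
      proof (rule graded_induct[OF graded])
        show "?q y \<in> U" if "y \<in> grade G p" for p y
          using that U(2)[of p] by (auto simp: gr)
        show "?q (y \<oplus>\<^bsub>G\<^esub> z) \<in> U" if "y \<in> carrier G" "z \<in> carrier G" "?q y \<in> U" "?q z \<in> U" for y z
          using U(3)[OF that(3,4)] by (simp add: lie_quotient_add[OF G I'] that)
      qed
      then show ?thesis by (auto simp: lie_quotient_carrier[OF G I'])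
    qed
    show "\<forall>p\<in>A. c p = \<zero>\<^bsub>?Q\<^esub>" if A: "finite A" and c: "\<And>p. p \<in> A \<Longrightarrow> c p \<in> grade ?Q p"
      and zero: "finsum ?Q c A = \<zero>\<^bsub>?Q\<^esub>" for A c
    proof
      interpret Q: lie_algebra ?Q by (rule Q)
      fix p assume p: "p \<in> A"
      have "\<forall>p\<in>A. \<exists>d. d \<in> grade G p \<and> c p = ?q d" using c by (force simp: gr)
      then obtain d where d: "\<And>p. p \<in> A \<Longrightarrow> d p \<in> grade G p" "\<And>p. p \<in> A \<Longrightarrow> c p = ?q (d p)"
        by metis
      have dc: "d \<in> A \<rightarrow> carrier G" using d grade_carrier[OF graded] by blast
      then have fin: "finsum G d A \<in> carrier G" by (rule M.finsum_closed)
      have "finsum ?Q c A = finsum ?Q (\<lambda>p. ?q (d p)) A"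
        by (rule Q.M.finsum_cong') (use d dc hom_carrier[OF q] in \<open>auto simp: Pi_iff\<close>)
      then have "?q (finsum G d A) = ?q \<zero>\<^bsub>G\<^esub>"
        using hom_finsum[OF q G Q A dc] zero by (simp add: lie_quotient_zero[OF G I'])
      then have "finsum G d A \<in> I"
        using coset_eq_ideal_iff[OF G I' fin] by (simp add: coset_zero[OF G I'])
      from graded_ideal_component[OF graded I this, of p] have "d p \<in> I"
        using component_finsum_homogeneous[OF graded A d(1), of p] p by simp
      then show "c p = \<zero>\<^bsub>?Q\<^esub>"
        using d p dc coset_eq_ideal_iff[OF G I', of "d p"] by (auto simp: lie_quotient_def)
    qed
    show "bracket ?Q x y \<in> grade ?Q (p + q)" if "x \<in> grade ?Q p" "y \<in> grade ?Q q" for x y p q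
      using that bracket_grade by (auto simp: gr lie_quotient_bracket[OF G I'] grade_carrier[OF graded])
  qed
qed


section \<open>The part of nonnegative degree\<close>

locale base_space = vector_space scale for scale :: "'k::field \<Rightarrow> 'v::ab_group_add \<Rightarrow> 'v"
begin

lemma linear_self_iff: "Vector_Spaces.linear scale scale f \<longleftrightarrow>
    (\<forall>x y. f (x + y) = f x + f y) \<and> (\<forall>a x. f (scale a x) = scale a (f x))"
  by (simp add: Vector_Spaces.linear_iff vector_space_axioms)

definition fscale :: "'k \<Rightarrow> ('v list \<Rightarrow> 'v) \<Rightarrow> 'v list \<Rightarrow> 'v" where
  "fscale a \<xi> = (\<lambda>vs. scale a (\<xi> vs))"

text \<open>A finite sum of multilinear maps of various arities in one function: the clauses about
  single entries hold for each list length separately, and the last clause bounds the arity. The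
  value at \<open>[]\<close> would have degree \<open>-1\<close>, which is stored in the other
  coordinate of F(V), so it is fixed to 0.\<close>

definition multilinear :: "('v list \<Rightarrow> 'v) \<Rightarrow> bool" where
  "multilinear \<xi> \<longleftrightarrow> \<xi> [] = 0 \<and>
     (\<forall>us v w ws. \<xi> (us @ (v + w) # ws) = \<xi> (us @ v # ws) + \<xi> (us @ w # ws)) \<and>
     (\<forall>us a v ws. \<xi> (us @ scale a v # ws) = scale a (\<xi> (us @ v # ws))) \<and>
     (\<exists>n. \<forall>vs. length vs > n \<longrightarrow> \<xi> vs = 0)"

text \<open>Prefixes of length p constrain the part of degree p; in particular the empty prefix puts
  the part of degree 0 into L.\<close>

definition multilinear_of_type :: "('v \<Rightarrow> 'v) set \<Rightarrow> ('v list \<Rightarrow> 'v) \<Rightarrow> bool" where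
  "multilinear_of_type L \<xi> \<longleftrightarrow> multilinear \<xi> \<and> (\<forall>vs. (\<lambda>v. \<xi> (vs @ [v])) \<in> L)"

abbreviation nb :: "('v list \<Rightarrow> 'v) \<Rightarrow> ('v list \<Rightarrow> 'v) \<Rightarrow> 'v list \<Rightarrow> 'v" where
  "nb \<xi> \<eta> \<equiv> (\<lambda>vs. nonneg_bracket vs \<xi> \<eta>)"

lemma multilinearD:
  assumes "multilinear \<xi>"
  shows "\<xi> [] = 0" "\<xi> (us @ (v + w) # ws) = \<xi> (us @ v # ws) + \<xi> (us @ w # ws)"
    "\<xi> (us @ scale a v # ws) = scale a (\<xi> (us @ v # ws))"
    "\<exists>n. \<forall>vs. length vs > n \<longrightarrow> \<xi> vs = 0"
  using assms by (auto simp: multilinear_def)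

lemma multilinear_Cons:
  assumes "multilinear \<xi>"
  shows "\<xi> ((v + w) # ws) = \<xi> (v # ws) + \<xi> (w # ws)" "\<xi> (scale a v # ws) = scale a (\<xi> (v # ws))"
    "\<xi> (0 # ws) = 0" "\<xi> ((- v) # ws) = - \<xi> (v # ws)" "\<xi> ((v - w) # ws) = \<xi> (v # ws) - \<xi> (w # ws)"
proof -
  show add: "\<xi> ((v + w) # ws) = \<xi> (v # ws) + \<xi> (w # ws)" for v w
    using multilinearD(2)[OF assms, of "[]"] by simp
  show "\<xi> (scale a v # ws) = scale a (\<xi> (v # ws))"
    using multilinearD(3)[OF assms, of "[]"] by simp
  show zero: "\<xi> (0 # ws) = 0" using add[of 0 0] by simp
  show neg: "\<xi> ((- v) # ws) = - \<xi> (v # ws)" for v using add[of "- v" v] zero by (simp add: eq_neg_iff_add_eq_0)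
  show "\<xi> ((v - w) # ws) = \<xi> (v # ws) - \<xi> (w # ws)" using add[of v "- w"] neg by simp
qed

lemma multilinear_zero: "multilinear 0"
  by (simp add: multilinear_def)

lemma multilinear_add:
  assumes "multilinear \<xi>" "multilinear \<eta>"
  shows "multilinear (\<xi> + \<eta>)"
proof -
  obtain m n where "\<forall>vs. length vs > m \<longrightarrow> \<xi> vs = 0" "\<forall>vs. length vs > n \<longrightarrow> \<eta> vs = 0"
    using multilinearD(4) assms by meson
  then have "\<forall>vs. length vs > m + n \<longrightarrow> (\<xi> + \<eta>) vs = 0" by simp
  then show ?thesis
    using multilinearD(1-3)[OF assms(1)] multilinearD(1-3)[OF assms(2)]
    unfolding multilinear_def by (auto simp: scale_right_distrib)
qed

lemma multilinear_fscale:
  assumes "multilinear \<xi>"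
  shows "multilinear (fscale a \<xi>)"
proof -
  obtain m where "\<forall>vs. length vs > m \<longrightarrow> \<xi> vs = 0"
    using multilinearD(4) assms by meson
  then have "\<forall>vs. length vs > m \<longrightarrow> (fscale a \<xi>) vs = 0" by (simp add: fscale_def)
  then show ?thesis
    using multilinearD(1-3)[OF assms(1)]
    unfolding multilinear_def by (auto simp: fscale_def scale_right_distrib scale_left_commute)
qed

lemma fscale_neg_one: "fscale (- 1) \<xi> = - \<xi>"
  by (simp add: fscale_def fun_eq_iff)

lemma multilinear_uminus: "multilinear \<xi> \<Longrightarrow> multilinear (- \<xi>)"
  using multilinear_fscale[of \<xi> "- 1"] by (simp add: fscale_neg_one)

lemma multilinear_diff: "multilinear \<xi> \<Longrightarrow> multilinear \<eta> \<Longrightarrow> multilinear (\<xi> - \<eta>)"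
  using multilinear_add[of \<xi> "- \<eta>"] multilinear_uminus[of \<eta>] by simp

lemma contract_simps:
  "contract (\<xi> + \<eta>) v = contract \<xi> v + contract \<eta> v"
  "contract (\<xi> - \<eta>) v = contract \<xi> v - contract \<eta> v"
  "contract (- \<xi>) v = - contract \<xi> v"
  "contract 0 v = 0"
  "contract (fscale a \<xi>) v = fscale a (contract \<xi> v)"
  by (simp_all add: contract_def fun_eq_iff fscale_def)

lemma contract_linear:
  assumes "multilinear \<xi>"
  shows "contract \<xi> (v + w) = contract \<xi> v + contract \<xi> w" "contract \<xi> (scale a v) = fscale a (contract \<xi> v)"
    "contract \<xi> (- v) = - contract \<xi> v" "contract \<xi> (v - w) = contract \<xi> v - contract \<xi> w" "contract \<xi> 0 = 0"
  using multilinear_Cons[OF assms] by (auto simp add: contract_def fun_eq_iff fscale_def)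

lemma multilinear_contract:
  assumes "multilinear \<xi>"
  shows "multilinear (contract \<xi> v)"
proof -
  obtain m where "\<forall>vs. length vs > m \<longrightarrow> \<xi> vs = 0"
    using multilinearD(4) assms by meson
  then have "\<forall>vs. length vs > m \<longrightarrow> contract \<xi> v vs = 0" by (simp add: contract_def)
  then show ?thesis
    using multilinearD(2,3)[OF assms(1), of "v # _"]
    unfolding multilinear_def by (intro conjI exI[of _ m]) (auto simp: contract_def)
qed

section \<open>The bracket of elements of nonnegative degree\<close>

lemma nb_Cons: "nb \<xi> \<eta> (v # vs) = nb (contract \<xi> v) \<eta> vs - \<eta> (\<xi> [v] # vs) + (nb \<xi> (contract \<eta> v) vs + \<xi> (\<eta> [v] # vs))"
  by simp

text \<open>The defining rule \<open>[[\<xi>, \<eta>], v] = [[\<xi>, v], \<eta>] + [\<xi>,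
  [\<eta>, v]]\<close> in nonnegative degree. The terms \<open>contract \<eta> (\<xi> [v])\<close>
  and \<open>contract \<xi> (\<eta> [v])\<close> come from the parts of degree \<open>-1\<close> of
  \<open>[\<xi>, v]\<close> and \<open>[\<eta>, v]\<close>.\<close>

lemma contract_nb: "contract (nb \<xi> \<eta>) v =
    nb (contract \<xi> v) \<eta> - contract \<eta> (\<xi> [v]) + nb \<xi> (contract \<eta> v) + contract \<xi> (\<eta> [v])"
  by (rule ext) (auto simp: contract_def)

lemma nb_antisym_at: "nb \<xi> \<eta> vs = - nb \<eta> \<xi> vs"
proof (induction vs arbitrary: \<xi> \<eta>)
  case (Cons v vs)
  show ?case
    using Cons[of "contract \<xi> v" \<eta>] Cons[of \<xi> "contract \<eta> v"] by simp
qed simp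

lemma nb_antisym: "nb \<xi> \<eta> = - nb \<eta> \<xi>"
proof
  show "nb \<xi> \<eta> vs = (- nb \<eta> \<xi>) vs" for vs
    using nb_antisym_at[of vs \<xi> \<eta>] by simp
qed

text \<open>Expanding one argument leaves
  \<open>nb (contract \<xi> v) \<xi> + nb \<xi> (contract \<xi> v)\<close>, which antisymmetry
  cancels. This avoids halving \<open>nb \<xi> \<xi> = - nb \<xi> \<xi>\<close>.\<close>

lemma nb_self: "nb \<xi> \<xi> = 0"
proof
  show "nb \<xi> \<xi> vs = 0 vs" for vs
    using nb_antisym_at[of _ \<xi> "contract \<xi> _"] by (cases vs) auto
qed

text \<open>Multilinearity of \<eta> enters through the term \<open>\<eta> (\<xi> [v] # vs)\<close>
  of the recursion: additivity in \<xi> becomes additivity of \<eta> in its first argument. The maps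
  are quantified inside so that the induction reaches \<open>contract \<eta> v\<close>.\<close>

lemma nb_add_left_at:
  "\<forall>\<xi> \<xi>' \<eta>. multilinear \<eta> \<longrightarrow> nb (\<xi> + \<xi>') \<eta> vs = nb \<xi> \<eta> vs + nb \<xi>' \<eta> vs"
proof (induction vs)
  case (Cons v vs)
  show ?case
  proof (intro allI impI)
    fix \<xi> \<xi>' \<eta> assume \<eta>: "multilinear \<eta>"
    show "nb (\<xi> + \<xi>') \<eta> (v # vs) = nb \<xi> \<eta> (v # vs) + nb \<xi>' \<eta> (v # vs)"
      by (simp add: contract_simps multilinear_Cons[OF \<eta>]
          Cons.IH[rule_format, OF \<eta>, of "contract \<xi> v" "contract \<xi>' v"]
          Cons.IH[rule_format, OF multilinear_contract[OF \<eta>], of \<xi> \<xi>' v])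
  qed
qed simp

lemma nb_scale_left_at:
  "\<forall>\<xi> \<eta>. multilinear \<eta> \<longrightarrow> nb (fscale a \<xi>) \<eta> vs = scale a (nb \<xi> \<eta> vs)"
proof (induction vs)
  case (Cons v vs)
  show ?case
  proof (intro allI impI)
    fix \<xi> \<eta> assume \<eta>: "multilinear \<eta>"
    have at: "fscale a \<xi> ws = scale a (\<xi> ws)" for ws by (simp add: fscale_def)
    show "nb (fscale a \<xi>) \<eta> (v # vs) = scale a (nb \<xi> \<eta> (v # vs))"
      using Cons.IH \<eta> multilinear_contract[OF \<eta>]
      by (simp add: contract_simps multilinear_Cons at scale_right_distrib scale_right_diff_distrib)
  qed
qed simp

lemma nb_left:
  assumes "multilinear \<eta>"
  shows nb_add_left: "nb (\<xi> + \<xi>') \<eta> = nb \<xi> \<eta> + nb \<xi>' \<eta>"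
    and nb_scale_left: "nb (fscale a \<xi>) \<eta> = fscale a (nb \<xi> \<eta>)"
    and nb_minus_left: "nb (- \<xi>) \<eta> = - nb \<xi> \<eta>"
    and nb_diff_left: "nb (\<xi> - \<xi>') \<eta> = nb \<xi> \<eta> - nb \<xi>' \<eta>"
    and nb_zero_left: "nb 0 \<eta> = 0"
proof -
  show add: "nb (\<xi> + \<xi>') \<eta> = nb \<xi> \<eta> + nb \<xi>' \<eta>" for \<xi> \<xi>'
    using nb_add_left_at assms by (simp add: fun_eq_iff)
  show sc: "nb (fscale a \<xi>) \<eta> = fscale a (nb \<xi> \<eta>)" for a \<xi>
    using nb_scale_left_at assms by (simp add: fun_eq_iff fscale_def[of _ "nb _ _"])
  show neg: "nb (- \<xi>) \<eta> = - nb \<xi> \<eta>" for \<xi>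
    using sc[of "- 1" \<xi>] by (simp only: fscale_neg_one)
  show "nb (\<xi> - \<xi>') \<eta> = nb \<xi> \<eta> - nb \<xi>' \<eta>"
    using add[of \<xi> "- \<xi>'"] neg[of \<xi>'] by simp
  show "nb 0 \<eta> = 0" using add[of 0 0] by simp
qed

lemma nb_right:
  assumes "multilinear \<eta>"
  shows nb_add_right: "nb \<eta> (\<xi> + \<xi>') = nb \<eta> \<xi> + nb \<eta> \<xi>'"
    and nb_scale_right: "nb \<eta> (fscale a \<xi>) = fscale a (nb \<eta> \<xi>)"
    and nb_minus_right: "nb \<eta> (- \<xi>) = - nb \<eta> \<xi>"
    and nb_diff_right: "nb \<eta> (\<xi> - \<xi>') = nb \<eta> \<xi> - nb \<eta> \<xi>'"
    and nb_zero_right: "nb \<eta> 0 = 0"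
  unfolding nb_antisym[of \<eta>] nb_left[OF assms] by (simp_all add: fscale_def fun_eq_iff)

text \<open>Vanishing on long lists: m and n bound the arities of \<xi> and \<eta>, each contraction
  lowers one of the two bounds, and a map of bound 0 has zero contraction. Linearity in an entry:
  the first entry is covered by linearity of \<open>contract\<close>, a later one by induction on
  the entries before it.\<close>

lemma multilinear_nb:
  assumes "multilinear \<xi>" "multilinear \<eta>"
  shows "multilinear (nb \<xi> \<eta>)"
proof -
  have zero: "nb \<xi> \<eta> vs = 0" if "multilinear \<xi>" "multilinear \<eta>" "\<forall>vs. length vs > m \<longrightarrow> \<xi> vs = 0" "\<forall>vs. length vs > n \<longrightarrow> \<eta> vs = 0"
    "length vs > m + n" for m n vs \<xi> \<eta>
    using that
  proof (induction vs arbitrary: m n \<xi> \<eta>)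
    case (Cons v vs)
    have z: "nb 0 \<eta> = 0" "nb \<xi> 0 = 0" using nb_left(5) nb_right(5) Cons.prems by auto
    have l: "nb (contract \<xi> v) \<eta> vs = 0"
    proof (cases m)
      case 0
      then have "contract \<xi> v = 0" using Cons.prems(3) by (auto simp: contract_def)
      then show ?thesis using fun_cong[OF z(1), of vs] by simp
    next
      case (Suc m')
      then have "\<forall>vs. length vs > m' \<longrightarrow> contract \<xi> v vs = 0" using Cons.prems(3) by (auto simp: contract_def)
      then show ?thesis
        using Cons.IH[OF multilinear_contract[OF Cons.prems(1)] Cons.prems(2), of m' v n] Cons.prems(4,5) Suc by auto
    qed
    have r: "nb \<xi> (contract \<eta> v) vs = 0"
    proof (cases n)
      case 0
      then have "contract \<eta> v = 0" using Cons.prems(4) by (auto simp: contract_def)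
      then show ?thesis using fun_cong[OF z(2), of vs] by simp
    next
      case (Suc n')
      then have "\<forall>vs. length vs > n' \<longrightarrow> contract \<eta> v vs = 0" using Cons.prems(4) by (auto simp: contract_def)
      then show ?thesis
        using Cons.IH[OF Cons.prems(1) multilinear_contract[OF Cons.prems(2)], of m n' v] Cons.prems(3,5) Suc by auto
    qed
    show ?case using l r Cons.prems(3-5) by simp
  qed simp
  obtain m n where "\<forall>vs. length vs > m \<longrightarrow> \<xi> vs = 0" "\<forall>vs. length vs > n \<longrightarrow> \<eta> vs = 0"
    using multilinearD(4) assms by meson
  then have "\<forall>vs. length vs > m + n \<longrightarrow> nb \<xi> \<eta> vs = 0" using zero assms by blast
  moreover have "nb \<xi> \<eta> (us @ (v + w) # ws) = nb \<xi> \<eta> (us @ v # ws) + nb \<xi> \<eta> (us @ w # ws)"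
    if "multilinear \<xi>" "multilinear \<eta>" for \<xi> \<eta> us v w ws
    using that
  proof (induction us arbitrary: \<xi> \<eta>)
    case Nil
    note m = Nil
    have "nb (contract \<xi> (v + w)) \<eta> = nb (contract \<xi> v) \<eta> + nb (contract \<xi> w) \<eta>"
      "nb \<xi> (contract \<eta> (v + w)) = nb \<xi> (contract \<eta> v) + nb \<xi> (contract \<eta> w)"
      by (simp_all only: contract_linear[OF m(1)] contract_linear[OF m(2)] nb_add_left[OF m(2)] nb_add_right[OF m(1)])
    from this[THEN fun_cong, of ws] show ?case
      using multilinear_Cons[OF m(1)] multilinear_Cons[OF m(2)] by simp
  next
    case (Cons u us)
    then show ?case
      using multilinearD(2)[OF Cons.prems(2), of "\<xi> [u] # us"] multilinearD(2)[OF Cons.prems(1), of "\<eta> [u] # us"]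
      by (simp add: multilinear_contract)
  qed
  moreover have "nb \<xi> \<eta> (us @ scale a v # ws) = scale a (nb \<xi> \<eta> (us @ v # ws))"
    if "multilinear \<xi>" "multilinear \<eta>" for \<xi> \<eta> us v a ws
    using that
  proof (induction us arbitrary: \<xi> \<eta>)
    case Nil
    note m = Nil
    have "nb (contract \<xi> (scale a v)) \<eta> = fscale a (nb (contract \<xi> v) \<eta>)"
      "nb \<xi> (contract \<eta> (scale a v)) = fscale a (nb \<xi> (contract \<eta> v))"
      by (simp_all only: contract_linear[OF m(1)] contract_linear[OF m(2)] nb_scale_left[OF m(2)] nb_scale_right[OF m(1)])
    from this[THEN fun_cong, of ws] show ?case
      using multilinear_Cons[OF m(1)] multilinear_Cons[OF m(2)]
      by (simp add: fscale_def scale_right_distrib scale_right_diff_distrib)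
  next
    case (Cons u us)
    then show ?case
      using multilinearD(3)[OF Cons.prems(2), of "\<xi> [u] # us"] multilinearD(3)[OF Cons.prems(1), of "\<eta> [u] # us"]
      by (simp add: multilinear_contract scale_right_distrib scale_right_diff_distrib)
  qed
  ultimately show ?thesis using assms unfolding multilinear_def[of "nb \<xi> \<eta>"] by auto
qed

lemmas multilinear_closed = multilinear_zero multilinear_add multilinear_diff multilinear_uminus
  multilinear_fscale multilinear_contract multilinear_nb

text \<open>Contraction by v is a derivation of the bracket up to terms with
  \<open>\<xi> [v]\<close>, \<open>\<eta> [v]\<close> and \<open>\<zeta> [v]\<close>. These cancel
  cyclically, so the cyclic sum at \<open>v # vs\<close> is a sum of three cyclic sums at
  \<open>vs\<close>, each with one map contracted.\<close>

lemma nb_jacobi: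
  assumes "multilinear \<xi>" "multilinear \<eta>" "multilinear \<zeta>"
  shows "nb \<xi> (nb \<eta> \<zeta>) + nb \<eta> (nb \<zeta> \<xi>) + nb \<zeta> (nb \<xi> \<eta>) = 0"
proof
  fix vs
  have "nb \<xi> (nb \<eta> \<zeta>) vs + nb \<eta> (nb \<zeta> \<xi>) vs + nb \<zeta> (nb \<xi> \<eta>) vs = 0"
    using assms
  proof (induction vs arbitrary: \<xi> \<eta> \<zeta>)
    case (Cons v vs)
    note m = Cons.prems
    have exp: "nb \<xi> (nb \<eta> \<zeta>) (v # vs) =
        nb (contract \<xi> v) (nb \<eta> \<zeta>) vs + nb \<xi> (nb (contract \<eta> v) \<zeta>) vs + nb \<xi> (nb \<eta> (contract \<zeta> v)) vs
        + (nb \<zeta> (contract \<eta> (\<xi> [v])) vs + \<zeta> (\<eta> [\<xi> [v]] # vs) - nb \<eta> (contract \<zeta> (\<xi> [v])) vs - \<eta> (\<zeta> [\<xi> [v]] # vs)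
        - nb \<xi> (contract \<zeta> (\<eta> [v])) vs + nb \<xi> (contract \<eta> (\<zeta> [v])) vs
        - \<xi> (\<zeta> [\<eta> [v]] # vs) + \<xi> (\<eta> [\<zeta> [v]] # vs))"
      if m: "multilinear \<xi>" "multilinear \<eta>" "multilinear \<zeta>" for \<xi> \<eta> \<zeta>
    proof -
      have "nb \<xi> (contract (nb \<eta> \<zeta>) v) = nb \<xi> (nb (contract \<eta> v) \<zeta>) - nb \<xi> (contract \<zeta> (\<eta> [v]))
          + nb \<xi> (nb \<eta> (contract \<zeta> v)) + nb \<xi> (contract \<eta> (\<zeta> [v]))"
        unfolding contract_nb nb_right[OF m(1)] ..
      from fun_cong[OF this, of vs] show ?thesis
        by (simp add: multilinear_Cons[OF m(1)] multilinear_Cons[OF m(2)] multilinear_Cons[OF m(3)]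
            nb_antisym_at[of vs "contract \<eta> (\<xi> [v])" \<zeta>] algebra_simps)
    qed
    have "nb \<xi> (nb \<eta> \<zeta>) (v # vs) + nb \<eta> (nb \<zeta> \<xi>) (v # vs) + nb \<zeta> (nb \<xi> \<eta>) (v # vs) =
        (nb (contract \<xi> v) (nb \<eta> \<zeta>) vs + nb \<eta> (nb \<zeta> (contract \<xi> v)) vs + nb \<zeta> (nb (contract \<xi> v) \<eta>) vs)
        + (nb \<xi> (nb (contract \<eta> v) \<zeta>) vs + nb (contract \<eta> v) (nb \<zeta> \<xi>) vs + nb \<zeta> (nb \<xi> (contract \<eta> v)) vs)
        + (nb \<xi> (nb \<eta> (contract \<zeta> v)) vs + nb \<eta> (nb (contract \<zeta> v) \<xi>) vs + nb (contract \<zeta> v) (nb \<xi> \<eta>) vs)"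
      unfolding exp[OF m] exp[OF m(2,3,1)] exp[OF m(3,1,2)] by (simp add: algebra_simps)
    also have "\<dots> = 0"
      using Cons.IH[OF multilinear_contract[OF m(1), of v] m(2,3)] Cons.IH[OF m(1) multilinear_contract[OF m(2), of v] m(3)]
        Cons.IH[OF m(1,2) multilinear_contract[OF m(3), of v]]
      by (simp only: add_0)
    finally show ?case .
  qed simp
  then show "(nb \<xi> (nb \<eta> \<zeta>) + nb \<eta> (nb \<zeta> \<xi>) + nb \<zeta> (nb \<xi> \<eta>)) vs = 0 vs" by simp
qed

text \<open>The identity of \<open>V\<close> as an element of degree \<open>0\<close>: \<open>[x, euler] = p x\<close> for \<open>x\<close> of degree \<open>p\<close>.\<close>

definition euler :: "'v list \<Rightarrow> 'v" where
  "euler vs = (if length vs = 1 then hd vs else 0)"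

lemma multilinear_euler: "multilinear euler"
proof -
  have "us @ x # ws = [hd (us @ x # ws)] \<longleftrightarrow> us = [] \<and> ws = []" for us ws :: "'v list" and x
    by (cases us) auto
  then show ?thesis
    unfolding multilinear_def euler_def
    by (intro conjI exI[of _ 1]) (auto simp: append_eq_Cons_conv)
qed

lemma contract_euler: "contract euler v = 0"
  by (auto simp: contract_def euler_def)

text \<open>Each argument contributes \<open>-1\<close> and the output contributes
  \<open>+1\<close>, hence the factor \<open>length vs - 1\<close>, the degree of a map with that
  many arguments. At \<open>[]\<close> the truncated difference is 0, in accordance with
  \<open>\<xi> [] = 0\<close>.\<close>

lemma nb_euler_at: "multilinear \<xi> \<Longrightarrow> nb euler \<xi> vs = - scale (of_nat (length vs - 1)) (\<xi> vs)"
proof (induction vs arbitrary: \<xi>)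
  case (Cons v vs)
  have z: "nb 0 \<xi> vs = 0" using fun_cong[OF nb_left(5)[OF Cons.prems], of vs] by simp
  show ?case
  proof (cases vs)
    case Nil
    then show ?thesis by (simp add: euler_def)
  next
    case (Cons w ws)
    then have "euler (\<xi> [v] # vs) = 0" by (simp add: euler_def)
    moreover have "nb euler (contract \<xi> v) vs = - scale (of_nat (length ws)) (\<xi> (v # vs))"
      using Cons.IH[OF multilinear_contract[OF \<open>multilinear \<xi>\<close>], of v] Cons by (simp add: contract_def)
    ultimately show ?thesis
      unfolding nb_Cons contract_euler z using Cons by (simp add: euler_def scale_left_distrib del: nonneg_bracket.simps)
  qed
qed simp

end


section \<open>The free Lie algebra\<close>

lemma lie_eq_iff_lcls: "lcls scale s = lcls scale t \<longleftrightarrow> lie_eq scale s t"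
proof
  assume "lcls scale s = lcls scale t"
  then have "t \<in> lcls scale s" by (simp add: lcls_def lie_eq.refl)
  then show "lie_eq scale s t" by (simp add: lcls_def)
next
  assume "lie_eq scale s t"
  then show "lcls scale s = lcls scale t"
    unfolding lcls_def by (auto intro: lie_eq.trans lie_eq.sym)
qed

lemma lie_eq_lrep: "lie_eq scale t (lrep (lcls scale t))"
proof -
  have "lrep (lcls scale t) \<in> lcls scale t"
    unfolding lrep_def by (rule someI[of _ t]) (simp add: lcls_def lie_eq.refl)
  then show ?thesis by (simp add: lcls_def)
qed

text \<open>The record computes with representatives chosen by \<open>lrep\<close>; the congruence
  rules of \<open>lie_eq\<close> allow any other representative in their place.\<close>

lemma free_lie_ops:
  "carrier (free_lie scale) = range (lcls scale)"
  "\<zero>\<^bsub>free_lie scale\<^esub> = lcls scale LZero"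
  "lcls scale s \<oplus>\<^bsub>free_lie scale\<^esub> lcls scale t = lcls scale (LAdd s t)"
  "a \<odot>\<^bsub>free_lie scale\<^esub> lcls scale s = lcls scale (LSmult a s)"
  "bracket (free_lie scale) (lcls scale s) (lcls scale t) = lcls scale (LBr s t)"
  "grade (free_lie scale) p = lcls scale ` {t. lhomogeneous p t}"
  by (simp_all add: free_lie_def lie_eq_iff_lcls lie_eq.cong_add lie_eq.cong_smult lie_eq.cong_br
      lie_eq.sym[OF lie_eq_lrep])

lemma free_lie_lie_algebra: "lie_algebra (free_lie scale)"
proof (rule lie_algebraI)
  let ?F = "free_lie scale"
  note [simp] = free_lie_ops
  show "\<zero>\<^bsub>?F\<^esub> \<in> carrier ?F" by simp
  fix x assume "x \<in> carrier ?F"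
  then obtain r where x [simp]: "x = lcls scale r" by auto
  show "1 \<odot>\<^bsub>?F\<^esub> x = x" "\<zero>\<^bsub>?F\<^esub> \<oplus>\<^bsub>?F\<^esub> x = x" "((- 1) \<odot>\<^bsub>?F\<^esub> x) \<oplus>\<^bsub>?F\<^esub> x = \<zero>\<^bsub>?F\<^esub>" "bracket ?F x x = \<zero>\<^bsub>?F\<^esub>"
    by (simp_all add: lie_eq_iff_lcls lie_eq.smult_one lie_eq.add_zero lie_eq.add_neg lie_eq.br_self)
  fix a b
  show "a \<odot>\<^bsub>?F\<^esub> x \<in> carrier ?F" by simp
  show "(a + b) \<odot>\<^bsub>?F\<^esub> x = (a \<odot>\<^bsub>?F\<^esub> x) \<oplus>\<^bsub>?F\<^esub> (b \<odot>\<^bsub>?F\<^esub> x)" "(a * b) \<odot>\<^bsub>?F\<^esub> x = a \<odot>\<^bsub>?F\<^esub> (b \<odot>\<^bsub>?F\<^esub> x)"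
    by (simp_all add: lie_eq_iff_lcls lie_eq.smult_add_left lie_eq.smult_smult)
  fix y assume "y \<in> carrier ?F"
  then obtain s where y [simp]: "y = lcls scale s" by auto
  show "x \<oplus>\<^bsub>?F\<^esub> y \<in> carrier ?F" "bracket ?F x y \<in> carrier ?F" by simp_all
  show "x \<oplus>\<^bsub>?F\<^esub> y = y \<oplus>\<^bsub>?F\<^esub> x" "a \<odot>\<^bsub>?F\<^esub> (x \<oplus>\<^bsub>?F\<^esub> y) = (a \<odot>\<^bsub>?F\<^esub> x) \<oplus>\<^bsub>?F\<^esub> (a \<odot>\<^bsub>?F\<^esub> y)"
    "bracket ?F (a \<odot>\<^bsub>?F\<^esub> x) y = a \<odot>\<^bsub>?F\<^esub> bracket ?F x y" "bracket ?F x (a \<odot>\<^bsub>?F\<^esub> y) = a \<odot>\<^bsub>?F\<^esub> bracket ?F x y"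
    by (simp_all add: lie_eq_iff_lcls lie_eq.add_comm lie_eq.smult_add_right lie_eq.br_smult_left lie_eq.br_smult_right)
  fix z assume "z \<in> carrier ?F"
  then obtain t where z [simp]: "z = lcls scale t" by auto
  show "x \<oplus>\<^bsub>?F\<^esub> y \<oplus>\<^bsub>?F\<^esub> z = x \<oplus>\<^bsub>?F\<^esub> (y \<oplus>\<^bsub>?F\<^esub> z)"
    "bracket ?F (x \<oplus>\<^bsub>?F\<^esub> y) z = bracket ?F x z \<oplus>\<^bsub>?F\<^esub> bracket ?F y z"
    "bracket ?F x (y \<oplus>\<^bsub>?F\<^esub> z) = bracket ?F x y \<oplus>\<^bsub>?F\<^esub> bracket ?F x z"
    "bracket ?F x (bracket ?F y z) \<oplus>\<^bsub>?F\<^esub> bracket ?F y (bracket ?F z x) \<oplus>\<^bsub>?F\<^esub> bracket ?F z (bracket ?F x y) = \<zero>\<^bsub>?F\<^esub>"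
    by (simp_all add: lie_eq_iff_lcls lie_eq.add_assoc lie_eq.br_add_left lie_eq.br_add_right lie_eq.br_jacobi)
qed

text \<open>The conditions on L, unpacked from \<open>gl_lie\<close>. Besides the given L, the set
  of all endomorphisms is an instance, so that statements about F(V) arise as the case of
  \<open>all_linear\<close>.\<close>

locale base_space_type = base_space scale
  for scale :: "'k::field \<Rightarrow> 'v::ab_group_add \<Rightarrow> 'v" +
  fixes L :: "('v \<Rightarrow> 'v) set"
  assumes L_linear: "T \<in> L \<Longrightarrow> Vector_Spaces.linear scale scale T"
    and L_zero: "(\<lambda>_. 0) \<in> L"
    and L_add: "S \<in> L \<Longrightarrow> T \<in> L \<Longrightarrow> (\<lambda>v. S v + T v) \<in> L"
    and L_scale: "T \<in> L \<Longrightarrow> (\<lambda>v. scale a (T v)) \<in> L"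
    and L_commutator: "S \<in> L \<Longrightarrow> T \<in> L \<Longrightarrow> (\<lambda>v. S (T v) - T (S v)) \<in> L"
begin

lemma L_diff: "S \<in> L \<Longrightarrow> T \<in> L \<Longrightarrow> (\<lambda>v. S v - T v) \<in> L"
  using L_add[of S "\<lambda>v. scale (- 1) (T v)"] L_scale[of T "- 1"] by simp

section \<open>Stability of the type condition\<close>

lemma multilinear_of_typeD:
  assumes "multilinear_of_type L \<xi>"
  shows "multilinear \<xi>" "(\<lambda>v. \<xi> (vs @ [v])) \<in> L"
  using assms by (auto simp: multilinear_of_type_def)

lemma multilinear_of_type_zero: "multilinear_of_type L 0"
  by (simp add: multilinear_of_type_def multilinear_closed L_zero)

lemma multilinear_of_type_add:
  "multilinear_of_type L \<xi> \<Longrightarrow> multilinear_of_type L \<eta> \<Longrightarrow> multilinear_of_type L (\<xi> + \<eta>)"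
  by (simp add: multilinear_of_type_def multilinear_closed L_add)

lemma multilinear_of_type_diff:
  "multilinear_of_type L \<xi> \<Longrightarrow> multilinear_of_type L \<eta> \<Longrightarrow> multilinear_of_type L (\<xi> - \<eta>)"
  by (simp add: multilinear_of_type_def multilinear_closed L_diff)

lemma multilinear_of_type_fscale: "multilinear_of_type L \<xi> \<Longrightarrow> multilinear_of_type L (fscale a \<xi>)"
  unfolding multilinear_of_type_def using multilinear_fscale L_scale by (auto simp: fscale_def)

lemma multilinear_of_type_contract:
  assumes "multilinear_of_type L \<xi>"
  shows "multilinear_of_type L (contract \<xi> v)"
proof -
  have "(\<lambda>w. contract \<xi> v (vs @ [w])) = (\<lambda>w. \<xi> ((v # vs) @ [w]))" for vs by (simp add: contract_def)
  then show ?thesis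
    using multilinear_of_typeD[OF assms] by (simp only: multilinear_of_type_def multilinear_contract simp_thms)
qed

text \<open>Only the last entry is inspected, so the prefix is removed by induction. For the empty
  prefix the bracket is the commutator of two members of L: here L has to be a Lie subalgebra and
  not merely a subspace.\<close>

lemma multilinear_of_type_nb:
  assumes "multilinear_of_type L \<xi>" "multilinear_of_type L \<eta>"
  shows "multilinear_of_type L (nb \<xi> \<eta>)"
proof -
  have "(\<lambda>w. nb \<xi> \<eta> (vs @ [w])) \<in> L" if "multilinear_of_type L \<xi>" "multilinear_of_type L \<eta>" for vs \<xi> \<eta>
    using that
  proof (induction vs arbitrary: \<xi> \<eta>)
    case Nil
    have "(\<lambda>w. \<xi> [\<eta> [w]] - \<eta> [\<xi> [w]]) \<in> L"
      using L_commutator[of "\<lambda>v. \<xi> [v]" "\<lambda>v. \<eta> [v]"] multilinear_of_typeD(2)[OF Nil(1), of "[]"]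
        multilinear_of_typeD(2)[OF Nil(2), of "[]"] by simp
    then show ?case by simp
  next
    case (Cons v vs)
    note 1 = Cons.IH[OF multilinear_of_type_contract[OF Cons.prems(1)] Cons.prems(2), of v]
      and 2 = Cons.IH[OF Cons.prems(1) multilinear_of_type_contract[OF Cons.prems(2)], of v]
      and 3 = multilinear_of_typeD(2)[OF Cons.prems(2), of "\<xi> [v] # vs"]
      and 4 = multilinear_of_typeD(2)[OF Cons.prems(1), of "\<eta> [v] # vs"]
    show ?case using L_add[OF L_diff[OF 1 3] L_add[OF 2 4]] by simp
  qed
  then show ?thesis
    using assms multilinear_nb by (simp add: multilinear_of_type_def)
qed

lemmas multilinear_of_type_closed = multilinear_of_type_zero multilinear_of_type_add
  multilinear_of_type_diff multilinear_of_type_fscale multilinear_of_type_contract multilinear_of_type_nb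

lemma list_fun_component_iff:
  "list_fun_component p \<xi> \<in> multilinear_maps_of_type scale L p \<longleftrightarrow>
    (\<forall>us ws. length us + length ws = p \<longrightarrow> Vector_Spaces.linear scale scale (\<lambda>v. \<xi> (us @ v # ws))) \<and>
    (\<forall>vs. length vs = p \<longrightarrow> (\<lambda>v. \<xi> (vs @ [v])) \<in> L)"
  by (auto simp: list_fun_component_def multilinear_maps_of_type_def multilinear_maps_def)

text \<open>The degreewise description agrees with the uniform one. What needs an argument is
  finiteness: finitely many nonzero components means a bound on the lengths of lists with nonzero
  value, where lists of length \<open>p + 1\<close> belong to degree p.\<close>

lemma list_fun_sum_eq: "list_fun_sum (multilinear_maps_of_type scale L) = {\<xi>. multilinear_of_type L \<xi>}"
proof -
  have fin: "finite {p. list_fun_component p \<xi> \<noteq> (\<lambda>_. 0)} \<longleftrightarrow> (\<exists>n. \<forall>vs. length vs > n \<longrightarrow> \<xi> vs = 0)"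
    for \<xi> :: "'v list \<Rightarrow> 'v"
  proof
    assume "finite {p. list_fun_component p \<xi> \<noteq> (\<lambda>_. 0)}"
    then obtain m where m: "\<And>p. list_fun_component p \<xi> \<noteq> (\<lambda>_. 0) \<Longrightarrow> p < m"
      by (auto simp: finite_nat_set_iff_bounded)
    have "\<xi> vs = 0" if "length vs > m" for vs
    proof -
      have "list_fun_component (length vs - 1) \<xi> = (\<lambda>_. 0)" using m[of "length vs - 1"] that by linarith
      from fun_cong[OF this, of vs] show ?thesis using that by (cases vs) (simp_all add: list_fun_component_def)
    qed
    then show "\<exists>n. \<forall>vs. length vs > n \<longrightarrow> \<xi> vs = 0" by blast
  next
    assume "\<exists>n. \<forall>vs. length vs > n \<longrightarrow> \<xi> vs = 0"
    then obtain n where n: "\<forall>vs. length vs > n \<longrightarrow> \<xi> vs = 0" ..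
    have "{p. list_fun_component p \<xi> \<noteq> (\<lambda>_. 0)} \<subseteq> {..n}"
    proof
      fix p assume "p \<in> {p. list_fun_component p \<xi> \<noteq> (\<lambda>_. 0)}"
      then obtain vs where "length vs = p + 1" "\<xi> vs \<noteq> 0"
        by (auto simp: list_fun_component_def fun_eq_iff split: if_splits)
      then show "p \<in> {..n}" using n[rule_format, of vs] by (cases "n < p + 1") auto
    qed
    then show "finite {p. list_fun_component p \<xi> \<noteq> (\<lambda>_. 0)}" by (rule finite_subset) simp
  qed
  show ?thesis
    unfolding list_fun_sum_def fin list_fun_component_iff multilinear_of_type_def multilinear_def linear_self_iff
    by auto
qed

end

lemma base_space_typeI:
  assumes "vector_space scale" and L: "lie_subalgebra L (gl_lie scale)"
  shows "base_space_type scale L"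
proof -
  interpret S: Module.submodule L "ring_of_type_algebra :: 'a ring" "gl_lie scale"
    using L by (simp add: lie_subalgebra_def)
  show ?thesis
  proof (intro base_space_type.intro base_space.intro base_space_type_axioms.intro assms(1))
    show "T \<in> L \<Longrightarrow> Vector_Spaces.linear scale scale T" for T
      using S.subset by (auto simp: gl_lie_def)
    show "(\<lambda>_. 0) \<in> L" using S.one_closed by (simp add: gl_lie_def)
    show "S \<in> L \<Longrightarrow> T \<in> L \<Longrightarrow> (\<lambda>v. S v + T v) \<in> L" for S T using S.m_closed by (simp add: gl_lie_def)
    show "T \<in> L \<Longrightarrow> (\<lambda>v. scale a (T v)) \<in> L" for a T using S.smult_closed by (simp add: gl_lie_def)
    show "S \<in> L \<Longrightarrow> T \<in> L \<Longrightarrow> (\<lambda>v. S (T v) - T (S v)) \<in> L" for S T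
      using L unfolding lie_subalgebra_def by (simp add: gl_lie_def)
  qed
qed

context base_space
begin

abbreviation all_linear :: "('v \<Rightarrow> 'v) set" where
  "all_linear \<equiv> {T. Vector_Spaces.linear scale scale T}"

lemma base_space_type_linear: "base_space_type scale all_linear"
  by unfold_locales
     (auto simp: linear_self_iff scale_right_distrib scale_right_diff_distrib scale_left_commute)

lemma multilinear_of_type_linear: "multilinear_of_type all_linear \<xi> \<longleftrightarrow> multilinear \<xi>"
  unfolding multilinear_of_type_def by (auto simp: linear_self_iff multilinear_def)

lemma list_fun_sum_multilinear_maps: "list_fun_sum (multilinear_maps scale) = {\<xi>. multilinear \<xi>}"
proof -
  interpret base_space_type scale all_linear by (rule base_space_type_linear)
  have "multilinear_maps_of_type scale all_linear p = multilinear_maps scale p" for p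
  proof -
    have "Vector_Spaces.linear scale scale (\<lambda>v. \<xi> (vs @ [v]))" if "\<xi> \<in> multilinear_maps scale (length vs)" for \<xi> vs
    proof -
      from that have "\<forall>us ws. length us + length ws = length vs \<longrightarrow> Vector_Spaces.linear scale scale (\<lambda>v. \<xi> (us @ v # ws))"
        by (simp add: multilinear_maps_def)
      from this[rule_format, of vs "[]"] show ?thesis by simp
    qed
    then show ?thesis by (auto simp: multilinear_maps_of_type_def)
  qed
  then have "list_fun_sum (multilinear_maps scale) = list_fun_sum (multilinear_maps_of_type scale all_linear)"
    by (simp add: list_fun_sum_def)
  then show ?thesis by (simp add: list_fun_sum_eq multilinear_of_type_linear)
qed

section \<open>The action on the free Lie algebra\<close>

definition cl :: "('k, 'v) lterm \<Rightarrow> ('k, ('k, 'v) lterm set) lie_product" where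
  "cl t = lemb (free_lie scale) (lcls scale t)"

lemma cl_eq_iff: "cl s = cl t \<longleftrightarrow> lie_eq scale s t"
  unfolding cl_def by (subst lemb_inject[OF free_lie_lie_algebra]) (auto simp: free_lie_ops lie_eq_iff_lcls)

lemma cl_simps:
  "cl LZero = 0" "cl (LAdd s t) = cl s + cl t" "cl (LSmult a s) = lscale a (cl s)" "cl (LBr s t) = lbr (cl s) (cl t)"
proof -
  have c: "lcls scale t \<in> carrier (free_lie scale)" for t by (simp add: free_lie_ops)
  show "cl LZero = 0" unfolding cl_def by (metis free_lie_ops(2) lemb_zero[OF free_lie_lie_algebra])
  show "cl (LAdd s t) = cl s + cl t"
    unfolding cl_def using lemb_add[OF free_lie_lie_algebra c c, of s t] by (simp add: free_lie_ops)
  show "cl (LSmult a s) = lscale a (cl s)"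
    unfolding cl_def using lemb_smult[OF free_lie_lie_algebra c[of s], of a] by (simp add: free_lie_ops)
  show "cl (LBr s t) = lbr (cl s) (cl t)"
    unfolding cl_def using lemb_bracket[OF free_lie_lie_algebra c c, of s t] by (simp add: free_lie_ops)
qed

lemma cl_LGen_add: "cl (LGen (v + w)) = cl (LGen v) + cl (LGen w)"
  using cl_eq_iff lie_eq.gen_add[of scale v w] by (simp flip: cl_simps)

lemma cl_LGen_scale: "cl (LGen (scale a v)) = lscale a (cl (LGen v))"
  using cl_eq_iff lie_eq.gen_smult[of scale a v] by (simp flip: cl_simps)

lemma cl_LGen_minus: "cl (LGen (- v)) = - cl (LGen v)"
  using cl_LGen_scale[of "- 1" v] by simp

lemma cl_LGen_diff: "cl (LGen (v - w)) = cl (LGen v) - cl (LGen w)"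
  using cl_LGen_add[of v "- w"] by (simp add: cl_LGen_minus)

lemma cl_LGen_zero: "cl (LGen 0) = 0"
  using cl_LGen_add[of 0 0] by simp

lemmas cl_LGen = cl_LGen_add cl_LGen_scale cl_LGen_minus cl_LGen_diff cl_LGen_zero

text \<open>\<open>nact t \<xi>\<close> and \<open>pact t \<xi>\<close> are the parts of negative
  and of nonnegative degree of \<open>[\<xi>, t]\<close>. The first is kept as a term, since it is
  bracketed again in the rule for \<open>LBr\<close>.\<close>

definition nact :: "('k, 'v) lterm \<Rightarrow> ('v list \<Rightarrow> 'v) \<Rightarrow> ('k, 'v) lterm" where
  "nact t \<xi> = fst (act scale t \<xi>)"

definition pact :: "('k, 'v) lterm \<Rightarrow> ('v list \<Rightarrow> 'v) \<Rightarrow> 'v list \<Rightarrow> 'v" where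
  "pact t \<xi> = snd (act scale t \<xi>)"

lemma nact_simps:
  "nact (LGen v) \<xi> = LGen (\<xi> [v])"
  "nact LZero \<xi> = LZero"
  "nact (LAdd s t) \<xi> = LAdd (nact s \<xi>) (nact t \<xi>)"
  "nact (LSmult a s) \<xi> = LSmult a (nact s \<xi>)"
  "nact (LBr s t) \<xi> = LAdd (LAdd (LBr (nact s \<xi>) t) (nact t (pact s \<xi>)))
     (LSmult (- 1) (LAdd (LBr (nact t \<xi>) s) (nact s (pact t \<xi>))))"
  by (simp_all add: nact_def pact_def case_prod_unfold Let_def)

lemma pact_simps:
  "pact (LGen v) \<xi> = contract \<xi> v"
  "pact LZero \<xi> = 0"
  "pact (LAdd s t) \<xi> = pact s \<xi> + pact t \<xi>"
  "pact (LSmult a s) \<xi> = fscale a (pact s \<xi>)"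
  "pact (LBr s t) \<xi> = pact t (pact s \<xi>) - pact s (pact t \<xi>)"
  by (simp_all add: nact_def pact_def case_prod_unfold Let_def fscale_def fun_eq_iff)

lemma pact_multilinear: "multilinear \<xi> \<Longrightarrow> multilinear (pact t \<xi>)"
  by (induction t arbitrary: \<xi>) (simp_all add: pact_simps multilinear_closed)

lemma pact_linear_raw:
  "(\<forall>\<xi> \<eta>. pact t (\<xi> + \<eta>) = pact t \<xi> + pact t \<eta>) \<and> (\<forall>a \<xi>. pact t (fscale a \<xi>) = fscale a (pact t \<xi>))"
proof (induction t)
  case (LGen v)
  show ?case unfolding pact_simps contract_simps by blast
next
  case (LBr s t)
  then show ?case by (simp only: pact_simps) (simp add: fscale_def fun_eq_iff scale_right_diff_distrib)
qed (simp_all add: pact_simps contract_simps, simp_all add: fscale_def fun_eq_iff scale_right_distrib scale_left_commute)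

lemma pact_add: "pact t (\<xi> + \<eta>) = pact t \<xi> + pact t \<eta>"
  and pact_fscale: "pact t (fscale a \<xi>) = fscale a (pact t \<xi>)"
  using pact_linear_raw[of t] by blast+

lemma pact_minus: "pact t (- \<xi>) = - pact t \<xi>"
  using pact_fscale[of t "- 1" \<xi>] by (simp only: fscale_neg_one)

lemma pact_diff: "pact t (\<xi> - \<eta>) = pact t \<xi> - pact t \<eta>"
  using pact_add[of t \<xi> "- \<eta>"] by (simp only: pact_minus diff_conv_add_uminus)

lemma pact_zero: "pact t 0 = 0"
  using pact_add[of t 0 0] by simp

lemmas pact_linear = pact_add pact_fscale pact_minus pact_diff pact_zero

text \<open>Linearity in \<xi> is a statement about classes: on a generator the two sides are
  \<open>LGen (\<xi> [v] + \<eta> [v])\<close> and a sum of two generators, which are different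
  terms identified by \<open>gen_add\<close>.\<close>

lemma cl_nact_linear_raw:
  "(\<forall>\<xi> \<eta>. cl (nact t (\<xi> + \<eta>)) = cl (nact t \<xi>) + cl (nact t \<eta>)) \<and>
    (\<forall>a \<xi>. cl (nact t (fscale a \<xi>)) = lscale a (cl (nact t \<xi>)))"
proof (induction t)
  case (LGen v)
  show ?case by (simp add: nact_simps cl_LGen fscale_def)
next
  case (LBr s t)
  then show ?case
    by (simp only: nact_simps cl_simps pact_linear lbr_simps lie_product.scale_right_distrib)
       (simp add: algebra_simps)
next
  case (LSmult a t)
  then show ?case
    by (simp only: nact_simps cl_simps lie_product.scale_right_distrib lie_product.scale_left_commute) simp
qed (simp_all add: nact_simps cl_simps lie_product.scale_right_distrib algebra_simps)

lemma cl_nact_add: "cl (nact t (\<xi> + \<eta>)) = cl (nact t \<xi>) + cl (nact t \<eta>)"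
  and cl_nact_fscale: "cl (nact t (fscale a \<xi>)) = lscale a (cl (nact t \<xi>))"
  using cl_nact_linear_raw[of t] by blast+

lemma cl_nact_minus: "cl (nact t (- \<xi>)) = - cl (nact t \<xi>)"
  using cl_nact_fscale[of t "- 1" \<xi>] by (simp add: fscale_neg_one)

lemma cl_nact_diff: "cl (nact t (\<xi> - \<eta>)) = cl (nact t \<xi>) - cl (nact t \<eta>)"
  using cl_nact_add[of t \<xi> "- \<eta>"] by (simp only: cl_nact_minus diff_conv_add_uminus)

lemma cl_nact_zero: "cl (nact t 0) = 0"
  using cl_nact_add[of t 0 0] by simp

lemmas cl_nact_linear = cl_nact_add cl_nact_fscale cl_nact_minus cl_nact_diff cl_nact_zero

text \<open>
  On pairs \<open>(P, \<xi>)\<close>, a term \<open>t\<close> acts by \<open>(P, \<xi>) \<mapsto> ([P, t] + nact t \<xi>, pact t \<xi>)\<close>, and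
  \<open>LBr s t\<close> acts by the commutator of the actions of \<open>t\<close> and \<open>s\<close>. Commutators satisfy the
  axioms of a Lie algebra, so the action is compatible with \<open>lie_eq\<close>.
\<close>

lemma lie_eq_act:
  assumes "lie_eq scale s t"
  shows "\<forall>\<xi>. multilinear \<xi> \<longrightarrow> cl (nact s \<xi>) = cl (nact t \<xi>) \<and> pact s \<xi> = pact t \<xi>"
  using assms
proof (induction rule: lie_eq.induct)
  \<comment> \<open>The triple brackets that remain after expansion become left-normed by
    \<open>lbr_lbr\<close> and then cancel.\<close>
  case (br_jacobi s t u)
  show ?case
    by (simp add: nact_simps pact_simps cl_simps pact_linear cl_nact_linear lbr_simps)
       (simp add: lbr_lbr algebra_simps)
next
  \<comment> \<open>The terms themselves occur beside their actions, so equality of their classes is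
    needed as well; the induction hypotheses are also used at \<open>pact s \<xi>\<close> and
    \<open>pact t \<xi>\<close>, which are multilinear.\<close>
  case (cong_br s s' t t')
  then have "cl s = cl s'" "cl t = cl t'" by (simp_all add: cl_eq_iff)
  with cong_br show ?case
    by (simp add: nact_simps pact_simps cl_simps pact_multilinear)
next
  \<comment> \<open>The relations between generators are respected because \<xi> is linear in its
    first argument.\<close>
  case (gen_add v w)
  then show ?case by (auto simp: nact_simps pact_simps cl_simps cl_LGen contract_linear multilinear_Cons)
next
  case (gen_smult a v)
  then show ?case by (auto simp: nact_simps pact_simps cl_simps cl_LGen contract_linear multilinear_Cons)
qed (simp_all add: nact_simps pact_simps cl_simps pact_linear cl_nact_linear lbr_simps algebra_simps,
   simp_all add: fscale_def fun_eq_iff algebra_simps scale_right_distrib scale_right_diff_distrib scale_left_distrib)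

text \<open>The Jacobi identity \<open>[[\<xi>, \<eta>], r] = [\<xi>, [\<eta>, r]] - [\<eta>,
  [\<xi>, r]]\<close> for r in \<open>f(V)\<close>, split into its negative and nonnegative parts.
  On generators it is the recursion of \<open>nonneg_bracket\<close>; the rule for
  \<open>LBr\<close> carries it to brackets.\<close>

lemma act_bracket_raw:
  "\<forall>\<xi> \<eta>. multilinear \<xi> \<longrightarrow> multilinear \<eta> \<longrightarrow>
    cl (nact r (nb \<xi> \<eta>)) = cl (nact (nact r \<eta>) \<xi>) - cl (nact (nact r \<xi>) \<eta>) \<and>
    pact r (nb \<xi> \<eta>) = pact (nact r \<eta>) \<xi> + nb \<xi> (pact r \<eta>) - pact (nact r \<xi>) \<eta> - nb \<eta> (pact r \<xi>)"
proof (induction r)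
  case (LGen v)
  show ?case
    by (auto simp: nact_simps pact_simps cl_LGen contract_nb nb_antisym[of _ "contract _ _"] algebra_simps)
next
  case LZero
  show ?case
  proof (intro allI impI)
    fix \<xi> \<eta> assume m: "multilinear \<xi>" "multilinear \<eta>"
    show "cl (nact LZero (nb \<xi> \<eta>)) = cl (nact (nact LZero \<eta>) \<xi>) - cl (nact (nact LZero \<xi>) \<eta>) \<and>
      pact LZero (nb \<xi> \<eta>) = pact (nact LZero \<eta>) \<xi> + nb \<xi> (pact LZero \<eta>) - pact (nact LZero \<xi>) \<eta> - nb \<eta> (pact LZero \<xi>)"
      unfolding nact_simps pact_simps nb_zero_right[OF m(1)] nb_zero_right[OF m(2)] by (simp add: cl_simps)
  qed
next
  case (LAdd s t)
  show ?case
  proof (intro allI impI)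
    fix \<xi> \<eta> assume m: "multilinear \<xi>" "multilinear \<eta>"
    note IH = LAdd.IH(1)[rule_format, OF m] LAdd.IH(2)[rule_format, OF m]
    show "cl (nact (LAdd s t) (nb \<xi> \<eta>)) = cl (nact (nact (LAdd s t) \<eta>) \<xi>) - cl (nact (nact (LAdd s t) \<xi>) \<eta>) \<and>
      pact (LAdd s t) (nb \<xi> \<eta>) = pact (nact (LAdd s t) \<eta>) \<xi> + nb \<xi> (pact (LAdd s t) \<eta>)
        - pact (nact (LAdd s t) \<xi>) \<eta> - nb \<eta> (pact (LAdd s t) \<xi>)"
      by (simp add: nact_simps pact_simps cl_simps nb_add_right m IH[THEN conjunct1] IH[THEN conjunct2])
  qed
next
  case (LSmult a s)
  show ?case
  proof (intro allI impI)
    fix \<xi> \<eta> assume m: "multilinear \<xi>" "multilinear \<eta>"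
    note IH = LSmult.IH[rule_format, OF m]
    have f: "fscale a (\<alpha> + \<beta>) = fscale a \<alpha> + fscale a \<beta>" "fscale a (\<alpha> - \<beta>) = fscale a \<alpha> - fscale a \<beta>" for \<alpha> \<beta>
      by (simp_all add: fscale_def fun_eq_iff scale_right_distrib scale_right_diff_distrib)
    show "cl (nact (LSmult a s) (nb \<xi> \<eta>)) = cl (nact (nact (LSmult a s) \<eta>) \<xi>) - cl (nact (nact (LSmult a s) \<xi>) \<eta>) \<and>
      pact (LSmult a s) (nb \<xi> \<eta>) = pact (nact (LSmult a s) \<eta>) \<xi> + nb \<xi> (pact (LSmult a s) \<eta>)
        - pact (nact (LSmult a s) \<xi>) \<eta> - nb \<eta> (pact (LSmult a s) \<xi>)"
      by (simp add: nact_simps pact_simps cl_simps nb_scale_right m IH[THEN conjunct1] IH[THEN conjunct2] f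
          lie_product.scale_right_diff_distrib)
  qed
next
  case (LBr s t)
  show ?case
  proof (intro allI impI)
    fix \<xi> \<eta> assume m: "multilinear \<xi>" "multilinear \<eta>"
    note IH1 = LBr.IH(1)[rule_format, THEN conjunct1] LBr.IH(2)[rule_format, THEN conjunct1]
      and IH2 = LBr.IH(1)[rule_format, THEN conjunct2] LBr.IH(2)[rule_format, THEN conjunct2]
    have p: "pact (LBr s t) (nb \<xi> \<eta>) = pact (nact (LBr s t) \<eta>) \<xi> + nb \<xi> (pact (LBr s t) \<eta>)
        - pact (nact (LBr s t) \<xi>) \<eta> - nb \<eta> (pact (LBr s t) \<xi>)"
      by (simp add: pact_simps nact_simps IH2 m pact_linear pact_multilinear nb_diff_right fscale_neg_one
          nb_antisym[of "pact t \<xi>" "pact s \<eta>"] nb_antisym[of "pact t \<eta>" "pact s \<xi>"])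
    have n: "cl (nact (LBr s t) (nb \<xi> \<eta>)) = cl (nact (nact (LBr s t) \<eta>) \<xi>) - cl (nact (nact (LBr s t) \<xi>) \<eta>)"
      by (simp add: pact_simps nact_simps cl_simps IH1 IH2 m pact_linear cl_nact_linear pact_multilinear lbr_simps
          lbr_antisym[of "cl (nact t \<xi>)" "cl (nact s \<eta>)"] lbr_antisym[of "cl (nact t \<eta>)" "cl (nact s \<xi>)"])
    show "cl (nact (LBr s t) (nb \<xi> \<eta>)) = cl (nact (nact (LBr s t) \<eta>) \<xi>) - cl (nact (nact (LBr s t) \<xi>) \<eta>) \<and>
      pact (LBr s t) (nb \<xi> \<eta>) = pact (nact (LBr s t) \<eta>) \<xi> + nb \<xi> (pact (LBr s t) \<eta>)
        - pact (nact (LBr s t) \<xi>) \<eta> - nb \<eta> (pact (LBr s t) \<xi>)"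
      using n p by blast
  qed
qed

end


section \<open>Gradings by eigenvalues\<close>

text \<open>Applying D to the relation and subtracting q times the relation removes the summand of
  degree q and multiplies the others by \<open>p - q\<close>, which is nonzero in characteristic
  zero. The family c varies in the induction because these factors rescale it.\<close>

lemma lie_eigenvectors_independent:
  fixes G :: "('k::field_char_0, 'g) graded_struct"
  assumes G: "lie_algebra G" and gc: "\<And>p. grade G p \<subseteq> carrier G"
    and D: "\<And>x. x \<in> carrier G \<Longrightarrow> D x \<in> carrier G"
    and add: "\<And>x y. x \<in> carrier G \<Longrightarrow> y \<in> carrier G \<Longrightarrow> D (x \<oplus>\<^bsub>G\<^esub> y) = D x \<oplus>\<^bsub>G\<^esub> D y"
    and eig: "\<And>x p. x \<in> grade G p \<Longrightarrow> D x = of_int p \<odot>\<^bsub>G\<^esub> x"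
    and sub: "\<And>p. Module.submodule (grade G p) (ring_of_type_algebra :: 'k ring) G"
    and A: "finite A" and c: "\<And>p. p \<in> A \<Longrightarrow> c p \<in> grade G p" and zero: "finsum G c A = \<zero>\<^bsub>G\<^esub>"
  shows "\<forall>p\<in>A. c p = \<zero>\<^bsub>G\<^esub>"
proof -
  have D0: "D \<zero>\<^bsub>G\<^esub> = \<zero>\<^bsub>G\<^esub>"
  proof -
    have "(0 :: 'k) \<odot>\<^bsub>G\<^esub> \<zero>\<^bsub>G\<^esub> = \<zero>\<^bsub>G\<^esub>"
      by (subst lemb_inject[OF G, symmetric]) (simp_all add: lemb_simps[OF G])
    then show ?thesis using eig[OF submodule_of_lie_zero[OF G sub], of 0] by simp
  qed
  have D_finsum: "lemb G (D (finsum G c A)) = (\<Sum>p\<in>A. lscale (of_int p) (lemb G (c p)))"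
    if "finite A" "\<And>p. p \<in> A \<Longrightarrow> c p \<in> grade G p" for A c
    using that
  proof (induction A rule: finite_induct)
    interpret lie_algebra G by (rule G)
    case empty
    then show ?case by (simp add: D0 lemb_zero[OF G])
  next
    interpret lie_algebra G by (rule G)
    case (insert p A)
    have "c \<in> A \<rightarrow> carrier G" "c p \<in> carrier G" using gc insert(4) by blast+
    then show ?case
      using insert by (simp add: add eig[of "c p" p] lemb_add[OF G] lemb_smult[OF G] D lie_algebra_closed[OF G])
  qed
  show ?thesis using A c zero
  proof (induction A arbitrary: c rule: finite_induct)
    case (insert q A)
    have cc: "c p \<in> carrier G" if "p \<in> insert q A" for p using gc insert(4) that by blast
    have s: "(\<Sum>p\<in>insert q A. lemb G (c p)) = 0"
      using finsum_eq_iff_lemb[OF G, of "insert q A" c "\<zero>\<^bsub>G\<^esub>"] insert cc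
      by (auto simp: lemb_zero[OF G] lie_algebra_closed[OF G])
    moreover have d: "(\<Sum>p\<in>insert q A. lscale (of_int p) (lemb G (c p))) = 0"
      using D_finsum[of "insert q A" c] insert by (simp add: D0 lemb_zero[OF G])
    ultimately have "(\<Sum>p\<in>insert q A. lscale (of_int p) (lemb G (c p))) - lscale (of_int q) (\<Sum>p\<in>insert q A. lemb G (c p)) = 0"
      by simp
    then have "(\<Sum>p\<in>insert q A. lscale (of_int (p - q)) (lemb G (c p))) = 0"
      by (simp only: lie_product.scale_sum_right sum_subtractf[symmetric] lie_product.scale_left_diff_distrib of_int_diff)
    then have "(\<Sum>p\<in>A. lemb G (of_int (p - q) \<odot>\<^bsub>G\<^esub> c p)) = 0"
      using insert(1,2) cc by (simp add: lemb_smult[OF G])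
    then have f: "finsum G (\<lambda>p. of_int (p - q) \<odot>\<^bsub>G\<^esub> c p) A = \<zero>\<^bsub>G\<^esub>"
      using finsum_eq_iff_lemb[OF G, of A "\<lambda>p. of_int (p - q) \<odot>\<^bsub>G\<^esub> c p" "\<zero>\<^bsub>G\<^esub>"] insert(1) cc
      by (auto simp: lemb_zero[OF G] lie_algebra_closed[OF G])
    have "of_int (p - q) \<odot>\<^bsub>G\<^esub> c p = \<zero>\<^bsub>G\<^esub>" if "p \<in> A" for p
      using insert.IH[OF _ f] insert(4) that submodule_of_lie_smult[OF G sub] by blast
    then have z: "lscale (of_int (p - q)) (lemb G (c p)) = 0" if "p \<in> A" for p
      using that cc by (simp flip: lemb_smult[OF G] lemb_zero[OF G])
    have zA: "lemb G (c p) = 0" if "p \<in> A" for p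
      using z[OF that] insert(2) that by auto
    then have "lemb G (c q) = 0" using s insert(1,2) by simp
    with zA have "lemb G (c p) = lemb G \<zero>\<^bsub>G\<^esub>" if "p \<in> insert q A" for p
      using that by (auto simp: lemb_zero[OF G])
    then show ?case using lemb_inject[OF G] cc lie_algebra_closed(1)[OF G] by blast
  qed simp
qed

text \<open>
  Since \<open>x \<mapsto> [x, E]\<close> is a derivation, the bracket of two eigenvectors is an eigenvector for
  the sum of the eigenvalues.
\<close>

lemma graded_lie_algebra_eigenI:
  fixes G :: "('k::field_char_0, 'g) graded_struct"
  assumes G: "lie_algebra G"
    and sub: "\<And>p. Module.submodule (grade G p) (ring_of_type_algebra :: 'k ring) G"
    and span: "\<And>U. U \<subseteq> carrier G \<Longrightarrow> (\<And>p. grade G p \<subseteq> U) \<Longrightarrow>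
      (\<And>x y. x \<in> U \<Longrightarrow> y \<in> U \<Longrightarrow> x \<oplus>\<^bsub>G\<^esub> y \<in> U) \<Longrightarrow> carrier G \<subseteq> U"
    and E: "E \<in> carrier G" and eig: "\<And>x p. x \<in> grade G p \<Longrightarrow> bracket G x E = of_int p \<odot>\<^bsub>G\<^esub> x"
  shows "graded_lie_algebra G"
proof -
  interpret lie_algebra G by (rule G)
  have gc: "grade G p \<subseteq> carrier G" for p using submodule_of_lie_subset[OF G sub] .
  have indep: "\<forall>p\<in>A. c p = \<zero>\<^bsub>G\<^esub>" if "finite A" "\<And>p. p \<in> A \<Longrightarrow> c p \<in> grade G p" "finsum G c A = \<zero>\<^bsub>G\<^esub>" for A c
    by (rule lie_eigenvectors_independent[where D = "\<lambda>x. bracket G x E", OF G gc _ _ eig sub that])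
       (simp_all add: E bracket_closed bracket_add_left)
  show ?thesis
  proof (rule graded_lie_algebraI[OF G sub span indep])
    fix x y p q assume x: "x \<in> grade G p" and y: "y \<in> grade G q"
    then have xc: "x \<in> carrier G" and yc: "y \<in> carrier G" using gc by blast+
    define z where "z = bracket G x y"
    have zc: "z \<in> carrier G" by (simp add: z_def bracket_closed xc yc)
    have ex: "lbr (lemb G x) (lemb G E) = lscale (of_int p) (lemb G x)" "lbr (lemb G y) (lemb G E) = lscale (of_int q) (lemb G y)"
      using eig[OF x] eig[OF y] xc yc E by (metis lemb_bracket[OF G] lemb_smult[OF G])+
    have ez: "lbr (lemb G z) (lemb G E) = lscale (of_int (p + q)) (lemb G z)"
    proof -
      have "lbr (lbr (lemb G x) (lemb G y)) (lemb G E) =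
          lbr (lbr (lemb G x) (lemb G E)) (lemb G y) + lbr (lemb G x) (lbr (lemb G y) (lemb G E))"
        by (simp add: lbr_lbr)
      then show ?thesis
        unfolding z_def lemb_bracket[OF G xc yc] ex by (simp add: lbr_simps lie_product.scale_left_distrib)
    qed
    obtain A c where A: "finite A" and c: "\<And>p. c p \<in> grade G p" and s: "lemb G z = (\<Sum>p\<in>A. lemb G (c p))"
      using ex_sum_homogeneous[OF G sub span zc] by blast
    have cc: "c p \<in> carrier G" for p using c gc by blast
    \<comment> \<open>Applying \<open>[_, E] - (p + q)\<close> to the decomposition of z gives zero,
      as z is an eigenvector for \<open>p + q\<close>. Independence then kills every component with
      \<open>r \<noteq> p + q\<close>, the factor \<open>r - (p + q)\<close> being nonzero in the
      field.\<close>
    have "(\<Sum>r\<in>A. lemb G (of_int (r - (p + q)) \<odot>\<^bsub>G\<^esub> c r)) = lbr (lemb G z) (lemb G E) - lscale (of_int (p + q)) (lemb G z)"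
    proof -
      have "lbr (lemb G (c r)) (lemb G E) = lscale (of_int r) (lemb G (c r))" for r
        using eig[OF c] cc E by (metis lemb_bracket[OF G] lemb_smult[OF G])
      then show ?thesis
        unfolding s by (simp only: lbr_sum_left lie_product.scale_sum_right sum_subtractf[symmetric]
            lemb_smult[OF G cc] of_int_diff lie_product.scale_left_diff_distrib)
    qed
    then have "(\<Sum>r\<in>A. lemb G (of_int (r - (p + q)) \<odot>\<^bsub>G\<^esub> c r)) = 0" using ez by simp
    then have "finsum G (\<lambda>r. of_int (r - (p + q)) \<odot>\<^bsub>G\<^esub> c r) A = \<zero>\<^bsub>G\<^esub>"
      using finsum_eq_iff_lemb[OF G A, of "\<lambda>r. of_int (r - (p + q)) \<odot>\<^bsub>G\<^esub> c r" "\<zero>\<^bsub>G\<^esub>"] cc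
      by (auto simp: lemb_zero[OF G] lie_algebra_closed[OF G])
    from indep[OF A _ this] have "of_int (r - (p + q)) \<odot>\<^bsub>G\<^esub> c r = \<zero>\<^bsub>G\<^esub>" if "r \<in> A" for r
      using that c submodule_of_lie_smult[OF G sub] by blast
    then have "lscale (of_int (r - (p + q))) (lemb G (c r)) = 0" if "r \<in> A" for r
      using that cc by (simp flip: lemb_smult[OF G] lemb_zero[OF G])
    then have cz: "lemb G (c r) = 0" if "r \<in> A" "r \<noteq> p + q" for r
      using that by (metis eq_iff_diff_eq_0 lie_product.scale_eq_0_iff of_int_eq_0_iff)
    have "lemb G z = lemb G (if p + q \<in> A then c (p + q) else \<zero>\<^bsub>G\<^esub>)"
    proof -
      have "(\<Sum>r\<in>A. lemb G (c r)) = (\<Sum>r\<in>A. if r = p + q then lemb G (c (p + q)) else 0)"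
        by (rule sum.cong) (auto simp: cz)
      then show ?thesis using A unfolding s by (simp add: lemb_zero[OF G])
    qed
    then have "z = (if p + q \<in> A then c (p + q) else \<zero>\<^bsub>G\<^esub>)"
      by (cases "p + q \<in> A") (simp_all add: lemb_inject[OF G zc] cc)
    then show "bracket G x y \<in> grade G (p + q)"
      using c submodule_of_lie_zero[OF G sub] unfolding z_def by presburger
  qed
qed

text \<open>Independence is pulled back along f: a relation in G is carried to a relation in H,
  whose homogeneous summands vanish. In this way \<open>f(V)\<close> obtains its grading from
  F(V).\<close>

lemma graded_lie_algebra_embeddingI:
  fixes G :: "('k::field, 'g) graded_struct" and H :: "('k, 'h) graded_struct"
  assumes G: "lie_algebra G" and H: "graded_lie_algebra H" and f: "f \<in> graded_lie_hom G H" "inj_on f (carrier G)"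
    and sub: "\<And>p. Module.submodule (grade G p) (ring_of_type_algebra :: 'k ring) G"
    and span: "\<And>U. U \<subseteq> carrier G \<Longrightarrow> (\<And>p. grade G p \<subseteq> U) \<Longrightarrow>
      (\<And>x y. x \<in> U \<Longrightarrow> y \<in> U \<Longrightarrow> x \<oplus>\<^bsub>G\<^esub> y \<in> U) \<Longrightarrow> carrier G \<subseteq> U"
    and br: "\<And>x y p q. x \<in> grade G p \<Longrightarrow> y \<in> grade G q \<Longrightarrow> bracket G x y \<in> grade G (p + q)"
  shows "graded_lie_algebra G"
proof (rule graded_lie_algebraI[OF G sub span _ br])
  note H' = graded_lie_algebra_lie[OF H]
  fix A c assume A: "finite A" "\<And>p. p \<in> A \<Longrightarrow> c p \<in> grade G p" "finsum G c A = \<zero>\<^bsub>G\<^esub>"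
  have gc: "grade G p \<subseteq> carrier G" for p using submodule_of_lie_subset[OF G sub] .
  have cc: "c \<in> A \<rightarrow> carrier G" using A(2) gc by blast
  have "finsum H (\<lambda>p. f (c p)) A = \<zero>\<^bsub>H\<^esub>"
    using hom_finsum[OF f(1) G H' A(1) cc] A(3) hom_zero[OF f(1) G H'] by simp
  then have "f (c p) = f \<zero>\<^bsub>G\<^esub>" if "p \<in> A" for p
    using component_finsum_homogeneous[OF H A(1), of "\<lambda>p. f (c p)" p] hom_grade[OF f(1) A(2)] that
      component_zero[OF H, of p] hom_zero[OF f(1) G H'] by simp
  then show "\<forall>p\<in>A. c p = \<zero>\<^bsub>G\<^esub>"
    using inj_onD[OF f(2)] cc lie_algebra_closed(1)[OF G] by blast
qed

section \<open>The prolongation of the free Lie algebra is a graded Lie algebra\<close>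

context base_space
begin

abbreviation fl where "fl \<equiv> free_lie scale"
abbreviation F where "F \<equiv> full_prolongation scale"

lemma fl_carrierE:
  assumes "P \<in> carrier fl"
  obtains t where "P = lcls scale t"
  using assms by (auto simp: free_lie_ops)

lemma lcls_carrier: "lcls scale t \<in> carrier fl"
  by (simp add: free_lie_ops)

lemma lcls_eq_iff: "lcls scale s = lcls scale t \<longleftrightarrow> cl s = cl t"
  by (simp add: lie_eq_iff_lcls cl_eq_iff)

lemma fl_minus: "lcls scale s \<ominus>\<^bsub>fl\<^esub> lcls scale t = lcls scale (LAdd s (LSmult (- 1) t))"
  by (simp add: a_minus_def free_lie_ops flip: smult_neg_one[OF free_lie_lie_algebra lcls_carrier])

lemma F_carrier: "carrier F = carrier fl \<times> {\<xi>. multilinear \<xi>}"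
  by (simp add: full_prolongation_def list_fun_sum_multilinear_maps)

lemma F_carrierE:
  assumes "x \<in> carrier F"
  obtains t \<xi> where "x = (lcls scale t, \<xi>)" "multilinear \<xi>"
  using assms by (auto simp: F_carrier free_lie_ops)

lemma F_zero: "\<zero>\<^bsub>F\<^esub> = (lcls scale LZero, 0)"
  by (simp add: full_prolongation_def free_lie_ops zero_fun_def)

lemma F_add: "(lcls scale s, \<xi>) \<oplus>\<^bsub>F\<^esub> (lcls scale t, \<eta>) = (lcls scale (LAdd s t), \<xi> + \<eta>)"
  by (simp add: full_prolongation_def free_lie_ops plus_fun_def)

lemma F_smult: "a \<odot>\<^bsub>F\<^esub> (lcls scale s, \<xi>) = (lcls scale (LSmult a s), fscale a \<xi>)"
  by (simp add: full_prolongation_def free_lie_ops fscale_def)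

lemma act_lrep:
  assumes "multilinear \<xi>"
  shows "cl (nact (lrep (lcls scale t)) \<xi>) = cl (nact t \<xi>)" "pact (lrep (lcls scale t)) \<xi> = pact t \<xi>"
  using lie_eq_act[OF lie_eq_lrep, of t] assms by simp_all

text \<open>From here on brackets are computed with arbitrary representatives: by
  \<open>lie_eq_act\<close> the representative selected by \<open>lrep\<close> acts in the same
  way.\<close>

lemma F_bracket:
  assumes "multilinear \<xi>" "multilinear \<eta>"
  shows "bracket F (lcls scale s, \<xi>) (lcls scale t, \<eta>) =
    (lcls scale (LAdd (LAdd (LBr s t) (nact t \<xi>)) (LSmult (- 1) (nact s \<eta>))), nb \<xi> \<eta> + pact t \<xi> - pact s \<eta>)"
proof -
  have "lcls scale (fst (act scale (lrep (lcls scale t)) \<xi>)) = lcls scale (nact t \<xi>)"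
    "lcls scale (fst (act scale (lrep (lcls scale s)) \<eta>)) = lcls scale (nact s \<eta>)"
    using act_lrep(1) assms by (simp_all add: lcls_eq_iff nact_def)
  moreover have "snd (act scale (lrep (lcls scale t)) \<xi>) = pact t \<xi>"
    "snd (act scale (lrep (lcls scale s)) \<eta>) = pact s \<eta>"
    using act_lrep(2) assms by (simp_all add: pact_def)
  ultimately show ?thesis
    by (simp add: full_prolongation_def case_prod_unfold Let_def free_lie_ops fl_minus fun_eq_iff)
qed

lemma fscale_apply: "fscale a \<xi> vs = scale a (\<xi> vs)"
  and fscale_zero: "fscale a 0 = 0"
  by (simp_all add: fscale_def fun_eq_iff)

lemma fscale_add: "fscale a (\<xi> + \<eta>) = fscale a \<xi> + fscale a \<eta>"
  and fscale_diff: "fscale a (\<xi> - \<eta>) = fscale a \<xi> - fscale a \<eta>"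
  and fscale_add_left: "fscale (a + b) \<xi> = fscale a \<xi> + fscale b \<xi>"
  and fscale_mult: "fscale (a * b) \<xi> = fscale a (fscale b \<xi>)"
  and fscale_one: "fscale 1 \<xi> = \<xi>"
  by (simp_all add: fscale_def fun_eq_iff scale_right_distrib scale_right_diff_distrib scale_left_distrib)

text \<open>The Jacobi identity splits by the number of arguments in \<open>f(V)\<close>: three are
  covered by the free Lie algebra, two by the rule for \<open>LBr\<close>, one by
  \<open>act_bracket_raw\<close>, none by \<open>nb_jacobi\<close>.\<close>

lemma full_prolongation_lie_algebra: "lie_algebra F"
proof (rule lie_algebraI)
  have car: "(lcls scale s, \<xi>) \<in> carrier F \<longleftrightarrow> multilinear \<xi>" for s \<xi>
    by (simp add: F_carrier lcls_carrier)
  note ops = F_zero F_add F_smult F_bracket car multilinear_closed pact_multilinear prod.inject lcls_eq_iff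
    cl_simps nact_simps pact_simps cl_nact_linear pact_linear lbr_simps fscale_add fscale_diff
    fscale_add_left fscale_mult fscale_one fscale_neg_one
    lie_product.scale_right_distrib lie_product.scale_left_distrib lie_product.scale_right_diff_distrib
  show "\<zero>\<^bsub>F\<^esub> \<in> carrier F" by (simp add: ops)
  fix x assume "x \<in> carrier F"
  then obtain p \<xi> where x: "x = (lcls scale p, \<xi>)" and \<xi>: "multilinear \<xi>" by (rule F_carrierE)
  show "1 \<odot>\<^bsub>F\<^esub> x = x" "\<zero>\<^bsub>F\<^esub> \<oplus>\<^bsub>F\<^esub> x = x" "((- 1) \<odot>\<^bsub>F\<^esub> x) \<oplus>\<^bsub>F\<^esub> x = \<zero>\<^bsub>F\<^esub>"
    by (simp_all add: x \<xi> ops)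
  show "bracket F x x = \<zero>\<^bsub>F\<^esub>"
    by (simp add: x \<xi> ops nb_self)
  fix a b
  show "a \<odot>\<^bsub>F\<^esub> x \<in> carrier F" by (simp add: x \<xi> ops)
  show "(a + b) \<odot>\<^bsub>F\<^esub> x = (a \<odot>\<^bsub>F\<^esub> x) \<oplus>\<^bsub>F\<^esub> (b \<odot>\<^bsub>F\<^esub> x)" "(a * b) \<odot>\<^bsub>F\<^esub> x = a \<odot>\<^bsub>F\<^esub> (b \<odot>\<^bsub>F\<^esub> x)"
    by (simp_all add: x \<xi> ops)
  fix y assume "y \<in> carrier F"
  then obtain q \<eta> where y: "y = (lcls scale q, \<eta>)" and \<eta>: "multilinear \<eta>" by (rule F_carrierE)
  show "x \<oplus>\<^bsub>F\<^esub> y \<in> carrier F" "bracket F x y \<in> carrier F"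
    by (simp_all add: x \<xi> y \<eta> ops)
  show "x \<oplus>\<^bsub>F\<^esub> y = y \<oplus>\<^bsub>F\<^esub> x"
    by (simp add: x \<xi> y \<eta> ops add.commute)
  show "a \<odot>\<^bsub>F\<^esub> (x \<oplus>\<^bsub>F\<^esub> y) = (a \<odot>\<^bsub>F\<^esub> x) \<oplus>\<^bsub>F\<^esub> (a \<odot>\<^bsub>F\<^esub> y)"
    by (simp add: x \<xi> y \<eta> ops)
  show "bracket F (a \<odot>\<^bsub>F\<^esub> x) y = a \<odot>\<^bsub>F\<^esub> bracket F x y" "bracket F x (a \<odot>\<^bsub>F\<^esub> y) = a \<odot>\<^bsub>F\<^esub> bracket F x y"
    by (simp_all add: x \<xi> y \<eta> ops nb_scale_left nb_scale_right)
  fix z assume "z \<in> carrier F"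
  then obtain r \<zeta> where z: "z = (lcls scale r, \<zeta>)" and \<zeta>: "multilinear \<zeta>" by (rule F_carrierE)
  show "x \<oplus>\<^bsub>F\<^esub> y \<oplus>\<^bsub>F\<^esub> z = x \<oplus>\<^bsub>F\<^esub> (y \<oplus>\<^bsub>F\<^esub> z)"
    by (simp add: x \<xi> y \<eta> z \<zeta> ops add.assoc)
  show "bracket F (x \<oplus>\<^bsub>F\<^esub> y) z = bracket F x z \<oplus>\<^bsub>F\<^esub> bracket F y z"
    by (simp add: x \<xi> y \<eta> z \<zeta> ops nb_add_left algebra_simps)
  show "bracket F x (y \<oplus>\<^bsub>F\<^esub> z) = bracket F x y \<oplus>\<^bsub>F\<^esub> bracket F x z"
    by (simp add: x \<xi> y \<eta> z \<zeta> ops nb_add_right algebra_simps)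
  have n: "cl (nact r (nb \<xi> \<eta>)) = cl (nact (nact r \<eta>) \<xi>) - cl (nact (nact r \<xi>) \<eta>)"
    and p: "pact r (nb \<xi> \<eta>) = pact (nact r \<eta>) \<xi> + nb \<xi> (pact r \<eta>) - pact (nact r \<xi>) \<eta> - nb \<eta> (pact r \<xi>)"
    if "multilinear \<xi>" "multilinear \<eta>" for r \<xi> \<eta>
    using act_bracket_raw[of r] that by blast+
  have anti: "lbr (cl p) (cl (nact q \<xi>)) = - lbr (cl (nact q \<xi>)) (cl p)" for p q \<xi> by (rule lbr_antisym)
  \<comment> \<open>Both cyclic identities are solved for one of their terms, so that substitution
    makes the cyclic sums disappear.\<close>
  have J: "lbr (cl r) (lbr (cl p) (cl q)) = - lbr (cl p) (lbr (cl q) (cl r)) - lbr (cl q) (lbr (cl r) (cl p))"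
    using lbr_jacobi[of "cl p" "cl q" "cl r"] by (simp add: algebra_simps eq_neg_iff_add_eq_0)
  have NJ: "nb \<zeta> (nb \<xi> \<eta>) = - nb \<xi> (nb \<eta> \<zeta>) - nb \<eta> (nb \<zeta> \<xi>)"
    using nb_jacobi[OF \<xi> \<eta> \<zeta>] by (simp add: algebra_simps eq_neg_iff_add_eq_0)
  show "bracket F x (bracket F y z) \<oplus>\<^bsub>F\<^esub> bracket F y (bracket F z x) \<oplus>\<^bsub>F\<^esub> bracket F z (bracket F x y) = \<zero>\<^bsub>F\<^esub>"
    by (simp add: x \<xi> y \<eta> z \<zeta> ops n p anti J NJ nb_add_right nb_diff_right)
qed

section \<open>Homogeneous terms and the span of the homogeneous parts\<close>

lemma lhomogeneous_nonneg: "lhomogeneous p t \<Longrightarrow> 0 \<le> p \<Longrightarrow> cl t = 0"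
proof (induction rule: lhomogeneous.induct)
  case (5 p s q t)
  then have "0 \<le> p \<or> 0 \<le> q" by linarith
  then show ?case using 5 by (auto simp: cl_simps)
qed (simp_all add: cl_simps)

lemma fl_grade_submodule: "Module.submodule (grade fl p) (ring_of_type_algebra :: 'k ring) fl"
proof (rule submodule_of_lieI[OF free_lie_lie_algebra])
  show "grade fl p \<subseteq> carrier fl" by (auto simp: free_lie_ops)
  show "\<zero>\<^bsub>fl\<^esub> \<in> grade fl p" by (auto simp: free_lie_ops intro: lhomogeneous.intros)
  show "x \<oplus>\<^bsub>fl\<^esub> y \<in> grade fl p" if "x \<in> grade fl p" "y \<in> grade fl p" for x y
    using that by (auto simp: free_lie_ops intro!: imageI lhomogeneous.intros)
  show "a \<odot>\<^bsub>fl\<^esub> x \<in> grade fl p" if "x \<in> grade fl p" for a x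
    using that by (auto simp: free_lie_ops intro!: imageI lhomogeneous.intros)
qed

lemma fl_bracket_grade: "x \<in> grade fl p \<Longrightarrow> y \<in> grade fl q \<Longrightarrow> bracket fl x y \<in> grade fl (p + q)"
  by (auto simp: free_lie_ops intro!: imageI lhomogeneous.intros)

text \<open>Terms in which different degrees are added only at the outermost level. Distributing
  scalars and brackets over sums brings every term into this form without a change of its class;
  this is the spanning property of the grading.\<close>

inductive homogeneous_sum :: "('k, 'v) lterm \<Rightarrow> bool" where
  "lhomogeneous p t \<Longrightarrow> homogeneous_sum t"
| "homogeneous_sum s \<Longrightarrow> homogeneous_sum t \<Longrightarrow> homogeneous_sum (LAdd s t)"

lemma homogeneous_sum_smult: "homogeneous_sum t \<Longrightarrow> \<exists>s. homogeneous_sum s \<and> cl s = cl (LSmult a t)"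
proof (induction rule: homogeneous_sum.induct)
  case (1 p t)
  show ?case
    by (rule exI[of _ "LSmult a t"]) (simp add: homogeneous_sum.intros(1)[OF lhomogeneous.intros(4)[OF 1]])
next
  case (2 s t)
  then obtain s' t' where "homogeneous_sum s'" "cl s' = cl (LSmult a s)" "homogeneous_sum t'" "cl t' = cl (LSmult a t)"
    by blast
  then show ?case
    by (intro exI[of _ "LAdd s' t'"]) (simp add: homogeneous_sum.intros cl_simps lie_product.scale_right_distrib)
qed

lemma homogeneous_sum_bracket_homogeneous:
  "homogeneous_sum t \<Longrightarrow> lhomogeneous p s \<Longrightarrow> \<exists>u. homogeneous_sum u \<and> cl u = cl (LBr s t)"
proof (induction rule: homogeneous_sum.induct)
  case (1 q t)
  show ?case
    by (rule exI[of _ "LBr s t"]) (simp add: homogeneous_sum.intros(1)[OF lhomogeneous.intros(5)[OF 1(2,1)]])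
next
  case (2 t t')
  then obtain u u' where "homogeneous_sum u" "cl u = cl (LBr s t)" "homogeneous_sum u'" "cl u' = cl (LBr s t')"
    by blast
  then show ?case
    by (intro exI[of _ "LAdd u u'"]) (simp add: homogeneous_sum.intros cl_simps lbr_simps)
qed

lemma homogeneous_sum_bracket:
  "homogeneous_sum s \<Longrightarrow> homogeneous_sum t \<Longrightarrow> \<exists>u. homogeneous_sum u \<and> cl u = cl (LBr s t)"
proof (induction rule: homogeneous_sum.induct)
  case (1 p s)
  then show ?case using homogeneous_sum_bracket_homogeneous by blast
next
  case (2 s s')
  then obtain u u' where "homogeneous_sum u" "cl u = cl (LBr s t)" "homogeneous_sum u'" "cl u' = cl (LBr s' t)"
    by blast
  then show ?case
    by (intro exI[of _ "LAdd u u'"]) (simp add: homogeneous_sum.intros cl_simps lbr_simps)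
qed

lemma ex_homogeneous_sum: "\<exists>s. homogeneous_sum s \<and> cl s = cl t"
proof (induction t)
  case (LGen v)
  show ?case
    by (rule exI[of _ "LGen v"]) (simp add: homogeneous_sum.intros(1)[OF lhomogeneous.intros(1)])
next
  case LZero
  show ?case
    by (rule exI[of _ LZero]) (simp add: homogeneous_sum.intros(1)[OF lhomogeneous.intros(2)])
next
  case (LAdd t1 t2)
  then obtain s1 s2 where "homogeneous_sum s1" "cl s1 = cl t1" "homogeneous_sum s2" "cl s2 = cl t2" by blast
  then show ?case by (intro exI[of _ "LAdd s1 s2"]) (simp add: homogeneous_sum.intros cl_simps)
next
  case (LSmult a t)
  then obtain s where "homogeneous_sum s" "cl s = cl t" by blast
  then show ?case using homogeneous_sum_smult[of s a] by (simp add: cl_simps)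
next
  case (LBr t1 t2)
  then obtain s1 s2 where "homogeneous_sum s1" "cl s1 = cl t1" "homogeneous_sum s2" "cl s2 = cl t2" by blast
  then show ?case using homogeneous_sum_bracket[of s1 s2] by (simp add: cl_simps)
qed

lemma fl_span:
  assumes "\<And>p. grade fl p \<subseteq> U" "\<And>x y. x \<in> U \<Longrightarrow> y \<in> U \<Longrightarrow> x \<oplus>\<^bsub>fl\<^esub> y \<in> U"
  shows "carrier fl \<subseteq> U"
proof
  fix x assume "x \<in> carrier fl"
  then obtain t where t: "x = lcls scale t" by (rule fl_carrierE)
  obtain s where s: "homogeneous_sum s" "cl s = cl t" using ex_homogeneous_sum by blast
  have "lcls scale s \<in> U" using s(1)
  proof (induction rule: homogeneous_sum.induct)
    case (1 p t)
    then show ?case using assms(1)[of p] by (auto simp: free_lie_ops)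
  next
    case (2 s t)
    then show ?case using assms(2) by (simp flip: free_lie_ops(3))
  qed
  then show "x \<in> U" using s(2) t lcls_eq_iff by metis
qed

lemma multilinear_maps_iff:
  "\<xi> \<in> multilinear_maps scale n \<longleftrightarrow> multilinear \<xi> \<and> (\<forall>vs. length vs \<noteq> n + 1 \<longrightarrow> \<xi> vs = 0)"
proof
  assume \<xi>: "\<xi> \<in> multilinear_maps scale n"
  then have z: "\<xi> vs = 0" if "length vs \<noteq> n + 1" for vs using that by (simp add: multilinear_maps_def)
  have lin: "Vector_Spaces.linear scale scale (\<lambda>v. \<xi> (us @ v # ws))" for us ws
  proof (cases "length us + length ws = n")
    case True
    then show ?thesis using \<xi> by (simp add: multilinear_maps_def)
  next
    case False
    then have "\<xi> (us @ v # ws) = 0" for v using z by simp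
    then show ?thesis by (simp add: linear_self_iff)
  qed
  then have "\<xi> (us @ (v + w) # ws) = \<xi> (us @ v # ws) + \<xi> (us @ w # ws)"
    "\<xi> (us @ scale a v # ws) = scale a (\<xi> (us @ v # ws))" for us v w a ws
    unfolding linear_self_iff by blast+
  then have "multilinear \<xi>"
    unfolding multilinear_def by (intro conjI exI[of _ "n + 1"]) (simp_all add: z)
  then show "multilinear \<xi> \<and> (\<forall>vs. length vs \<noteq> n + 1 \<longrightarrow> \<xi> vs = 0)"
    using z by simp
next
  assume "multilinear \<xi> \<and> (\<forall>vs. length vs \<noteq> n + 1 \<longrightarrow> \<xi> vs = 0)"
  then show "\<xi> \<in> multilinear_maps scale n"
    unfolding multilinear_maps_def linear_self_iff by (auto simp: multilinearD)
qed

lemma F_grade: "grade F p = (if p < 0 then grade fl p \<times> {0} else {lcls scale LZero} \<times> multilinear_maps scale (nat p))"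
  by (simp add: full_prolongation_def free_lie_ops zero_fun_def)

lemma F_grade_submodule: "Module.submodule (grade F p) (ring_of_type_algebra :: 'k ring) F"
proof (rule submodule_of_lieI[OF full_prolongation_lie_algebra])
  have g: "(lcls scale s, \<xi>) \<in> grade F p \<longleftrightarrow> (if p < 0 then lcls scale s \<in> grade fl p \<and> \<xi> = 0
      else cl s = 0 \<and> multilinear \<xi> \<and> (\<forall>vs. length vs \<noteq> nat p + 1 \<longrightarrow> \<xi> vs = 0))" for s \<xi>
    by (auto simp: F_grade multilinear_maps_iff lcls_eq_iff cl_simps)
  show sub: "grade F p \<subseteq> carrier F"
    by (auto simp: F_grade F_carrier multilinear_maps_iff free_lie_ops multilinear_zero)
  show "\<zero>\<^bsub>F\<^esub> \<in> grade F p"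
    using submodule_of_lie_zero[OF free_lie_lie_algebra fl_grade_submodule]
    by (simp add: F_zero g cl_simps multilinear_zero free_lie_ops(2))
  show "x \<oplus>\<^bsub>F\<^esub> y \<in> grade F p" if xy: "x \<in> grade F p" "y \<in> grade F p" for x y
  proof -
    obtain s \<xi> where x: "x = (lcls scale s, \<xi>)"
      by (rule F_carrierE[OF subsetD[OF sub xy(1)]])
    obtain t \<eta> where y: "y = (lcls scale t, \<eta>)"
      by (rule F_carrierE[OF subsetD[OF sub xy(2)]])
    show ?thesis
      using xy submodule_of_lie_add[OF free_lie_lie_algebra fl_grade_submodule, of "lcls scale s" p "lcls scale t"]
      unfolding x y F_add g by (auto simp: free_lie_ops(3) cl_simps multilinear_add split: if_splits)
  qed
  show "a \<odot>\<^bsub>F\<^esub> x \<in> grade F p" if xp: "x \<in> grade F p" for a x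
  proof -
    obtain s \<xi> where x: "x = (lcls scale s, \<xi>)"
      by (rule F_carrierE[OF subsetD[OF sub xp]])
    show ?thesis
      using xp submodule_of_lie_smult[OF free_lie_lie_algebra fl_grade_submodule, of "lcls scale s" p a]
      unfolding x F_smult g by (auto simp: free_lie_ops(4) cl_simps multilinear_fscale fscale_apply fscale_zero split: if_splits)
  qed
qed

lemma F_split: "multilinear \<xi> \<Longrightarrow> (lcls scale t, \<xi>) = (lcls scale t, 0) \<oplus>\<^bsub>F\<^esub> (lcls scale LZero, \<xi>)"
  by (simp add: F_add lcls_eq_iff cl_simps)

end

context base_space_type
begin

text \<open>Induction on a bound of the arity. The part of arity \<open>n + 1\<close> has degree n
  and is split off; it is again of type L, since for prefixes of length n its endomorphisms are
  those of \<xi>, and for other prefixes they are 0, a member of L.\<close>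

lemma nonneg_span:
  assumes \<xi>: "multilinear_of_type L \<xi>"
    and gr: "\<And>n \<eta>. multilinear_of_type L \<eta> \<Longrightarrow> (lcls scale LZero, \<eta>) \<in> grade F (int n) \<Longrightarrow> (lcls scale LZero, \<eta>) \<in> U"
    and add: "\<And>x y. x \<in> U \<Longrightarrow> y \<in> U \<Longrightarrow> x \<oplus>\<^bsub>F\<^esub> y \<in> U"
  shows "(lcls scale LZero, \<xi>) \<in> U"
proof -
  have z: "(lcls scale LZero, 0) \<in> U"
    using gr[of 0 0] by (simp add: F_grade multilinear_maps_iff multilinear_zero multilinear_of_type_zero)
  have "(lcls scale LZero, \<xi>) \<in> U" if "multilinear_of_type L \<xi>" "\<forall>vs. length vs > n \<longrightarrow> \<xi> vs = 0" for n \<xi>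
    using that
  proof (induction n arbitrary: \<xi>)
    case 0
    have "\<xi> = 0"
    proof
      show "\<xi> vs = 0 vs" for vs
        using 0 multilinear_of_typeD(1)[OF 0(1)] by (cases vs) (auto simp: multilinear_def)
    qed
    then show ?case using z by (simp only:)
  next
    case (Suc n)
    note m = multilinear_of_typeD[OF Suc.prems(1)]
    define \<eta> where "\<eta> vs = (if length vs = Suc n then \<xi> vs else 0)" for vs
    have "multilinear \<eta>"
      unfolding multilinear_def
      by (intro conjI exI[of _ "Suc n"]) (auto simp: \<eta>_def multilinearD[OF m(1)])
    moreover have "(\<lambda>v. \<eta> (vs @ [v])) = (if length vs = n then (\<lambda>v. \<xi> (vs @ [v])) else (\<lambda>_. 0))" for vs
      by (simp add: \<eta>_def)
    ultimately have \<eta>: "multilinear_of_type L \<eta>"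
      using m(2) L_zero by (simp add: multilinear_of_type_def)
    then have "(lcls scale LZero, \<eta>) \<in> grade F (int n)"
      using multilinear_of_typeD(1)[OF \<eta>] by (simp add: F_grade multilinear_maps_iff \<eta>_def)
    then have "(lcls scale LZero, \<eta>) \<in> U" using gr \<eta> by blast
    moreover have "(lcls scale LZero, \<xi> - \<eta>) \<in> U"
      using Suc.prems \<eta> by (intro Suc.IH multilinear_of_type_diff) (auto simp: \<eta>_def)
    ultimately have "(lcls scale LZero, \<xi> - \<eta>) \<oplus>\<^bsub>F\<^esub> (lcls scale LZero, \<eta>) \<in> U" by (intro add)
    moreover have "lcls scale (LAdd LZero LZero) = lcls scale LZero" by (simp add: lcls_eq_iff cl_simps)
    ultimately show ?case by (simp add: F_add)
  qed
  then show ?thesis using \<xi> multilinearD(4)[OF multilinear_of_typeD(1)[OF \<xi>]] by blast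
qed

end

context base_space
begin

lemma grade_fl_nonneg:
  assumes "0 \<le> p"
  shows "grade fl p = {\<zero>\<^bsub>fl\<^esub>}"
proof -
  have "lcls scale t = lcls scale LZero" if "lhomogeneous p t" for t
    using lhomogeneous_nonneg[OF that assms] by (simp add: lcls_eq_iff cl_simps)
  then have "grade fl p \<subseteq> {\<zero>\<^bsub>fl\<^esub>}" by (auto simp only: free_lie_ops(2,6))
  then show ?thesis
    using submodule_of_lie_zero[OF free_lie_lie_algebra fl_grade_submodule, of p] by blast
qed

lemma incl_lcls: "incl (lcls scale t) = (lcls scale t, 0)"
  by (simp add: incl_def zero_fun_def)

lemma incl_grade: "P \<in> grade fl p \<Longrightarrow> incl P \<in> grade F p"
proof (cases "p < 0")
  case False
  assume "P \<in> grade fl p"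
  then have "P = lcls scale LZero" using False grade_fl_nonneg[of p] by (simp add: free_lie_ops(2))
  then show ?thesis using False by (simp add: incl_lcls F_grade multilinear_maps_iff multilinear_zero)
qed (simp add: F_grade incl_def zero_fun_def)

lemma F_span:
  assumes gr: "\<And>p. grade F p \<subseteq> U" and add: "\<And>x y. x \<in> U \<Longrightarrow> y \<in> U \<Longrightarrow> x \<oplus>\<^bsub>F\<^esub> y \<in> U"
  shows "carrier F \<subseteq> U"
proof
  interpret base_space_type scale all_linear by (rule base_space_type_linear)
  fix x assume "x \<in> carrier F"
  then obtain t \<xi> where x: "x = (lcls scale t, \<xi>)" and \<xi>: "multilinear \<xi>" by (rule F_carrierE)
  have "carrier fl \<subseteq> {P \<in> carrier fl. incl P \<in> U}"
  proof (rule fl_span)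
    show "grade fl p \<subseteq> {P \<in> carrier fl. incl P \<in> U}" for p
      using gr incl_grade submodule_of_lie_subset[OF free_lie_lie_algebra fl_grade_submodule] by blast
    fix P Q assume "P \<in> {P \<in> carrier fl. incl P \<in> U}" "Q \<in> {P \<in> carrier fl. incl P \<in> U}"
    moreover from this obtain s t where "P = lcls scale s" "Q = lcls scale t" by (auto simp: free_lie_ops)
    ultimately show "P \<oplus>\<^bsub>fl\<^esub> Q \<in> {P \<in> carrier fl. incl P \<in> U}"
      using add[of "incl P" "incl Q"] by (simp add: F_add free_lie_ops incl_lcls)
  qed
  then have "(lcls scale t, 0) \<in> U"
    unfolding incl_lcls[symmetric] using lcls_carrier[of t] by blast
  moreover have "(lcls scale LZero, \<xi>) \<in> U"
    by (rule nonneg_span) (use \<xi> multilinear_of_type_linear subsetD[OF gr] add in blast)+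
  ultimately have "(lcls scale t, 0) \<oplus>\<^bsub>F\<^esub> (lcls scale LZero, \<xi>) \<in> U" by (rule add)
  then show "x \<in> U" by (simp only: x F_split[OF \<xi>, symmetric])
qed

section \<open>The identity of \<open>V\<close> as grading element\<close>

lemma pact_euler: "pact t euler = 0"
  by (induction t) (simp_all only: pact_simps contract_euler pact_zero fscale_zero add_0 diff_self)

text \<open>The \<open>pact\<close> terms vanish because \<open>contract euler v = 0\<close>, so
  \<open>euler\<close> acts as a derivation; on generators, where \<open>p = -1\<close>, it acts as
  the identity.\<close>

lemma cl_nact_euler: "lhomogeneous p t \<Longrightarrow> cl (nact t euler) = lscale (- of_int p) (cl t)"
proof (induction rule: lhomogeneous.induct)
  case (1 v)
  show ?case by (simp add: nact_simps euler_def)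
next
  case (5 p s q t)
  then show ?case
    by (simp add: nact_simps cl_simps pact_euler cl_nact_zero lbr_scale_left lbr_minus_left lbr_antisym[of "cl t" "cl s"]
        lie_product.scale_left_diff_distrib lie_product.scale_left_distrib)
qed (simp_all add: nact_simps cl_simps lie_product.scale_right_distrib lie_product.scale_left_commute)

lemma F_euler_eigen:
  assumes "x \<in> grade F p"
  shows "bracket F x (lcls scale LZero, euler) = of_int p \<odot>\<^bsub>F\<^esub> x"
proof (cases "p < 0")
  case True
  then obtain t where "x = (lcls scale t, 0)" "lhomogeneous p t" using assms by (auto simp: F_grade free_lie_ops(6))
  then show ?thesis
    by (simp add: F_bracket multilinear_zero multilinear_euler F_smult lcls_eq_iff cl_simps nact_simps pact_simps
        cl_nact_euler pact_euler nb_zero_left) (simp add: fscale_def fun_eq_iff)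
next
  case False
  then obtain \<xi> where x: "x = (lcls scale LZero, \<xi>)" and \<xi>: "multilinear \<xi>" "\<And>vs. length vs \<noteq> nat p + 1 \<Longrightarrow> \<xi> vs = 0"
    using assms by (auto simp: F_grade multilinear_maps_iff)
  have "nb \<xi> euler vs = scale (of_int p) (\<xi> vs)" for vs
    using nb_antisym_at[of vs \<xi> euler] nb_euler_at[OF \<xi>(1), of vs] \<xi>(2)[of vs] False
    by (cases "length vs = nat p + 1") auto
  then have "nb \<xi> euler = fscale (of_int p) \<xi>" by (simp add: fscale_def fun_eq_iff)
  then show ?thesis
    unfolding x by (simp add: F_bracket \<xi> multilinear_euler F_smult lcls_eq_iff cl_simps nact_simps pact_simps)
qed

lemma incl_hom: "incl \<in> graded_lie_hom fl F"
proof -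
  show ?thesis
    unfolding graded_lie_hom_def using incl_grade
    by (auto simp: free_lie_ops(1-5) incl_lcls F_carrier F_add F_smult F_bracket multilinear_zero lcls_eq_iff
        cl_simps cl_nact_zero pact_zero nb_zero_left)
       (simp add: fscale_def fun_eq_iff)
qed

end

locale base_space_char_0 = base_space scale
  for scale :: "'k::field_char_0 \<Rightarrow> 'v::ab_group_add \<Rightarrow> 'v"
begin

lemma full_prolongation_graded: "graded_lie_algebra F"
  by (rule graded_lie_algebra_eigenI[OF full_prolongation_lie_algebra F_grade_submodule F_span _ F_euler_eigen])
     (simp_all add: F_carrier lcls_carrier multilinear_euler)

lemma free_lie_graded: "graded_lie_algebra fl"
  by (rule graded_lie_algebra_embeddingI[OF free_lie_lie_algebra full_prolongation_graded incl_hom _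
        fl_grade_submodule fl_span fl_bracket_grade])
     (auto simp: inj_on_def incl_def)

end


section \<open>Normalizers\<close>

lemma lie_algebra_add_zero:
  fixes G :: "('k::field, 'g) graded_struct"
  assumes "lie_algebra G" "x \<in> carrier G"
  shows "x \<oplus>\<^bsub>G\<^esub> \<zero>\<^bsub>G\<^esub> = x" "\<zero>\<^bsub>G\<^esub> \<oplus>\<^bsub>G\<^esub> x = x"
proof -
  interpret lie_algebra G by (rule assms)
  show "x \<oplus>\<^bsub>G\<^esub> \<zero>\<^bsub>G\<^esub> = x" "\<zero>\<^bsub>G\<^esub> \<oplus>\<^bsub>G\<^esub> x = x" using assms(2) by simp_all
qed

definition bracket_normalizer :: "('k, 'g, 'm) lie_struct_scheme \<Rightarrow> 'g set \<Rightarrow> 'g set \<Rightarrow> 'g set" where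
  "bracket_normalizer G P I = {x \<in> P. \<forall>k\<in>I. bracket G x k \<in> I}"

lemma bracket_normalizer_lie_subalgebra:
  fixes G :: "('k::field, 'g) graded_struct"
  assumes G: "lie_algebra G" and P: "lie_subalgebra P G"
    and I: "Module.submodule I (ring_of_type_algebra :: 'k ring) G"
  shows "lie_subalgebra (bracket_normalizer G P I) G"
proof -
  note Pc = sub_closed[OF G P] and Psub = submodule_of_lie_subset[OF G lie_subalgebra_submodule[OF G P]]
  note Isub = submodule_of_lie_subset[OF G I]
  have "Module.submodule (bracket_normalizer G P I) (ring_of_type_algebra :: 'k ring) G"
  proof (rule submodule_of_lieI[OF G])
    show "bracket_normalizer G P I \<subseteq> carrier G" using Psub by (auto simp: bracket_normalizer_def)
    have "bracket G \<zero>\<^bsub>G\<^esub> k = \<zero>\<^bsub>G\<^esub>" if "k \<in> I" for k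
      using that Isub by (subst lemb_inject[OF G, symmetric]) (auto simp: lemb_simps[OF G])
    then show "\<zero>\<^bsub>G\<^esub> \<in> bracket_normalizer G P I"
      using Pc(1) submodule_of_lie_zero[OF G I] by (auto simp: bracket_normalizer_def)
    show "x \<oplus>\<^bsub>G\<^esub> y \<in> bracket_normalizer G P I" if "x \<in> bracket_normalizer G P I" "y \<in> bracket_normalizer G P I" for x y
    proof -
      have "bracket G (x \<oplus>\<^bsub>G\<^esub> y) k = bracket G x k \<oplus>\<^bsub>G\<^esub> bracket G y k" if "k \<in> I" for k
        using that \<open>x \<in> _\<close> \<open>y \<in> _\<close> Isub Psub
        by (subst lemb_inject[OF G, symmetric]) (auto simp: bracket_normalizer_def lemb_simps[OF G] lbr_simps subset_iff)
      then show ?thesis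
        using that Pc(2) submodule_of_lie_add[OF G I] by (auto simp: bracket_normalizer_def)
    qed
    show "a \<odot>\<^bsub>G\<^esub> x \<in> bracket_normalizer G P I" if "x \<in> bracket_normalizer G P I" for a x
    proof -
      have "bracket G (a \<odot>\<^bsub>G\<^esub> x) k = a \<odot>\<^bsub>G\<^esub> bracket G x k" if "k \<in> I" for k
        using that \<open>x \<in> _\<close> Isub Psub
        by (subst lemb_inject[OF G, symmetric]) (auto simp: bracket_normalizer_def lemb_simps[OF G] lbr_simps subset_iff)
      then show ?thesis
        using that Pc(3) submodule_of_lie_smult[OF G I] by (auto simp: bracket_normalizer_def)
    qed
  qed
  moreover have "bracket G x y \<in> bracket_normalizer G P I"
    if "x \<in> bracket_normalizer G P I" "y \<in> bracket_normalizer G P I" for x y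
  proof -
    have "bracket G (bracket G x y) k = bracket G x (bracket G y k) \<ominus>\<^bsub>G\<^esub> bracket G y (bracket G x k)" if "k \<in> I" for k
    proof -
      have *: "x \<in> carrier G" "y \<in> carrier G" "k \<in> carrier G"
        using that \<open>x \<in> _\<close> \<open>y \<in> _\<close> Isub Psub by (auto simp: bracket_normalizer_def)
      have "lbr (lemb G y) (lbr (lemb G x) (lemb G k)) = - lbr (lbr (lemb G x) (lemb G k)) (lemb G y)"
        by (rule lbr_antisym)
      then show ?thesis
        using * by (subst lemb_inject[OF G, symmetric]) (simp_all add: lemb_simps[OF G] lbr_lbr[of "lemb G x"])
    qed
    then show ?thesis
      using that Pc(4) submodule_of_lie_minus[OF G I] by (auto simp: bracket_normalizer_def)
  qed
  ultimately show ?thesis by (simp add: lie_subalgebra_def)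
qed

text \<open>For k in I of degree q, the bracket of the component of degree p of x with k is the
  component of degree \<open>p + q\<close> of \<open>[x, k]\<close>, and this lies in I, which is
  closed under components. An arbitrary k is the sum of its components, which again lie in
  I.\<close>

lemma bracket_normalizer_component:
  fixes G :: "('k::field, 'g) graded_struct"
  assumes graded: "graded_lie_algebra G" and P: "lie_subalgebra P G"
    and Pcomp: "\<And>x p. x \<in> P \<Longrightarrow> component G x p \<in> P"
    and I: "Module.submodule I (ring_of_type_algebra :: 'k ring) G"
    and Icomp: "\<And>x p. x \<in> I \<Longrightarrow> component G x p \<in> I"
    and x: "x \<in> bracket_normalizer G P I"
  shows "component G x p \<in> bracket_normalizer G P I"
proof -
  note G = graded_lie_algebra_lie[OF graded]
  note Psub = submodule_of_lie_subset[OF G lie_subalgebra_submodule[OF G P]]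
  note Isub = submodule_of_lie_subset[OF G I]
  have xP: "x \<in> P" "x \<in> carrier G" using x Psub by (auto simp: bracket_normalizer_def)
  note cx = component_carrier[OF graded xP(2), of p]
  let ?U = "{k \<in> carrier G. bracket G (component G x p) k \<in> I}"
  have U: "Module.submodule ?U (ring_of_type_algebra :: 'k ring) G"
  proof (rule submodule_of_lieI[OF G])
    have "bracket G (component G x p) \<zero>\<^bsub>G\<^esub> = \<zero>\<^bsub>G\<^esub>"
      using cx by (subst lemb_inject[OF G, symmetric]) (auto simp: lemb_simps[OF G])
    then show "\<zero>\<^bsub>G\<^esub> \<in> ?U" using submodule_of_lie_zero[OF G I] by (simp add: lie_algebra_closed[OF G])
    show "k \<oplus>\<^bsub>G\<^esub> l \<in> ?U" if "k \<in> ?U" "l \<in> ?U" for k l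
      using that submodule_of_lie_add[OF G I] lie_algebra.bracket_add_right[OF G cx]
      by (simp add: lie_algebra_closed[OF G])
    show "a \<odot>\<^bsub>G\<^esub> k \<in> ?U" if "k \<in> ?U" for a k
      using that submodule_of_lie_smult[OF G I] lie_algebra.bracket_smult_right[OF G cx]
      by (simp add: lie_algebra_closed[OF G])
  qed auto
  have "bracket G (component G x p) k \<in> I" if k: "k \<in> I" for k
  proof -
    have kc: "k \<in> carrier G" using k Isub by blast
    have "component G k q \<in> ?U" for q
    proof -
      have "bracket G x (component G k q) \<in> I" using x Icomp[OF k] by (simp add: bracket_normalizer_def)
      from Icomp[OF this, of "p + q"] show ?thesis
        using component_bracket[OF graded xP(2) component_grade[OF graded kc, of q], of "p + q"]
          component_carrier[OF graded kc, of q] by simp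
    qed
    then have "finsum G (component G k) {q. component G k q \<noteq> \<zero>\<^bsub>G\<^esub>} \<in> ?U"
      by (intro submodule_of_lie_finsum[OF G U] component_finite[OF graded kc])
    then have "k \<in> ?U" by (simp only: component_finsum[OF graded kc, symmetric])
    then show ?thesis by simp
  qed
  then show ?thesis using Pcomp[OF xP(1)] by (simp add: bracket_normalizer_def)
qed

lemma mem_submodule_of_components:
  fixes G :: "('k::field, 'g) graded_struct"
  assumes graded: "graded_lie_algebra G" and I: "Module.submodule I (ring_of_type_algebra :: 'k ring) G"
    and x: "x \<in> carrier G" and comp: "\<And>p. component G x p \<in> I"
  shows "x \<in> I"
proof -
  have "finsum G (component G x) {q. component G x q \<noteq> \<zero>\<^bsub>G\<^esub>} \<in> I"
    by (intro submodule_of_lie_finsum[OF graded_lie_algebra_lie[OF graded] I] component_finite[OF graded x] comp)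
  then show ?thesis by (simp only: component_finsum[OF graded x, symmetric])
qed

section \<open>The prolongation of type \<open>L\<close>\<close>

context base_space
begin

text \<open>
  The homomorphism from terms to the abelian Lie algebra \<open>V\<close>, which shows that \<open>V\<close> embeds
  into the free Lie algebra.
\<close>

primrec abelian_value :: "('k, 'v) lterm \<Rightarrow> 'v" where
  "abelian_value (LGen v) = v"
| "abelian_value LZero = 0"
| "abelian_value (LAdd s t) = abelian_value s + abelian_value t"
| "abelian_value (LSmult a s) = scale a (abelian_value s)"
| "abelian_value (LBr s t) = 0"

lemma abelian_value_cong: "lie_eq scale s t \<Longrightarrow> abelian_value s = abelian_value t"
  by (induction rule: lie_eq.induct) (simp_all add: scale_right_distrib scale_left_distrib)

lemma cl_LGen_eq_0_iff: "cl (LGen v) = 0 \<longleftrightarrow> v = 0"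
proof
  assume "cl (LGen v) = 0"
  then have "lie_eq scale (LGen v) LZero" using cl_eq_iff[of "LGen v" LZero] by (simp add: cl_simps)
  from abelian_value_cong[OF this] show "v = 0" by simp
qed (simp add: cl_LGen)

text \<open>A bracket of degree \<open>-1\<close> has a factor of nonnegative degree, which is zero;
  what remains are linear combinations of generators, and the relations on \<open>LGen\<close>
  collapse each of them to a single generator.\<close>

lemma grade_fl_minus_one: "grade fl (- 1) = range (\<lambda>v. lcls scale (LGen v))"
proof -
  have ex: "\<exists>v. cl t = cl (LGen v)" if "lhomogeneous p t" "p = - 1" for p t
    using that
  proof (induction rule: lhomogeneous.induct)
    case (2 p)
    show ?case by (rule exI[of _ 0]) (simp add: cl_simps cl_LGen)
  next
    case (3 p s t)
    then obtain v w where "cl s = cl (LGen v)" "cl t = cl (LGen w)" by blast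
    then show ?case by (intro exI[of _ "v + w"]) (simp add: cl_simps cl_LGen)
  next
    case (4 p s a)
    then obtain v where "cl s = cl (LGen v)" by blast
    then show ?case by (intro exI[of _ "scale a v"]) (simp add: cl_simps cl_LGen)
  next
    case (5 p s q t)
    then have "0 \<le> p \<or> 0 \<le> q" by linarith
    then have "cl (LBr s t) = 0" using 5 lhomogeneous_nonneg by (auto simp: cl_simps)
    then show ?case by (intro exI[of _ 0]) (simp add: cl_LGen)
  qed blast
  have r: "lcls scale t \<in> range (\<lambda>v. lcls scale (LGen v))" if t: "lhomogeneous (- 1) t" for t
  proof -
    obtain v where "cl t = cl (LGen v)" using ex[OF t HOL.refl] by blast
    then have "lcls scale t = lcls scale (LGen v)" by (simp only: lcls_eq_iff)
    then show ?thesis by (rule range_eqI)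
  qed
  have "grade fl (- 1) \<subseteq> range (\<lambda>v. lcls scale (LGen v))"
    unfolding free_lie_ops(6) using r by (intro image_subsetI) simp
  moreover have "range (\<lambda>v. lcls scale (LGen v)) \<subseteq> grade fl (- 1)"
    unfolding free_lie_ops(6) by (intro image_subsetI imageI CollectI lhomogeneous.intros(1))
  ultimately show ?thesis by (rule equalityI)
qed

lemma free_lie_generated:
  assumes "lie_subalgebra H fl" "grade fl (- 1) \<subseteq> H"
  shows "carrier fl \<subseteq> H"
proof -
  note c = sub_closed[OF free_lie_lie_algebra assms(1)]
  have "lcls scale t \<in> H" for t
  proof (induction t)
    case (LGen v)
    then show ?case using assms(2) by (auto simp: grade_fl_minus_one)
  qed (use c in \<open>auto simp: free_lie_ops(2) simp flip: free_lie_ops(3-5)\<close>)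
  then show ?thesis by (auto simp: free_lie_ops(1))
qed

lemma gen_bracket:
  assumes "multilinear \<xi>"
  shows "bracket F (lcls scale LZero, \<xi>) (incl (lcls scale (LGen v))) = (lcls scale (LGen (\<xi> [v])), contract \<xi> v)"
  using assms
  by (simp add: incl_lcls F_bracket multilinear_zero nact_simps pact_simps lcls_eq_iff cl_simps nb_zero_right)

end

context base_space_type
begin

abbreviation FL where "FL \<equiv> prolongation_of_type scale L"

lemma FL_iff: "(lcls scale t, \<xi>) \<in> FL \<longleftrightarrow> multilinear_of_type L \<xi>"
  by (simp add: prolongation_of_type_def list_fun_sum_eq lcls_carrier)

lemma FL_E:
  assumes "x \<in> FL"
  obtains t \<xi> where "x = (lcls scale t, \<xi>)" "multilinear_of_type L \<xi>"
  using assms by (auto simp: prolongation_of_type_def list_fun_sum_eq free_lie_ops)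

lemma FL_subset: "FL \<subseteq> carrier F"
  by (auto simp: prolongation_of_type_def list_fun_sum_eq F_carrier multilinear_of_typeD)

lemma multilinear_of_type_pact: "multilinear_of_type L \<xi> \<Longrightarrow> multilinear_of_type L (pact t \<xi>)"
  by (induction t arbitrary: \<xi>) (simp_all add: pact_simps multilinear_of_type_closed)

lemma FL_lie_subalgebra: "lie_subalgebra FL F"
proof -
  have "Module.submodule FL (ring_of_type_algebra :: 'k ring) F"
  proof (rule submodule_of_lieI[OF full_prolongation_lie_algebra FL_subset])
    show "\<zero>\<^bsub>F\<^esub> \<in> FL" by (simp add: F_zero FL_iff multilinear_of_type_zero)
    show "x \<oplus>\<^bsub>F\<^esub> y \<in> FL" if "x \<in> FL" "y \<in> FL" for x y
      using that by (elim FL_E) (simp add: F_add FL_iff multilinear_of_type_add)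
    show "a \<odot>\<^bsub>F\<^esub> x \<in> FL" if "x \<in> FL" for a x
      using that by (elim FL_E) (simp add: F_smult FL_iff multilinear_of_type_fscale)
  qed
  moreover have "bracket F x y \<in> FL" if "x \<in> FL" "y \<in> FL" for x y
    using that
    by (elim FL_E) (simp add: F_bracket multilinear_of_typeD FL_iff multilinear_of_type_closed multilinear_of_type_pact)
  ultimately show ?thesis by (simp add: lie_subalgebra_def)
qed

end

locale graded_space = base_space_char_0 scale + base_space_type scale L
  for scale :: "'k::field_char_0 \<Rightarrow> 'v::ab_group_add \<Rightarrow> 'v" and L
begin

lemmas F_lie = full_prolongation_lie_algebra and F_graded = full_prolongation_graded

lemma component_incl: "P \<in> carrier fl \<Longrightarrow> component F (incl P) p = incl (component fl P p)"
  by (rule hom_component[OF incl_hom free_lie_graded F_graded])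

lemma component_incl_nonneg: "P \<in> carrier fl \<Longrightarrow> 0 \<le> p \<Longrightarrow> component F (incl P) p = \<zero>\<^bsub>F\<^esub>"
  using component_grade[OF free_lie_graded, of P p] grade_fl_nonneg[of p]
    hom_zero[OF incl_hom free_lie_lie_algebra F_lie]
  by (simp add: component_incl)

lemma component_nonneg_part:
  assumes "multilinear_of_type L \<xi>"
  shows "component F (lcls scale LZero, \<xi>) p \<in> FL \<and> (p < 0 \<longrightarrow> component F (lcls scale LZero, \<xi>) p = \<zero>\<^bsub>F\<^esub>)"
proof -
  note c = sub_closed[OF F_lie FL_lie_subalgebra]
  have "(lcls scale LZero, \<xi>) \<in> {x \<in> carrier F. \<forall>p. component F x p \<in> FL \<and> (p < 0 \<longrightarrow> component F x p = \<zero>\<^bsub>F\<^esub>)}"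
    using assms
  proof (rule nonneg_span)
    fix n \<eta> assume "multilinear_of_type L \<eta>" "(lcls scale LZero, \<eta>) \<in> grade F (int n)"
    then show "(lcls scale LZero, \<eta>) \<in> {x \<in> carrier F. \<forall>p. component F x p \<in> FL \<and> (p < 0 \<longrightarrow> component F x p = \<zero>\<^bsub>F\<^esub>)}"
      using component_homogeneous[OF F_graded, of "(lcls scale LZero, \<eta>)" "int n"] c(1)
      by (simp add: FL_iff grade_carrier[OF F_graded])
  next
    fix x y assume "x \<in> {x \<in> carrier F. \<forall>p. component F x p \<in> FL \<and> (p < 0 \<longrightarrow> component F x p = \<zero>\<^bsub>F\<^esub>)}"
      "y \<in> {x \<in> carrier F. \<forall>p. component F x p \<in> FL \<and> (p < 0 \<longrightarrow> component F x p = \<zero>\<^bsub>F\<^esub>)}"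
    moreover have "\<zero>\<^bsub>F\<^esub> \<oplus>\<^bsub>F\<^esub> \<zero>\<^bsub>F\<^esub> = \<zero>\<^bsub>F\<^esub>"
      by (simp add: F_zero F_add lcls_eq_iff cl_simps)
    ultimately show "x \<oplus>\<^bsub>F\<^esub> y \<in> {x \<in> carrier F. \<forall>p. component F x p \<in> FL \<and> (p < 0 \<longrightarrow> component F x p = \<zero>\<^bsub>F\<^esub>)}"
      using c(2) by (simp add: component_add[OF F_graded] lie_algebra_closed[OF F_lie])
  qed
  then show ?thesis by blast
qed

lemma FL_split: "multilinear \<xi> \<Longrightarrow> (lcls scale t, \<xi>) = incl (lcls scale t) \<oplus>\<^bsub>F\<^esub> (lcls scale LZero, \<xi>)"
  unfolding incl_lcls by (rule F_split)

lemma incl_FL: "P \<in> carrier fl \<Longrightarrow> incl P \<in> FL"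
  by (elim fl_carrierE) (simp add: incl_lcls FL_iff multilinear_of_type_zero)

lemma component_FL:
  assumes t: "multilinear_of_type L \<xi>"
  shows "component F (lcls scale t, \<xi>) p =
    (if p < 0 then incl (component fl (lcls scale t) p) else component F (lcls scale LZero, \<xi>) p)"
proof -
  note m = multilinear_of_typeD(1)[OF t]
  have c: "incl (lcls scale t) \<in> carrier F" "(lcls scale LZero, \<xi>) \<in> carrier F"
    using m by (simp_all add: F_carrier incl_lcls lcls_carrier multilinear_zero)
  have e: "component F (lcls scale t, \<xi>) p = component F (incl (lcls scale t)) p \<oplus>\<^bsub>F\<^esub> component F (lcls scale LZero, \<xi>) p"
    by (subst FL_split[OF m]) (rule component_add[OF F_graded c])
  note cc = component_carrier[OF F_graded c(1), of p] component_carrier[OF F_graded c(2), of p]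
  show ?thesis
  proof (cases "p < 0")
    case True
    then show ?thesis
      unfolding e using component_nonneg_part[OF t, of p] cc(1)
      by (simp add: lie_algebra_add_zero[OF F_lie] component_incl[OF lcls_carrier])
  next
    case False
    then show ?thesis
      unfolding e using component_incl_nonneg[OF lcls_carrier[of t], of p] cc(2)
      by (simp add: lie_algebra_add_zero[OF F_lie])
  qed
qed

lemma component_FL_closed:
  assumes "x \<in> FL"
  shows "component F x p \<in> FL"
proof -
  obtain t \<xi> where x: "x = (lcls scale t, \<xi>)" and t: "multilinear_of_type L \<xi>" using assms by (rule FL_E)
  have "incl (component fl (lcls scale t) p) \<in> FL"
    by (rule incl_FL) (rule component_carrier[OF free_lie_graded lcls_carrier])
  then show ?thesis
    unfolding x using component_nonneg_part[OF t, of p] by (subst component_FL[OF t]) simp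
qed

end


section \<open>The quotient by a graded ideal\<close>

lemma lie_algebra_zero_bracket:
  fixes G :: "('k::field, 'g) graded_struct"
  assumes "lie_algebra G" "x \<in> carrier G"
  shows "bracket G \<zero>\<^bsub>G\<^esub> x = \<zero>\<^bsub>G\<^esub>" "bracket G x \<zero>\<^bsub>G\<^esub> = \<zero>\<^bsub>G\<^esub>"
  using assms(2)
  by (subst lemb_inject[OF assms(1), symmetric]; simp add: lemb_simps[OF assms(1)])+

lemma hom_inj_onI:
  fixes G :: "('k::field, 'g) graded_struct" and H :: "('k, 'h) graded_struct"
  assumes f: "f \<in> graded_lie_hom G H" and G: "lie_algebra G" and H: "lie_algebra H"
    and ker: "\<And>x. x \<in> carrier G \<Longrightarrow> f x = \<zero>\<^bsub>H\<^esub> \<Longrightarrow> x = \<zero>\<^bsub>G\<^esub>"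
  shows "inj_on f (carrier G)"
proof (rule inj_onI)
  fix x y assume x: "x \<in> carrier G" and y: "y \<in> carrier G" and e: "f x = f y"
  have "f (x \<ominus>\<^bsub>G\<^esub> y) = f x \<ominus>\<^bsub>H\<^esub> f y" by (rule hom_minus[OF f G H x y])
  also have "\<dots> = \<zero>\<^bsub>H\<^esub>"
    unfolding e using hom_carrier[OF f y] by (subst lemb_inject[OF H, symmetric]) (simp_all add: lemb_simps[OF H])
  finally have "x \<ominus>\<^bsub>G\<^esub> y = \<zero>\<^bsub>G\<^esub>" using x y by (intro ker) (simp_all add: lie_algebra_closed[OF G])
  then have "lemb G x - lemb G y = 0" using x y by (simp flip: lemb_minus[OF G] add: lemb_zero[OF G])
  then show "x = y" using lemb_inject[OF G x y] by simp
qed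

lemma lie_subalgebra_preimage:
  fixes G :: "('k::field, 'g) graded_struct" and H :: "('k, 'h) graded_struct"
  assumes f: "f \<in> graded_lie_hom G H" and G: "lie_algebra G" and H: "lie_algebra H" and S: "lie_subalgebra S H"
  shows "lie_subalgebra {x \<in> carrier G. f x \<in> S} G"
proof -
  note c = sub_closed[OF H S]
  have "Module.submodule {x \<in> carrier G. f x \<in> S} (ring_of_type_algebra :: 'k ring) G"
    by (rule submodule_of_lieI[OF G])
       (use c in \<open>auto simp: hom_add[OF f] hom_smult[OF f] hom_zero[OF f G H] lie_algebra_closed[OF G]\<close>)
  moreover have "\<forall>x\<in>{x \<in> carrier G. f x \<in> S}. \<forall>y\<in>{x \<in> carrier G. f x \<in> S}. bracket G x y \<in> {x \<in> carrier G. f x \<in> S}"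
    using c(4) by (auto simp: hom_bracket[OF f] lie_algebra_closed[OF G])
  ultimately show ?thesis unfolding lie_subalgebra_def by blast
qed

lemma lie_quotient_induced_hom:
  fixes G :: "('k::field, 'g) graded_struct" and H :: "('k, 'h) graded_struct"
  assumes f: "f \<in> graded_lie_hom G H" and G: "lie_algebra G" and I: "lie_ideal I G"
    and g: "\<And>x. x \<in> carrier G \<Longrightarrow> g (I +>\<^bsub>G\<^esub> x) = f x" and gc: "\<And>p. grade G p \<subseteq> carrier G"
  shows "g \<in> graded_lie_hom (lie_quotient G I) H"
proof -
  have "g Z \<in> grade H p" if Z: "Z \<in> grade (lie_quotient G I) p" for Z p
  proof -
    obtain x where "Z = I +>\<^bsub>G\<^esub> x" "x \<in> grade G p" using Z by (auto simp: lie_quotient_def)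
    then show ?thesis using hom_grade[OF f] g gc by (metis subsetD)
  qed
  then show ?thesis
    unfolding graded_lie_hom_def lie_quotient_carrier[OF G I]
    by (auto simp: lie_quotient_add[OF G I] lie_quotient_smult[OF G I] lie_quotient_bracket[OF G I] g
        hom_carrier[OF f] hom_add[OF f] hom_smult[OF f] hom_bracket[OF f] lie_algebra_closed[OF G])
qed

locale ideal_space = graded_space scale L
  for scale :: "'k::field_char_0 \<Rightarrow> 'v::ab_group_add \<Rightarrow> 'v" and L +
  fixes K :: "('k, 'v) lterm set set"
  assumes K: "graded_ideal K fl" and K_degree: "K \<subseteq> graded_part fl {..-2}"
begin

abbreviation NN where "NN \<equiv> bracket_normalizer F FL (incl ` K)"
abbreviation NA where "NA \<equiv> normalizer_alg scale K L"
abbreviation M where "M \<equiv> m_alg scale K"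
abbreviation GA where "GA \<equiv> g_alg scale K L"
abbreviation q where "q x \<equiv> incl ` K +>\<^bsub>NA\<^esub> x"

lemma NA_eq: "NA = graded_restrict F NN"
  unfolding normalizer_alg_def bracket_normalizer_def ..

lemmas fl_lie = free_lie_lie_algebra and fl_graded = free_lie_graded

lemma K_ideal: "lie_ideal K fl"
  by (rule graded_ideal_lie_ideal[OF K])

lemmas K_submodule = lie_ideal_submodule[OF fl_lie K_ideal]
lemmas K_subset = lie_ideal_subset[OF fl_lie K_ideal]

lemma K_component: "P \<in> K \<Longrightarrow> component fl P p \<in> K"
  by (rule graded_ideal_component[OF fl_graded K])

lemma K_component_zero: "P \<in> K \<Longrightarrow> - 2 < p \<Longrightarrow> component fl P p = \<zero>\<^bsub>fl\<^esub>"
  using K_degree graded_part_iff[OF fl_graded, of P "{..-2}"] by auto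

text \<open>K has no component of degree \<open>-1\<close>, and V embeds into the free Lie algebra
  by \<open>abelian_value\<close>; hence V also embeds into \<open>m(K)\<close>.\<close>

lemma LGen_K: "lcls scale (LGen v) \<in> K \<Longrightarrow> v = 0"
proof -
  assume k: "lcls scale (LGen v) \<in> K"
  have "lcls scale (LGen v) \<in> grade fl (- 1)" by (simp add: grade_fl_minus_one)
  then have "component fl (lcls scale (LGen v)) (- 1) = lcls scale (LGen v)"
    by (simp add: component_homogeneous[OF fl_graded])
  then have "lcls scale (LGen v) = lcls scale LZero"
    using K_component_zero[OF k, of "- 1"] by (simp add: free_lie_ops(2))
  then show "v = 0" by (simp add: lcls_eq_iff cl_simps cl_LGen_eq_0_iff)
qed

lemma incl_image_iff: "(lcls scale t, \<xi>) \<in> incl ` K \<longleftrightarrow> lcls scale t \<in> K \<and> \<xi> = 0"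
  by (auto simp: incl_def zero_fun_def)

lemma incl_in_image_iff: "incl P \<in> incl ` K \<longleftrightarrow> P \<in> K"
  by (auto simp: incl_def)

lemma incl_K_submodule: "Module.submodule (incl ` K) (ring_of_type_algebra :: 'k ring) F"
proof (rule submodule_of_lieI[OF F_lie])
  note h = hom_carrier[OF incl_hom] hom_add[OF incl_hom, symmetric] hom_smult[OF incl_hom, symmetric]
    hom_zero[OF incl_hom fl_lie F_lie, symmetric]
  show "incl ` K \<subseteq> carrier F" using K_subset h(1) by blast
  show "\<zero>\<^bsub>F\<^esub> \<in> incl ` K" unfolding h(4) using submodule_of_lie_zero[OF fl_lie K_submodule] by blast
  show "x \<oplus>\<^bsub>F\<^esub> y \<in> incl ` K" if "x \<in> incl ` K" "y \<in> incl ` K" for x y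
    using that submodule_of_lie_add[OF fl_lie K_submodule] by (auto simp: h(2)[OF subsetD[OF K_subset] subsetD[OF K_subset]])
  show "a \<odot>\<^bsub>F\<^esub> x \<in> incl ` K" if "x \<in> incl ` K" for a x
    using that submodule_of_lie_smult[OF fl_lie K_submodule] by (auto simp: h(3)[OF subsetD[OF K_subset]])
qed

lemma incl_K_component: "x \<in> incl ` K \<Longrightarrow> component F x p \<in> incl ` K"
  using K_component K_subset component_incl by (auto simp: incl_in_image_iff subset_iff)

lemma NN_subalgebra: "lie_subalgebra NN F"
  by (rule bracket_normalizer_lie_subalgebra[OF F_lie FL_lie_subalgebra incl_K_submodule])

lemma NN_component: "x \<in> NN \<Longrightarrow> component F x p \<in> NN"
  by (rule bracket_normalizer_component[OF F_graded FL_lie_subalgebra component_FL_closed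
        incl_K_submodule incl_K_component])

lemma NN_FL: "x \<in> NN \<Longrightarrow> x \<in> FL"
  by (simp add: bracket_normalizer_def)

lemma NN_carrier: "x \<in> NN \<Longrightarrow> x \<in> carrier F"
  using NN_FL FL_subset by blast

text \<open>\<open>[t, k]\<close> lies in K because K is an ideal, so to normalize K is a condition
  on \<xi>. The included copy of K has nonnegative part 0, which forces
  \<open>pact k \<xi> = 0\<close> besides a negative part in K.\<close>

lemma NN_iff: "(lcls scale t, \<xi>) \<in> NN \<longleftrightarrow>
    multilinear_of_type L \<xi> \<and> (\<forall>k. lcls scale k \<in> K \<longrightarrow> lcls scale (nact k \<xi>) \<in> K \<and> pact k \<xi> = 0)"
proof (cases "multilinear_of_type L \<xi>")
  case True
  note m = multilinear_of_typeD(1)[OF True]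
  have "bracket F (lcls scale t, \<xi>) (lcls scale k, 0) \<in> incl ` K \<longleftrightarrow> lcls scale (nact k \<xi>) \<in> K \<and> pact k \<xi> = 0"
    if k: "lcls scale k \<in> K" for k
  proof -
    have "bracket F (lcls scale t, \<xi>) (lcls scale k, 0) = (lcls scale (LBr t k) \<oplus>\<^bsub>fl\<^esub> lcls scale (nact k \<xi>), pact k \<xi>)"
      by (simp add: F_bracket m multilinear_zero free_lie_ops(3) lcls_eq_iff cl_simps cl_nact_zero nb_zero_right pact_zero)
    moreover have br: "lcls scale (LBr t k) \<in> K"
      using lie_ideal_bracket_right[OF fl_lie K_ideal lcls_carrier k] by (simp add: free_lie_ops)
    have "lcls scale (LBr t k) \<oplus>\<^bsub>fl\<^esub> lcls scale (nact k \<xi>) \<in> K \<longleftrightarrow> lcls scale (nact k \<xi>) \<in> K"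
    proof
      assume "lcls scale (LBr t k) \<oplus>\<^bsub>fl\<^esub> lcls scale (nact k \<xi>) \<in> K"
      then have "(lcls scale (LBr t k) \<oplus>\<^bsub>fl\<^esub> lcls scale (nact k \<xi>)) \<ominus>\<^bsub>fl\<^esub> lcls scale (LBr t k) \<in> K"
        using br by (rule submodule_of_lie_minus[OF fl_lie K_submodule])
      moreover have "(lcls scale (LBr t k) \<oplus>\<^bsub>fl\<^esub> lcls scale (nact k \<xi>)) \<ominus>\<^bsub>fl\<^esub> lcls scale (LBr t k) = lcls scale (nact k \<xi>)"
        by (simp add: free_lie_ops fl_minus lcls_eq_iff cl_simps)
      ultimately show "lcls scale (nact k \<xi>) \<in> K" by simp
    qed (rule submodule_of_lie_add[OF fl_lie K_submodule br])
    ultimately show ?thesis by (simp add: free_lie_ops(3) incl_image_iff)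
  qed
  moreover have "(\<forall>k\<in>incl ` K. bracket F (lcls scale t, \<xi>) k \<in> incl ` K) \<longleftrightarrow>
      (\<forall>k. lcls scale k \<in> K \<longrightarrow> bracket F (lcls scale t, \<xi>) (lcls scale k, 0) \<in> incl ` K)"
  proof -
    have "(\<forall>k\<in>incl ` K. bracket F (lcls scale t, \<xi>) k \<in> incl ` K) \<longleftrightarrow> (\<forall>P\<in>K. bracket F (lcls scale t, \<xi>) (incl P) \<in> incl ` K)"
      by blast
    also have "\<dots> \<longleftrightarrow> (\<forall>k. lcls scale k \<in> K \<longrightarrow> bracket F (lcls scale t, \<xi>) (incl (lcls scale k)) \<in> incl ` K)"
    proof (intro iffI ballI allI impI)
      fix P assume *: "\<forall>k. lcls scale k \<in> K \<longrightarrow> bracket F (lcls scale t, \<xi>) (incl (lcls scale k)) \<in> incl ` K" and P: "P \<in> K"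
      obtain k where "P = lcls scale k" by (rule fl_carrierE[OF subsetD[OF K_subset P]])
      then show "bracket F (lcls scale t, \<xi>) (incl P) \<in> incl ` K" using * P by blast
    qed blast
    finally show ?thesis unfolding incl_lcls .
  qed
  ultimately show ?thesis
    using True by (simp add: bracket_normalizer_def FL_iff)
qed (simp add: bracket_normalizer_def FL_iff)

lemma incl_NN: "P \<in> carrier fl \<Longrightarrow> incl P \<in> NN"
proof (elim fl_carrierE)
  fix t assume "P = lcls scale t"
  moreover have "lcls scale (nact k 0) \<in> K" for k
  proof -
    have "lcls scale (nact k 0) = \<zero>\<^bsub>fl\<^esub>" by (simp add: free_lie_ops(2) lcls_eq_iff cl_nact_zero cl_simps)
    then show ?thesis using submodule_of_lie_zero[OF fl_lie K_submodule] by simp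
  qed
  ultimately show "incl P \<in> NN" by (simp add: incl_lcls NN_iff multilinear_of_type_zero pact_zero)
qed

lemma NN_nonneg_part: "(lcls scale t, \<xi>) \<in> NN \<Longrightarrow> (lcls scale LZero, \<xi>) \<in> NN"
  by (simp add: NN_iff)

section \<open>The normalizer and the quotient as graded Lie algebras\<close>

lemma NA_graded: "graded_lie_algebra NA"
  unfolding NA_eq by (rule graded_restrict_graded[OF F_graded NN_subalgebra NN_component])

lemmas NA_lie = graded_lie_algebra_lie[OF NA_graded]

lemma NA_simps: "carrier NA = NN" "\<zero>\<^bsub>NA\<^esub> = \<zero>\<^bsub>F\<^esub>" "x \<oplus>\<^bsub>NA\<^esub> y = x \<oplus>\<^bsub>F\<^esub> y" "a \<odot>\<^bsub>NA\<^esub> x = a \<odot>\<^bsub>F\<^esub> x"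
  "bracket NA x y = bracket F x y" "grade NA p = grade F p \<inter> NN"
  unfolding NA_eq by (simp_all add: graded_restrict_def)

lemma NA_component: "x \<in> NN \<Longrightarrow> component NA x p = component F x p"
  unfolding NA_eq by (rule component_graded_restrict[OF F_graded NN_subalgebra NN_component])

lemma incl_K_ideal: "lie_ideal (incl ` K) NA"
proof -
  have "Module.submodule (incl ` K) (ring_of_type_algebra :: 'k ring) NA"
    by (rule submodule_of_lieI[OF NA_lie])
       (use K_subset incl_NN submodule_of_lie_zero[OF F_lie incl_K_submodule] submodule_of_lie_add[OF F_lie incl_K_submodule]
        submodule_of_lie_smult[OF F_lie incl_K_submodule] in \<open>auto simp: NA_simps\<close>)
  then show ?thesis
    by (simp add: lie_ideal_def NA_simps) (simp add: bracket_normalizer_def)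
qed

lemma incl_K_graded_ideal: "graded_ideal (incl ` K) NA"
proof (rule graded_idealI[OF NA_graded incl_K_ideal])
  fix x p assume x: "x \<in> incl ` K"
  then have "x \<in> NN" using K_subset incl_NN by blast
  then show "component NA x p \<in> incl ` K" using incl_K_component[OF x] NA_component by simp
qed

lemma incl_hom_NA: "incl \<in> graded_lie_hom fl NA"
  using incl_hom incl_NN grade_subset[OF fl_graded]
  unfolding graded_lie_hom_def by (auto simp: NA_simps subset_iff image_subset_iff)

lemma GA_eq: "GA = lie_quotient NA (incl ` K)"
  by (simp add: g_alg_def)

lemma M_eq: "M = lie_quotient fl K"
  by (simp add: m_alg_def)

lemma GA_graded: "graded_lie_algebra GA"
  unfolding GA_eq by (rule lie_quotient_graded[OF NA_graded incl_K_graded_ideal])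

lemma M_graded: "graded_lie_algebra M"
  unfolding M_eq by (rule lie_quotient_graded[OF fl_graded K])

lemmas GA_lie = graded_lie_algebra_lie[OF GA_graded] and M_lie = graded_lie_algebra_lie[OF M_graded]

lemma q_hom: "(\<lambda>x. q x) \<in> graded_lie_hom NA GA"
  unfolding GA_eq by (rule lie_quotient_hom[OF NA_lie incl_K_ideal])

lemma mcoset_hom: "(\<lambda>P. K +>\<^bsub>fl\<^esub> P) \<in> graded_lie_hom fl M"
  unfolding M_eq by (rule lie_quotient_hom[OF fl_lie K_ideal])

lemma GA_carrier: "carrier GA = (\<lambda>x. q x) ` NN"
  unfolding GA_eq by (simp add: lie_quotient_carrier[OF NA_lie incl_K_ideal] NA_simps)

lemma M_carrier: "carrier M = (\<lambda>P. K +>\<^bsub>fl\<^esub> P) ` carrier fl"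
  unfolding M_eq by (simp add: lie_quotient_carrier[OF fl_lie K_ideal])

lemma q_zero: "q \<zero>\<^bsub>F\<^esub> = \<zero>\<^bsub>GA\<^esub>"
  unfolding GA_eq by (simp add: lie_quotient_zero[OF NA_lie incl_K_ideal] NA_simps)

lemma q_eq_zero_iff: "x \<in> NN \<Longrightarrow> q x = \<zero>\<^bsub>GA\<^esub> \<longleftrightarrow> x \<in> incl ` K"
  using coset_eq_ideal_iff[OF NA_lie incl_K_ideal, of x] by (simp add: GA_eq lie_quotient_def NA_simps)

lemma q_component: "x \<in> NN \<Longrightarrow> component GA (q x) p = q (component F x p)"
  using hom_component[OF q_hom NA_graded GA_graded, of x p] by (simp add: NA_component NA_simps)

text \<open>The union in \<open>m_to_g\<close> runs over all representatives of a class modulo K;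
  their images agree modulo the included copy of K.\<close>

lemma m_to_g_coset: "P \<in> carrier fl \<Longrightarrow> m_to_g scale K L (K +>\<^bsub>fl\<^esub> P) = q (incl P)"
proof -
  assume P: "P \<in> carrier fl"
  have "q (incl Q) = q (incl P)" if Q: "Q \<in> K +>\<^bsub>fl\<^esub> P" for Q
  proof -
    have Q: "Q \<in> carrier fl" "Q \<ominus>\<^bsub>fl\<^esub> P \<in> K" using Q by (simp_all add: mem_coset_iff[OF fl_lie K_ideal P])
    have "incl Q \<ominus>\<^bsub>NA\<^esub> incl P = incl (Q \<ominus>\<^bsub>fl\<^esub> P)"
      by (rule hom_minus[OF incl_hom_NA fl_lie NA_lie Q(1) P, symmetric])
    then show ?thesis
      using Q P incl_NN by (intro coset_eqI[OF NA_lie incl_K_ideal]) (simp_all add: NA_simps)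
  qed
  then have "(\<Union>Q\<in>K +>\<^bsub>fl\<^esub> P. q (incl Q)) = (\<Union>Q\<in>K +>\<^bsub>fl\<^esub> P. q (incl P))"
    by (intro SUP_cong HOL.refl)
  also have "\<dots> = q (incl P)"
    using coset_self[OF fl_lie K_ideal P] by blast
  finally show ?thesis unfolding m_to_g_def .
qed

lemma q_incl_hom: "(\<lambda>P. q (incl P)) \<in> graded_lie_hom fl GA"
  using graded_lie_hom_comp[OF incl_hom_NA q_hom] by (simp add: comp_def)

lemma m_to_g_hom: "m_to_g scale K L \<in> graded_lie_hom M GA"
  unfolding M_eq
  by (rule lie_quotient_induced_hom[OF q_incl_hom fl_lie K_ideal m_to_g_coset grade_subset[OF fl_graded]])

lemma mcoset_zero: "P \<in> K \<Longrightarrow> K +>\<^bsub>fl\<^esub> P = \<zero>\<^bsub>M\<^esub>"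
  using coset_eq_ideal_iff[OF fl_lie K_ideal, of P] K_subset by (auto simp: M_eq lie_quotient_def)

lemma m_to_g_inj: "inj_on (m_to_g scale K L) (carrier M)"
proof (rule hom_inj_onI[OF m_to_g_hom M_lie GA_lie])
  fix Z assume "Z \<in> carrier M" and z: "m_to_g scale K L Z = \<zero>\<^bsub>GA\<^esub>"
  then obtain P where P: "P \<in> carrier fl" "Z = K +>\<^bsub>fl\<^esub> P" by (auto simp: M_carrier)
  then have "P \<in> K" using z m_to_g_coset[of P] q_eq_zero_iff[OF incl_NN[of P]] by (simp add: incl_in_image_iff)
  then show "Z = \<zero>\<^bsub>M\<^esub>" using mcoset_zero P by simp
qed

section \<open>The algebra \<open>m(K)\<close> and effectivity of the quotient\<close>

lemma gen_m_eq: "gen_m scale K v = K +>\<^bsub>fl\<^esub> lcls scale (LGen v)"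
  by (simp add: gen_m_def)

lemma gen_m_linear:
  "gen_m scale K (v + w) = gen_m scale K v \<oplus>\<^bsub>M\<^esub> gen_m scale K w"
  "gen_m scale K (scale a v) = a \<odot>\<^bsub>M\<^esub> gen_m scale K v"
  "gen_m scale K 0 = \<zero>\<^bsub>M\<^esub>"
proof -
  have e: "lcls scale (LGen (v + w)) = lcls scale (LGen v) \<oplus>\<^bsub>fl\<^esub> lcls scale (LGen w)"
    "lcls scale (LGen (scale a v)) = a \<odot>\<^bsub>fl\<^esub> lcls scale (LGen v)" "lcls scale (LGen 0) = \<zero>\<^bsub>fl\<^esub>"
    by (simp_all add: free_lie_ops lcls_eq_iff cl_simps cl_LGen)
  show "gen_m scale K (v + w) = gen_m scale K v \<oplus>\<^bsub>M\<^esub> gen_m scale K w"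
    "gen_m scale K (scale a v) = a \<odot>\<^bsub>M\<^esub> gen_m scale K v" "gen_m scale K 0 = \<zero>\<^bsub>M\<^esub>"
    unfolding gen_m_eq e
    by (simp_all add: hom_add[OF mcoset_hom lcls_carrier lcls_carrier] hom_smult[OF mcoset_hom lcls_carrier]
        hom_zero[OF mcoset_hom fl_lie M_lie])
qed

lemma M_grade: "grade M p = (\<lambda>P. K +>\<^bsub>fl\<^esub> P) ` grade fl p"
  by (simp add: M_eq lie_quotient_def)

lemma M_grade_minus_one: "grade M (- 1) = range (gen_m scale K)"
  by (simp add: M_grade grade_fl_minus_one image_image gen_m_eq[abs_def])

text \<open>The images of a finite spanning set span degree \<open>-1\<close>, since the preimage of
  a submodule under \<open>gen_m\<close> is a subspace of V. Generation is inherited from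
  \<open>f(V)\<close> through preimages of subalgebras.\<close>

lemma M_fgla:
  assumes "finite B" "span B = UNIV"
  shows "fgla M"
  unfolding fgla_def
proof (intro conjI allI impI)
  show "graded_lie_algebra M" by (rule M_graded)
  show "grade M p = {\<zero>\<^bsub>M\<^esub>}" if "0 \<le> p" for p
    using hom_zero[OF mcoset_hom fl_lie M_lie] by (simp add: M_grade grade_fl_nonneg[OF that])
  have "grade M (- 1) \<subseteq> U" if U: "Module.submodule U (ring_of_type_algebra :: 'k ring) M" "gen_m scale K ` B \<subseteq> U" for U
  proof -
    have "subspace {v. gen_m scale K v \<in> U}"
      using submodule_of_lie_zero[OF M_lie U(1)] submodule_of_lie_add[OF M_lie U(1)] submodule_of_lie_smult[OF M_lie U(1)]
      by (intro subspaceI) (simp_all add: gen_m_linear)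
    moreover have "B \<subseteq> {v. gen_m scale K v \<in> U}" using U(2) by blast
    ultimately have "span B \<subseteq> {v. gen_m scale K v \<in> U}" by (intro span_minimal)
    then show ?thesis using assms(2) by (auto simp: M_grade_minus_one)
  qed
  then show "\<exists>S. finite S \<and> S \<subseteq> grade M (- 1) \<and> (\<forall>U. Module.submodule U (ring_of_type_algebra :: 'k ring) M \<and> S \<subseteq> U \<longrightarrow> grade M (- 1) \<subseteq> U)"
    using assms(1) by (intro exI[of _ "gen_m scale K ` B"]) (auto simp: M_grade_minus_one)
  fix H assume H: "lie_subalgebra H M \<and> grade M (- 1) \<subseteq> H"
  have "carrier fl \<subseteq> {P \<in> carrier fl. K +>\<^bsub>fl\<^esub> P \<in> H}"
    using H by (intro free_lie_generated lie_subalgebra_preimage[OF mcoset_hom fl_lie M_lie])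
      (auto simp: M_grade grade_carrier[OF fl_graded])
  then show "carrier M \<subseteq> H" by (auto simp: M_carrier)
qed

text \<open>For the reverse inclusion, the components of y of degree \<open>p \<ge> 0\<close> lie in
  the included copy of K, because those of its class vanish. That copy lives in negative degrees, so
  these components are zero and y comes from \<open>f(V)\<close>.\<close>

lemma m_to_g_image: "m_to_g scale K L ` carrier M = graded_part GA {..<0}"
proof (intro equalityI subsetI)
  fix Z assume "Z \<in> m_to_g scale K L ` carrier M"
  then obtain P where P: "P \<in> carrier fl" "Z = q (incl P)" using m_to_g_coset by (auto simp: M_carrier)
  have "component GA Z p = \<zero>\<^bsub>GA\<^esub>" if "0 \<le> p" for p
    using q_component[OF incl_NN[OF P(1)]] component_incl_nonneg[OF P(1) that] q_zero P(2) by simp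
  then show "Z \<in> graded_part GA {..<0}"
    using P incl_NN by (auto simp: graded_part_iff[OF GA_graded] GA_carrier)
next
  fix Z assume Z: "Z \<in> graded_part GA {..<0}"
  then obtain y where y: "y \<in> NN" "Z = q y" by (auto simp: graded_part_iff[OF GA_graded] GA_carrier)
  obtain t \<xi> where t: "y = (lcls scale t, \<xi>)" "multilinear_of_type L \<xi>" by (rule FL_E[OF NN_FL[OF y(1)]])
  note m = multilinear_of_typeD(1)[OF t(2)]
  have zc: "(lcls scale LZero, \<xi>) \<in> carrier F" by (simp add: F_carrier m lcls_carrier)
  have "component F (lcls scale LZero, \<xi>) p = \<zero>\<^bsub>F\<^esub>" for p
  proof (cases "p < 0")
    case True
    then show ?thesis using component_nonneg_part[OF t(2)] by blast
  next
    case False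
    have e: "component F y p = component F (lcls scale LZero, \<xi>) p"
      unfolding t(1) using False by (subst component_FL[OF t(2)]) simp
    have "q (component F y p) = \<zero>\<^bsub>GA\<^esub>"
      using Z False q_component[OF y(1)] y(2) by (auto simp: graded_part_iff[OF GA_graded])
    then have "component F y p \<in> incl ` K" using q_eq_zero_iff[OF NN_component[OF y(1)]] by blast
    then obtain P where P: "P \<in> K" "component F y p = incl P" by blast
    have "component F (incl P) p = \<zero>\<^bsub>F\<^esub>" using False P(1) K_subset by (intro component_incl_nonneg) auto
    moreover have "component F (component F y p) p = component F y p"
      using component_homogeneous[OF F_graded component_grade[OF F_graded NN_carrier[OF y(1)], of p], of p] by simp
    ultimately show ?thesis using P(2) e by simp
  qed
  then have "(lcls scale LZero, \<xi>) = \<zero>\<^bsub>F\<^esub>" by (rule eq_zero_of_components[OF F_graded zc])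
  then have "y = incl (lcls scale t)" by (simp add: t(1) incl_lcls F_zero)
  then show "Z \<in> m_to_g scale K L ` carrier M"
    using m_to_g_coset[OF lcls_carrier, of t] y(2) lcls_carrier by (auto simp: M_carrier)
qed

lemma q_nonneg_part:
  assumes "y \<in> NN" "y = (lcls scale t, \<xi>)" "q y \<in> graded_part GA {0..}"
  shows "q y = q (lcls scale LZero, \<xi>)"
proof -
  have t: "multilinear_of_type L \<xi>" using NN_FL[OF assms(1)] by (simp add: assms(2) FL_iff)
  note m = multilinear_of_typeD(1)[OF t]
  have "component fl (lcls scale t) p \<in> K" for p
  proof (cases "p < 0")
    case True
    have "q (component F y p) = \<zero>\<^bsub>GA\<^esub>"
      using assms(3) True q_component[OF assms(1)] by (auto simp: graded_part_iff[OF GA_graded])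
    then have "component F y p \<in> incl ` K" using q_eq_zero_iff[OF NN_component[OF assms(1)]] by blast
    moreover have "component F y p = incl (component fl (lcls scale t) p)"
      unfolding assms(2) using True by (subst component_FL[OF t]) simp
    ultimately show ?thesis by (simp add: incl_in_image_iff)
  next
    case False
    then have "component fl (lcls scale t) p = \<zero>\<^bsub>fl\<^esub>"
      using component_grade[OF fl_graded lcls_carrier, of t p] grade_fl_nonneg[of p] by simp
    then show ?thesis using submodule_of_lie_zero[OF fl_lie K_submodule] by simp
  qed
  then have "lcls scale t \<in> K" by (rule mem_submodule_of_components[OF fl_graded K_submodule lcls_carrier])
  then have z: "q (incl (lcls scale t)) = \<zero>\<^bsub>GA\<^esub>"
    using q_eq_zero_iff[OF incl_NN[OF lcls_carrier]] by (simp add: incl_in_image_iff)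
  have n: "(lcls scale LZero, \<xi>) \<in> NN" using assms(1,2) NN_nonneg_part by simp
  have "q y = q (incl (lcls scale t) \<oplus>\<^bsub>NA\<^esub> (lcls scale LZero, \<xi>))"
    unfolding assms(2) NA_simps by (subst FL_split[OF m]) (rule HOL.refl)
  also have "\<dots> = q (incl (lcls scale t)) \<oplus>\<^bsub>GA\<^esub> q (lcls scale LZero, \<xi>)"
    using n incl_NN[OF lcls_carrier] by (intro hom_add[OF q_hom]) (simp_all add: NA_simps)
  also have "\<dots> = q (lcls scale LZero, \<xi>)"
    unfolding z using n hom_carrier[OF q_hom] by (intro lie_algebra_add_zero[OF GA_lie]) (simp add: NA_simps)
  finally show ?thesis .
qed

lemma gen_bracket_GA:
  assumes "(lcls scale LZero, \<xi>) \<in> NN"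
  shows "bracket GA (q (lcls scale LZero, \<xi>)) (q (incl (lcls scale (LGen v)))) = q (lcls scale (LGen (\<xi> [v])), contract \<xi> v)"
    and "(lcls scale (LGen (\<xi> [v])), contract \<xi> v) \<in> NN"
proof -
  have m: "multilinear \<xi>" using assms by (simp add: NN_iff multilinear_of_typeD)
  note i = incl_NN[OF lcls_carrier, of "LGen v"]
  show "bracket GA (q (lcls scale LZero, \<xi>)) (q (incl (lcls scale (LGen v)))) = q (lcls scale (LGen (\<xi> [v])), contract \<xi> v)"
    using hom_bracket[OF q_hom, of "(lcls scale LZero, \<xi>)" "incl (lcls scale (LGen v))"] assms i
    by (simp add: NA_simps gen_bracket[OF m])
  show "(lcls scale (LGen (\<xi> [v])), contract \<xi> v) \<in> NN"
    using lie_subalgebra_bracket[OF F_lie NN_subalgebra assms i] by (simp add: gen_bracket[OF m])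
qed

text \<open>\<open>[\<xi>, v]\<close> has the parts \<open>\<xi> [v]\<close> and
  \<open>contract \<xi> v\<close>. If its class vanishes, it lies in the included copy of K, which
  contains no nonzero vector of V and has nonnegative part 0. So both parts vanish for every v, and
  together they comprise all values of \<xi> on nonempty lists.\<close>

lemma GA_effective:
  assumes Z: "Z \<in> graded_part GA {0..}" and Q: "\<forall>Q\<in>grade GA (- 1). bracket GA Z Q = \<zero>\<^bsub>GA\<^esub>"
  shows "Z = \<zero>\<^bsub>GA\<^esub>"
proof -
  obtain y where y: "y \<in> NN" "Z = q y" using Z by (auto simp: graded_part_iff[OF GA_graded] GA_carrier)
  obtain t \<xi> where t: "y = (lcls scale t, \<xi>)" "multilinear_of_type L \<xi>" by (rule FL_E[OF NN_FL[OF y(1)]])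
  have n: "(lcls scale LZero, \<xi>) \<in> NN" using y(1) t(1) NN_nonneg_part by simp
  have Z': "Z = q (lcls scale LZero, \<xi>)" using q_nonneg_part[OF y(1) t(1)] Z y(2) by simp
  have "\<xi> [v] = 0 \<and> contract \<xi> v = 0" for v
  proof -
    have "q (incl (lcls scale (LGen v))) \<in> grade GA (- 1)"
      by (rule hom_grade[OF q_incl_hom]) (simp add: grade_fl_minus_one)
    then have "q (lcls scale (LGen (\<xi> [v])), contract \<xi> v) = \<zero>\<^bsub>GA\<^esub>"
      unfolding gen_bracket_GA(1)[OF n, symmetric] Z'[symmetric] using Q by blast
    then have "(lcls scale (LGen (\<xi> [v])), contract \<xi> v) \<in> incl ` K"
      using q_eq_zero_iff[OF gen_bracket_GA(2)[OF n]] by blast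
    then show ?thesis using LGen_K by (simp add: incl_image_iff)
  qed
  then have "\<xi> vs = 0" for vs
  proof (cases vs)
    case Nil
    then show ?thesis using multilinearD(1)[OF multilinear_of_typeD(1)[OF t(2)]] by simp
  next
    case (Cons v ws)
    then show ?thesis
      using \<open>\<And>v. \<xi> [v] = 0 \<and> contract \<xi> v = 0\<close>[of v]
      by (cases ws) (auto simp: contract_def fun_eq_iff dest: spec[of _ ws])
  qed
  then have "\<xi> = 0" by (simp add: fun_eq_iff)
  then show ?thesis using Z' q_zero by (simp add: F_zero)
qed

lemma GA_effective_prolongation:
  assumes "finite B" "span B = UNIV"
  shows "effective_prolongation M (m_to_g scale K L) GA"
proof -
  have "\<zero>\<^bsub>GA\<^esub> \<in> graded_part GA {0..}"
    by (simp add: graded_part_iff[OF GA_graded] lie_algebra_closed[OF GA_lie] component_zero[OF GA_graded])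
  moreover have "bracket GA \<zero>\<^bsub>GA\<^esub> Q = \<zero>\<^bsub>GA\<^esub>" if "Q \<in> grade GA (- 1)" for Q
    using lie_algebra_zero_bracket(1)[OF GA_lie grade_carrier[OF GA_graded that]] .
  ultimately have "{P \<in> graded_part GA {0..}. \<forall>Q\<in>grade GA (- 1). bracket GA P Q = \<zero>\<^bsub>GA\<^esub>} = {\<zero>\<^bsub>GA\<^esub>}"
    using GA_effective by blast
  then show ?thesis
    unfolding effective_prolongation_def
    using M_fgla[OF assms] GA_graded m_to_g_hom m_to_g_inj m_to_g_image by blast
qed

lemma m_to_g_gen_m: "m_to_g scale K L (gen_m scale K v) = q (incl (lcls scale (LGen v)))"
  by (simp add: gen_m_eq m_to_g_coset lcls_carrier)

text \<open>A map of degree 0 has zero contractions, so \<open>[A, v]\<close> is the class of the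
  generator \<open>\<xi> [v]\<close>, and \<open>v \<mapsto> \<xi> [v]\<close> lies in L by the type
  condition for the empty prefix.\<close>

lemma GA_of_type: "of_type L (m_to_g scale K L \<circ> gen_m scale K) GA"
  unfolding of_type_def
proof
  fix A assume "A \<in> grade GA 0"
  then obtain x where x: "x \<in> NN" "x \<in> grade F 0" "A = q x"
    by (auto simp: GA_eq lie_quotient_def NA_simps)
  then obtain \<xi> where \<xi>: "x = (lcls scale LZero, \<xi>)" "\<xi> \<in> multilinear_maps scale 0"
    by (auto simp: F_grade)
  then have z: "\<xi> vs = 0" if "length vs \<noteq> 1" for vs using that by (simp add: multilinear_maps_iff)
  have "contract \<xi> v = 0" for v
  proof
    show "contract \<xi> v vs = 0 vs" for vs using z[of "v # vs"] by (cases vs) (simp_all add: contract_def)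
  qed
  then have "bracket GA A (q (incl (lcls scale (LGen v)))) = q (incl (lcls scale (LGen (\<xi> [v]))))" for v
    using gen_bracket_GA(1)[of \<xi> v] x \<xi> by (simp add: incl_lcls)
  moreover have "(\<lambda>v. \<xi> [v]) \<in> L"
    using x(1) multilinear_of_typeD(2)[of \<xi> "[]"] by (simp add: \<xi>(1) NN_iff)
  ultimately show "\<exists>T\<in>L. \<forall>v. bracket GA A ((m_to_g scale K L \<circ> gen_m scale K) v) = (m_to_g scale K L \<circ> gen_m scale K) (T v)"
    by (intro bexI[of _ "\<lambda>v. \<xi> [v]"]) (simp_all add: m_to_g_gen_m)
qed

end


section \<open>Maximality\<close>

lemma graded_part_submodule:
  fixes G :: "('k::field, 'g) graded_struct"
  assumes graded: "graded_lie_algebra G"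
  shows "Module.submodule (graded_part G P) (ring_of_type_algebra :: 'k ring) G"
proof -
  note G = graded_lie_algebra_lie[OF graded]
  have "a \<odot>\<^bsub>G\<^esub> \<zero>\<^bsub>G\<^esub> = \<zero>\<^bsub>G\<^esub>" for a
    by (subst lemb_inject[OF G, symmetric]) (simp_all add: lemb_simps[OF G])
  then show ?thesis
    by (intro submodule_of_lieI[OF G])
       (auto simp: graded_part_iff[OF graded] component_add[OF graded] component_smult[OF graded]
          component_zero[OF graded] lie_algebra_closed[OF G] lie_algebra_add_zero[OF G])
qed

lemma grade_graded_part:
  fixes G :: "('k::field, 'g) graded_struct"
  assumes "graded_lie_algebra G" "x \<in> grade G p" "p \<in> P"
  shows "x \<in> graded_part G P"
  using assms(3) by (auto simp: graded_part_iff[OF assms(1)] grade_carrier[OF assms(1,2)]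
      component_homogeneous[OF assms(1,2)])

lemma graded_part_Int_zero:
  fixes G :: "('k::field, 'g) graded_struct"
  assumes "graded_lie_algebra G" "x \<in> graded_part G P" "x \<in> graded_part G Q" "P \<inter> Q = {}"
  shows "x = \<zero>\<^bsub>G\<^esub>"
  by (rule eq_zero_of_components[OF assms(1)])
     (use assms(2-4) in \<open>auto simp: graded_part_iff[OF assms(1)]\<close>)

text \<open>A degree-preserving endomorphism over \<open>M\<close> is the identity: in degree \<open>p \<ge> 0\<close>, by induction on
  \<open>p\<close>, the difference with the identity is annihilated by the part of degree \<open>-1\<close>.\<close>

lemma effective_prolongation_endo_eq:
  fixes G :: "('k::field, 'g) graded_struct"
  assumes eff: "effective_prolongation M i G" and c: "c \<in> graded_lie_hom G G"
    and ci: "\<And>x. x \<in> carrier M \<Longrightarrow> c (i x) = i x" and x: "x \<in> carrier G"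
  shows "c x = x"
proof -
  have graded: "graded_lie_algebra G" and im: "i ` carrier M = graded_part G {..<0}"
    and kill: "{P \<in> graded_part G {0..}. \<forall>Q\<in>grade G (- 1). bracket G P Q = \<zero>\<^bsub>G\<^esub>} = {\<zero>\<^bsub>G\<^esub>}"
    using eff by (auto simp: effective_prolongation_def)
  note G = graded_lie_algebra_lie[OF graded]
  interpret graded_lie_algebra G by (rule graded)
  have neg: "c x = x" if "x \<in> grade G p" "p < 0" for x p
  proof -
    have "x \<in> i ` carrier M" unfolding im by (rule grade_graded_part[OF graded that(1)]) (simp add: that(2))
    then show ?thesis using ci by blast
  qed
  have step: "c x = x" if x: "x \<in> grade G p" "0 \<le> p" and IH: "\<And>y. y \<in> grade G (p - 1) \<Longrightarrow> c y = y" for x p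
  proof -
    note xc = grade_carrier[OF graded x(1)]
    have cx: "c x \<in> grade G p" by (rule hom_grade[OF c x(1)])
    note cxc = grade_carrier[OF graded cx]
    have "bracket G (c x \<ominus>\<^bsub>G\<^esub> x) y = \<zero>\<^bsub>G\<^esub>" if y: "y \<in> grade G (- 1)" for y
    proof -
      note yc = grade_carrier[OF graded y]
      have "bracket G (c x) y = bracket G x y"
        using hom_bracket[OF c xc yc] neg[OF y] IH[of "bracket G x y"] bracket_grade[OF x(1) y] by simp
      moreover have "lemb G (bracket G (c x \<ominus>\<^bsub>G\<^esub> x) y) = lemb G (bracket G (c x) y) - lemb G (bracket G x y)"
        by (simp add: lemb_simps[OF G] lbr_simps xc cxc yc)
      ultimately have "lemb G (bracket G (c x \<ominus>\<^bsub>G\<^esub> x) y) = lemb G \<zero>\<^bsub>G\<^esub>" by (simp add: lemb_zero[OF G])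
      then show ?thesis
        by (subst (asm) lemb_inject[OF G]) (simp_all add: lie_algebra_closed[OF G] xc cxc yc)
    qed
    moreover have "c x \<ominus>\<^bsub>G\<^esub> x \<in> graded_part G {0..}"
      by (rule grade_graded_part[OF graded submodule_of_lie_minus[OF G grade_submodule cx x(1)]]) (simp add: x(2))
    ultimately have "c x \<ominus>\<^bsub>G\<^esub> x = \<zero>\<^bsub>G\<^esub>" using kill by blast
    then have "lemb G (c x) - lemb G x = 0" using xc cxc by (simp flip: lemb_minus[OF G] add: lemb_zero[OF G])
    then show ?thesis using lemb_inject[OF G cxc xc] by simp
  qed
  have nonneg: "c x = x" if "x \<in> grade G (int n)" for x n
    using that
  proof (induction n arbitrary: x)
    case 0
    show ?case by (rule step[OF 0]) (simp_all add: neg)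
  next
    case (Suc n)
    show ?case by (rule step[OF Suc.prems]) (simp_all add: Suc.IH)
  qed
  show ?thesis
  proof (rule graded_induct[OF graded x, where P = "\<lambda>x. c x = x"])
    show "c y = y" if "y \<in> grade G p" for p y
    proof (cases "p < 0")
      case True
      then show ?thesis by (rule neg[OF that])
    next
      case False
      then show ?thesis using that by (intro nonneg[of _ "nat p"]) simp
    qed
  qed (simp add: hom_add[OF c])
qed

section \<open>A competing prolongation and its negative part\<close>

locale competing_prolongation = ideal_space scale L K
  for scale :: "'k::field_char_0 \<Rightarrow> 'v::ab_group_add \<Rightarrow> 'v" and L K +
  fixes H :: "('k, 'h) graded_struct" and i :: "('k, 'v) lterm set set \<Rightarrow> 'h"
  assumes effective: "effective_prolongation M i H" and type_L: "of_type L (i \<circ> gen_m scale K) H"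
begin

lemma H_props:
  shows H_graded: "graded_lie_algebra H" and i_hom: "i \<in> graded_lie_hom M H" and i_inj: "inj_on i (carrier M)"
    and i_image: "i ` carrier M = graded_part H {..<0}"
  using effective by (auto simp: effective_prolongation_def)

lemma H_effective: "x \<in> graded_part H {0..} \<Longrightarrow> (\<And>y. y \<in> grade H (- 1) \<Longrightarrow> bracket H x y = \<zero>\<^bsub>H\<^esub>) \<Longrightarrow> x = \<zero>\<^bsub>H\<^esub>"
  using effective unfolding effective_prolongation_def by blast

lemmas H_lie = graded_lie_algebra_lie[OF H_graded]

abbreviation J where "J \<equiv> lemb H"
abbreviation Hnn where "Hnn \<equiv> graded_part H {0..}"

lemma J_inject: "x \<in> carrier H \<Longrightarrow> y \<in> carrier H \<Longrightarrow> J x = J y \<longleftrightarrow> x = y"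
  by (rule lemb_inject[OF H_lie])

lemmas J_simps = lemb_simps[OF H_lie]

text \<open>The composite of \<open>f(V) \<rightarrow> m(K)\<close> and \<open>i\<close>, taken on
  terms because \<open>nact\<close> and \<open>pact\<close>, with which brackets in H are to be
  compared, are defined by recursion on terms.\<close>

definition img :: "('k, 'v) lterm \<Rightarrow> 'h" where
  "img t = i (K +>\<^bsub>fl\<^esub> lcls scale t)"

abbreviation e :: "'v \<Rightarrow> 'h" where "e v \<equiv> img (LGen v)"

lemma fl_H_hom: "(\<lambda>P. i (K +>\<^bsub>fl\<^esub> P)) \<in> graded_lie_hom fl H"
  using graded_lie_hom_comp[OF mcoset_hom i_hom] by (simp add: comp_def)

lemma img_carrier: "img t \<in> carrier H"
  unfolding img_def by (rule hom_carrier[OF fl_H_hom lcls_carrier])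

lemma img_cong: "cl s = cl t \<Longrightarrow> img s = img t"
  unfolding img_def by (simp add: lcls_eq_iff[symmetric])

lemma J_img:
  "J (img LZero) = 0" "J (img (LAdd s t)) = J (img s) + J (img t)" "J (img (LSmult a s)) = lscale a (J (img s))"
  "J (img (LBr s t)) = lbr (J (img s)) (J (img t))"
proof -
  note c = img_carrier[unfolded img_def]
  show "J (img LZero) = 0"
    using hom_zero[OF fl_H_hom fl_lie H_lie] by (simp add: img_def free_lie_ops(2) J_simps)
  show "J (img (LAdd s t)) = J (img s) + J (img t)"
    using hom_add[OF fl_H_hom lcls_carrier lcls_carrier, of s t] by (simp add: img_def free_lie_ops(3) J_simps c)
  show "J (img (LSmult a s)) = lscale a (J (img s))"
    using hom_smult[OF fl_H_hom lcls_carrier, of a s] by (simp add: img_def free_lie_ops(4) J_simps c)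
  show "J (img (LBr s t)) = lbr (J (img s)) (J (img t))"
    using hom_bracket[OF fl_H_hom lcls_carrier lcls_carrier, of s t] by (simp add: img_def free_lie_ops(5) J_simps c)
qed

lemma J_e: "J (e (v + w)) = J (e v) + J (e w)" "J (e (scale a v)) = lscale a (J (e v))"
  using img_cong[of "LGen (v + w)" "LAdd (LGen v) (LGen w)"] img_cong[of "LGen (scale a v)" "LSmult a (LGen v)"]
  by (simp_all add: cl_simps cl_LGen J_img)

text \<open>Injectivity of \<open>i\<close> makes K the whole kernel of the composite from
  \<open>f(V)\<close> to H.\<close>

lemma img_eq_zero_iff: "img t = \<zero>\<^bsub>H\<^esub> \<longleftrightarrow> lcls scale t \<in> K"
proof -
  have m: "K +>\<^bsub>fl\<^esub> lcls scale t \<in> carrier M" by (rule hom_carrier[OF mcoset_hom lcls_carrier])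
  have "img t = \<zero>\<^bsub>H\<^esub> \<longleftrightarrow> K +>\<^bsub>fl\<^esub> lcls scale t = \<zero>\<^bsub>M\<^esub>"
    unfolding img_def using inj_onD[OF i_inj _ m lie_algebra_zero_closed[OF M_lie]] hom_zero[OF i_hom M_lie H_lie] by auto
  also have "\<dots> \<longleftrightarrow> lcls scale t \<in> K"
    using coset_eq_ideal_iff[OF fl_lie K_ideal lcls_carrier, of t] by (simp add: M_eq lie_quotient_def)
  finally show ?thesis .
qed

lemma e_inj: "inj e"
proof (rule injI)
  fix v w assume "e v = e w"
  moreover have "J (e (v + scale (- 1) w)) = J (e v) - J (e w)" unfolding J_e by simp
  ultimately have "J (e (v + scale (- 1) w)) = J \<zero>\<^bsub>H\<^esub>" by (simp add: J_simps)
  then have "e (v + scale (- 1) w) = \<zero>\<^bsub>H\<^esub>" using J_inject img_carrier lie_algebra_zero_closed[OF H_lie] by blast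
  then show "v = w" using LGen_K[of "v + scale (- 1) w"] by (simp add: img_eq_zero_iff)
qed

lemma negative_img: "y \<in> graded_part H {..<0} \<Longrightarrow> \<exists>t. y = img t"
proof -
  assume "y \<in> graded_part H {..<0}"
  then obtain m where "m \<in> carrier M" "y = i m" using i_image by blast
  then show ?thesis by (auto simp: M_carrier img_def free_lie_ops(1))
qed

lemma img_negative: "img t \<in> graded_part H {..<0}"
  unfolding img_def i_image[symmetric] by (intro imageI hom_carrier[OF mcoset_hom lcls_carrier])

lemma homogeneous_negative:
  assumes "y \<in> grade H p" "p < 0"
  obtains t where "y = img t" "lcls scale t \<in> grade fl p"
proof -
  obtain s where s: "y = img s" using negative_img grade_graded_part[OF H_graded assms(1), of "{..<0}"] assms(2) by auto
  obtain t where t: "component fl (lcls scale s) p = lcls scale t"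
    by (rule fl_carrierE[OF component_carrier[OF fl_graded lcls_carrier]])
  have "component H y p = img t"
    unfolding s img_def using hom_component[OF fl_H_hom fl_graded H_graded lcls_carrier, of s p] by (simp only: t)
  then have "y = img t" using component_homogeneous[OF H_graded assms(1), of p] by simp
  moreover have "lcls scale t \<in> grade fl p" unfolding t[symmetric] by (rule component_grade[OF fl_graded lcls_carrier])
  ultimately show ?thesis by (rule that)
qed

lemma grade_H_minus_one: "grade H (- 1) = range e"
proof (intro equalityI subsetI)
  fix y assume "y \<in> grade H (- 1)"
  then obtain t where t: "y = img t" "lcls scale t \<in> grade fl (- 1)" by (rule homogeneous_negative) simp
  then obtain v where "lcls scale t = lcls scale (LGen v)" by (auto simp only: grade_fl_minus_one image_iff)
  then show "y \<in> range e" using img_cong[of t "LGen v"] t(1) by (simp add: lcls_eq_iff)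
next
  fix y assume "y \<in> range e"
  then obtain v where v: "y = e v" by blast
  show "y \<in> grade H (- 1)"
    unfolding v img_def by (rule hom_grade[OF fl_H_hom]) (simp add: grade_fl_minus_one)
qed

lemma e_grade: "e v \<in> grade H (- 1)"
  by (simp add: grade_H_minus_one)

definition val :: "'h \<Rightarrow> 'v" where
  "val h = inv_into UNIV e (component H h (- 1))"

lemma e_val: "h \<in> carrier H \<Longrightarrow> e (val h) = component H h (- 1)"
  unfolding val_def using component_grade[OF H_graded, of h "- 1"] by (intro f_inv_into_f) (simp add: grade_H_minus_one)

lemma val_eqI: "component H h (- 1) = e v \<Longrightarrow> val h = v"
  unfolding val_def using inv_f_f[OF e_inj, of v] by simp

lemma val_add: "x \<in> carrier H \<Longrightarrow> y \<in> carrier H \<Longrightarrow> val (x \<oplus>\<^bsub>H\<^esub> y) = val x + val y"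
proof (rule val_eqI)
  assume *: "x \<in> carrier H" "y \<in> carrier H"
  have "J (component H (x \<oplus>\<^bsub>H\<^esub> y) (- 1)) = J (e (val x + val y))"
    using * by (simp add: J_e e_val component_add[OF H_graded] J_simps component_carrier[OF H_graded])
  then show "component H (x \<oplus>\<^bsub>H\<^esub> y) (- 1) = e (val x + val y)"
    using J_inject component_carrier[OF H_graded] img_carrier * lie_algebra_closed[OF H_lie] by metis
qed

lemma val_smult: "x \<in> carrier H \<Longrightarrow> val (a \<odot>\<^bsub>H\<^esub> x) = scale a (val x)"
proof (rule val_eqI)
  assume *: "x \<in> carrier H"
  have "J (component H (a \<odot>\<^bsub>H\<^esub> x) (- 1)) = J (e (scale a (val x)))"
    using * by (simp add: J_e e_val component_smult[OF H_graded] J_simps component_carrier[OF H_graded])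
  then show "component H (a \<odot>\<^bsub>H\<^esub> x) (- 1) = e (scale a (val x))"
    using J_inject component_carrier[OF H_graded] img_carrier * lie_algebra_closed[OF H_lie] by metis
qed

section \<open>Multilinear maps attached to elements of the competitor\<close>

primrec chain :: "'v list \<Rightarrow> 'h \<Rightarrow> 'h" where
  "chain [] h = h"
| "chain (v # vs) h = chain vs (bracket H h (e v))"

lemma chain_carrier: "h \<in> carrier H \<Longrightarrow> chain vs h \<in> carrier H"
  by (induction vs arbitrary: h) (simp_all add: lie_algebra_closed[OF H_lie] img_carrier)

lemma chain_append: "chain (us @ vs) h = chain vs (chain us h)"
  by (induction us arbitrary: h) simp_all

lemma bracket_H_add: "x \<in> carrier H \<Longrightarrow> y \<in> carrier H \<Longrightarrow> z \<in> carrier H \<Longrightarrow>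
    bracket H (x \<oplus>\<^bsub>H\<^esub> y) z = bracket H x z \<oplus>\<^bsub>H\<^esub> bracket H y z"
  by (rule lie_algebra.bracket_add_left[OF H_lie])

lemma chain_add: "x \<in> carrier H \<Longrightarrow> y \<in> carrier H \<Longrightarrow> chain vs (x \<oplus>\<^bsub>H\<^esub> y) = chain vs x \<oplus>\<^bsub>H\<^esub> chain vs y"
  by (induction vs arbitrary: x y) (simp_all add: bracket_H_add img_carrier lie_algebra_closed[OF H_lie])

lemma chain_smult: "x \<in> carrier H \<Longrightarrow> chain vs (a \<odot>\<^bsub>H\<^esub> x) = a \<odot>\<^bsub>H\<^esub> chain vs x"
  by (induction vs arbitrary: x)
     (simp_all add: lie_algebra.bracket_smult_left[OF H_lie] img_carrier lie_algebra_closed[OF H_lie])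

lemma chain_zero: "chain vs \<zero>\<^bsub>H\<^esub> = \<zero>\<^bsub>H\<^esub>"
  by (induction vs) (simp_all add: lie_algebra_zero_bracket[OF H_lie] img_carrier)

lemma component_chain:
  "h \<in> carrier H \<Longrightarrow> component H (chain vs h) p = chain vs (component H h (p + int (length vs)))"
proof (induction vs arbitrary: h)
  case (Cons v vs)
  have "bracket H h (e v) \<in> carrier H" using Cons.prems by (simp add: lie_algebra_closed[OF H_lie] img_carrier)
  then show ?case
    using Cons.IH component_bracket[OF H_graded Cons.prems e_grade, of v "p + int (length vs)"] by (simp add: algebra_simps)
qed simp

text \<open>
  \<open>\<xi>(v\<^sub>1, \<dots>, v\<^sub>n)\<close> is the part of degree \<open>-1\<close> of \<open>[\<dots>[h, v\<^sub>1], \<dots>, v\<^sub>n]\<close>; only the component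
  of \<open>h\<close> of degree \<open>n - 1 \<ge> 0\<close> contributes.
\<close>

definition xi :: "'h \<Rightarrow> 'v list \<Rightarrow> 'v" where
  "xi h vs = (if vs = [] then 0 else val (chain vs h))"

lemma val_chain_component: "h \<in> carrier H \<Longrightarrow> component H h (int (length vs) - 1) = \<zero>\<^bsub>H\<^esub> \<Longrightarrow> val (chain vs h) = 0"
proof (rule val_eqI)
  assume "h \<in> carrier H" "component H h (int (length vs) - 1) = \<zero>\<^bsub>H\<^esub>"
  then have "component H (chain vs h) (- 1) = \<zero>\<^bsub>H\<^esub>" by (simp add: component_chain chain_zero)
  also have "\<dots> = e 0"
    using img_eq_zero_iff[of "LGen 0"] submodule_of_lie_zero[OF fl_lie K_submodule] lcls_eq_iff[of "LGen 0" LZero]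
    by (simp add: free_lie_ops(2) cl_simps cl_LGen)
  finally show "component H (chain vs h) (- 1) = e 0" .
qed

lemma xi_add: "x \<in> carrier H \<Longrightarrow> y \<in> carrier H \<Longrightarrow> xi (x \<oplus>\<^bsub>H\<^esub> y) = xi x + xi y"
  by (rule ext) (simp add: xi_def chain_add val_add chain_carrier)

lemma xi_smult: "x \<in> carrier H \<Longrightarrow> xi (a \<odot>\<^bsub>H\<^esub> x) = fscale a (xi x)"
  by (rule ext) (simp add: xi_def chain_smult val_smult chain_carrier fscale_def)

lemma xi_zero: "xi \<zero>\<^bsub>H\<^esub> = 0"
  using val_chain_component[OF lie_algebra_zero_closed[OF H_lie]] component_zero[OF H_graded]
  by (simp add: fun_eq_iff xi_def)

lemma contract_xi: "contract (xi h) v = xi (bracket H h (e v))"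
  by (rule ext) (simp add: xi_def contract_def)

text \<open>Linearity in each entry comes from linearity of \<open>e\<close> and of the iterated
  bracket. The length is bounded because h has finitely many components. The type condition concerns
  the last bracket, that of an element of degree 0 with V.\<close>

lemma xi_multilinear_of_type:
  assumes h: "h \<in> carrier H"
  shows "multilinear_of_type L (xi h)"
proof -
  note ec = img_carrier
  have add: "xi h (us @ (v + w) # ws) = xi h (us @ v # ws) + xi h (us @ w # ws)" for us v w ws
  proof -
    have "bracket H (chain us h) (e (v + w)) = bracket H (chain us h) (e v) \<oplus>\<^bsub>H\<^esub> bracket H (chain us h) (e w)"
      using chain_carrier[OF h] ec by (subst J_inject[symmetric]) (simp_all add: J_simps J_e lbr_simps)
    then show ?thesis
      using h by (simp add: xi_def chain_append chain_add val_add chain_carrier ec lie_algebra_closed[OF H_lie])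
  qed
  have sc: "xi h (us @ scale a v # ws) = scale a (xi h (us @ v # ws))" for us a v ws
  proof -
    have "bracket H (chain us h) (e (scale a v)) = a \<odot>\<^bsub>H\<^esub> bracket H (chain us h) (e v)"
      using chain_carrier[OF h] ec by (subst J_inject[symmetric]) (simp_all add: J_simps J_e lbr_simps)
    then show ?thesis
      using h by (simp add: xi_def chain_append chain_smult val_smult chain_carrier ec lie_algebra_closed[OF H_lie])
  qed
  \<comment> \<open>\<open>Max\<close> needs a nonempty set, hence the inserted 0; the bound m lies
    strictly above all degrees of h.\<close>
  obtain m where m: "\<And>p. component H h p \<noteq> \<zero>\<^bsub>H\<^esub> \<Longrightarrow> p < m"
  proof
    let ?S = "{p. component H h p \<noteq> \<zero>\<^bsub>H\<^esub>}"
    show "p < Max (insert 0 ?S) + 1" if "component H h p \<noteq> \<zero>\<^bsub>H\<^esub>" for p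
      using Max_ge[of "insert 0 ?S" p] component_finite[OF H_graded h] that by simp
  qed
  have "\<forall>vs. length vs > nat (m + 1) \<longrightarrow> xi h vs = 0"
  proof (intro allI impI)
    fix vs :: "'v list" assume "length vs > nat (m + 1)"
    then have "component H h (int (length vs) - 1) = \<zero>\<^bsub>H\<^esub>" using m[of "int (length vs) - 1"] by linarith
    then show "xi h vs = 0" using val_chain_component[OF h] by (simp add: xi_def)
  qed
  then have "multilinear (xi h)"
    unfolding multilinear_def using add sc by (auto simp: xi_def[of h "[]"])
  moreover have "(\<lambda>v. xi h (vs @ [v])) \<in> L" for vs
  proof -
    \<comment> \<open>Bracketing with a vector lowers the degree by one, so the part of degree
      \<open>-1\<close> of \<open>[chain vs h, v]\<close> comes from the component of degree 0, to
      which \<open>of_type\<close> applies.\<close>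
    let ?A = "component H (chain vs h) 0"
    have "?A \<in> grade H 0" by (rule component_grade[OF H_graded chain_carrier[OF h]])
    then obtain T where T: "T \<in> L" "\<And>v. bracket H ?A (e v) = e (T v)"
      using type_L unfolding of_type_def by (auto simp: gen_m_eq img_def)
    have "xi h (vs @ [v]) = T v" for v
    proof -
      have "component H (bracket H (chain vs h) (e v)) (- 1) = e (T v)"
        using component_bracket[OF H_graded chain_carrier[OF h] e_grade, of vs v "- 1"] T(2) by simp
      then show ?thesis by (simp add: xi_def chain_append val_eqI)
    qed
    then show ?thesis using T(1) by simp
  qed
  ultimately show ?thesis by (simp add: multilinear_of_type_def)
qed

lemmas xi_multilinear = multilinear_of_typeD(1)[OF xi_multilinear_of_type]

lemma xi_img: "xi (img t) = 0"
proof
  fix vs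
  show "xi (img t) vs = 0 vs"
  proof (cases vs)
    case (Cons v ws)
    then have "component H (img t) (int (length vs) - 1) = \<zero>\<^bsub>H\<^esub>"
      using img_negative[of t] by (auto simp: graded_part_iff[OF H_graded])
    then show ?thesis using val_chain_component[OF img_carrier] by (simp add: xi_def)
  qed (simp add: xi_def)
qed

section \<open>Negative and nonnegative parts and their brackets\<close>

lemma Hnn_carrier: "g \<in> Hnn \<Longrightarrow> g \<in> carrier H"
  by (simp add: graded_part_iff[OF H_graded])

lemmas Hnn_submodule = graded_part_submodule[OF H_graded, of "{0..}"]
lemmas Hnn_closed = submodule_of_lie_zero[OF H_lie Hnn_submodule] submodule_of_lie_add[OF H_lie Hnn_submodule]
  submodule_of_lie_smult[OF H_lie Hnn_submodule] submodule_of_lie_minus[OF H_lie Hnn_submodule]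
  submodule_of_lie_neg[OF H_lie Hnn_submodule]

text \<open>\<open>decomposes h s g\<close>: the part of negative degree of \<open>h\<close> is the image of \<open>s\<close>, the rest is \<open>g\<close>.\<close>

definition decomposes :: "'h \<Rightarrow> ('k, 'v) lterm \<Rightarrow> 'h \<Rightarrow> bool" where
  "decomposes h s g \<longleftrightarrow> g \<in> Hnn \<and> h = img s \<oplus>\<^bsub>H\<^esub> g"

lemma decomposesD:
  assumes "decomposes h s g"
  shows "g \<in> Hnn" "g \<in> carrier H" "h \<in> carrier H" "J h = J (img s) + J g" "xi h = xi g"
  using assms Hnn_carrier
  by (auto simp: decomposes_def J_simps img_carrier xi_add xi_img)

lemma decomposesI: "g \<in> Hnn \<Longrightarrow> h \<in> carrier H \<Longrightarrow> J h = J (img s) + J g \<Longrightarrow> decomposes h s g"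
  unfolding decomposes_def using Hnn_carrier img_carrier
  by (auto simp: J_inject[symmetric] J_simps)

lemma decomposes_nonneg: "g \<in> Hnn \<Longrightarrow> decomposes g LZero g"
  using Hnn_carrier by (intro decomposesI) (auto simp: J_img)

lemma decomposes_img: "decomposes (img s) s \<zero>\<^bsub>H\<^esub>"
  by (intro decomposesI) (auto simp: Hnn_closed img_carrier J_simps)

lemma decomposes_add: "decomposes h s g \<Longrightarrow> decomposes h' s' g' \<Longrightarrow> decomposes (h \<oplus>\<^bsub>H\<^esub> h') (LAdd s s') (g \<oplus>\<^bsub>H\<^esub> g')"
  by (intro decomposesI) (auto simp: decomposesD Hnn_closed J_simps J_img)

lemma decomposes_smult: "decomposes h s g \<Longrightarrow> decomposes (a \<odot>\<^bsub>H\<^esub> h) (LSmult a s) (a \<odot>\<^bsub>H\<^esub> g)"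
  by (intro decomposesI) (auto simp: decomposesD Hnn_closed J_simps J_img lie_product.scale_right_distrib)

lemma ex_decomposes: "h \<in> carrier H \<Longrightarrow> \<exists>s g. decomposes h s g"
proof (erule graded_induct[OF H_graded])
  show "\<exists>s g. decomposes y s g" if y: "y \<in> grade H p" for p y
  proof (cases "p < 0")
    case True
    then obtain t where "y = img t" using homogeneous_negative[OF y] by blast
    then show ?thesis using decomposes_img by blast
  next
    case False
    then have "y \<in> Hnn" using y by (intro grade_graded_part[OF H_graded]) auto
    then show ?thesis using decomposes_nonneg by blast
  qed
qed (blast intro: decomposes_add)

text \<open>The difference of the two images lies both in the negative and in the nonnegative part,
  hence is zero. Only \<open>img s\<close> is determined: s itself may change by an element of
  K.\<close>

lemma decomposes_unique:
  assumes "decomposes h s g" "decomposes h s' g'"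
  shows "img s = img s'"
proof -
  note d = decomposesD[OF assms(1)] decomposesD[OF assms(2)]
  have e: "img s \<ominus>\<^bsub>H\<^esub> img s' = g' \<ominus>\<^bsub>H\<^esub> g"
    using d img_carrier by (subst J_inject[symmetric]) (simp_all add: J_simps algebra_simps)
  have "img s \<ominus>\<^bsub>H\<^esub> img s' \<in> graded_part H {..<0}"
    by (intro submodule_of_lie_minus[OF H_lie graded_part_submodule[OF H_graded]] img_negative)
  moreover have "img s \<ominus>\<^bsub>H\<^esub> img s' \<in> Hnn" unfolding e using d by (simp add: Hnn_closed)
  ultimately have "img s \<ominus>\<^bsub>H\<^esub> img s' = \<zero>\<^bsub>H\<^esub>"
    by (rule graded_part_Int_zero[OF H_graded]) auto
  then have "J (img s) - J (img s') = 0" by (simp add: J_simps img_carrier flip: lemb_minus[OF H_lie img_carrier img_carrier])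
  then show ?thesis using J_inject img_carrier by simp
qed

text \<open>g starts in degree 0, so \<open>[g, v]\<close> starts in degree \<open>-1\<close>, and
  its component there is \<open>e (xi g [v])\<close> by the definition of \<open>xi\<close>.\<close>

lemma nonneg_bracket_e:
  assumes "g \<in> Hnn"
  obtains g' where "decomposes (bracket H g (e v)) (LGen (xi g [v])) g'"
proof -
  note gc = Hnn_carrier[OF assms]
  have bc: "bracket H g (e v) \<in> carrier H" using gc img_carrier by (simp add: lie_algebra_closed[OF H_lie])
  let ?g = "bracket H g (e v) \<ominus>\<^bsub>H\<^esub> e (xi g [v])"
  have x: "e (xi g [v]) = component H (bracket H g (e v)) (- 1)" using e_val[OF bc] by (simp add: xi_def)
  have "component H ?g p = \<zero>\<^bsub>H\<^esub>" if "p < 0" for p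
  proof (cases "p = - 1")
    case True
    have "component H ?g p = component H (bracket H g (e v)) p \<ominus>\<^bsub>H\<^esub> component H (e (xi g [v])) p"
      using bc img_carrier by (simp add: a_minus_def component_add[OF H_graded] component_smult[OF H_graded]
          lie_algebra_closed[OF H_lie] component_carrier[OF H_graded] flip: smult_neg_one[OF H_lie])
    also have "\<dots> = \<zero>\<^bsub>H\<^esub>"
      using True component_homogeneous[OF H_graded e_grade, of "xi g [v]" p] x component_carrier[OF H_graded bc, of p]
      by (subst J_inject[symmetric]) (simp_all add: J_simps)
    finally show ?thesis .
  next
    case False
    have "component H (bracket H g (e v)) p = bracket H (component H g (p + 1)) (e v)"
      using component_bracket[OF H_graded gc e_grade, of v p] by simp
    also have "\<dots> = \<zero>\<^bsub>H\<^esub>"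
      using assms False that by (simp add: graded_part_iff[OF H_graded] lie_algebra_zero_bracket[OF H_lie] img_carrier)
    finally have "component H (bracket H g (e v)) p = \<zero>\<^bsub>H\<^esub>" .
    moreover have "component H (e (xi g [v])) p = \<zero>\<^bsub>H\<^esub>"
      using component_homogeneous[OF H_graded e_grade, of "xi g [v]" p] False by simp
    moreover have "component H ?g p = component H (bracket H g (e v)) p \<oplus>\<^bsub>H\<^esub> (- 1) \<odot>\<^bsub>H\<^esub> component H (e (xi g [v])) p"
      using bc img_carrier by (simp add: a_minus_def component_add[OF H_graded] component_smult[OF H_graded]
          lie_algebra_closed[OF H_lie] flip: smult_neg_one[OF H_lie])
    ultimately show ?thesis
      by (subst J_inject[symmetric]) (simp_all add: J_simps)
  qed
  then have "?g \<in> Hnn" using bc img_carrier by (auto simp: graded_part_iff[OF H_graded] lie_algebra_closed[OF H_lie])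
  then have "decomposes (bracket H g (e v)) (LGen (xi g [v])) ?g"
    using bc img_carrier by (intro decomposesI) (simp_all add: J_simps)
  then show ?thesis by (rule that)
qed

text \<open>The bracket of \<open>F(V)\<close> is defined so that this holds, by induction on \<open>t\<close>.\<close>

lemma nonneg_bracket_img:
  "\<forall>g\<in>Hnn. (\<exists>g'. decomposes (bracket H g (img t)) (nact t (xi g)) g') \<and> xi (bracket H g (img t)) = pact t (xi g)"
proof (induction t)
  case (LGen v)
  show ?case
    using nonneg_bracket_e by (auto simp: nact_simps pact_simps contract_xi) blast
next
  case LZero
  have "img LZero = \<zero>\<^bsub>H\<^esub>"
    using submodule_of_lie_zero[OF fl_lie K_submodule] by (simp add: img_eq_zero_iff free_lie_ops(2))
  then show ?case
    using decomposes_nonneg[OF Hnn_closed(1)]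
    by (auto simp: nact_simps pact_simps lie_algebra_zero_bracket[OF H_lie] Hnn_carrier xi_zero)
next
  case (LAdd s t)
  show ?case
  proof
    fix g assume g: "g \<in> Hnn"
    note gc = Hnn_carrier[OF g]
    obtain g1 g2 where d: "decomposes (bracket H g (img s)) (nact s (xi g)) g1" "decomposes (bracket H g (img t)) (nact t (xi g)) g2"
      and x: "xi (bracket H g (img s)) = pact s (xi g)" "xi (bracket H g (img t)) = pact t (xi g)"
      using LAdd g by blast
    have b: "bracket H g (img (LAdd s t)) = bracket H g (img s) \<oplus>\<^bsub>H\<^esub> bracket H g (img t)"
      using gc img_carrier by (subst J_inject[symmetric]) (simp_all add: J_simps J_img lbr_simps)
    show "(\<exists>g'. decomposes (bracket H g (img (LAdd s t))) (nact (LAdd s t) (xi g)) g') \<and>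
      xi (bracket H g (img (LAdd s t))) = pact (LAdd s t) (xi g)"
      using decomposes_add[OF d] x unfolding b nact_simps pact_simps
      by (auto simp: xi_add decomposesD(3)[OF d(1)] decomposesD(3)[OF d(2)])
  qed
next
  case (LSmult a t)
  show ?case
  proof
    fix g assume g: "g \<in> Hnn"
    note gc = Hnn_carrier[OF g]
    obtain g1 where d: "decomposes (bracket H g (img t)) (nact t (xi g)) g1"
      and x: "xi (bracket H g (img t)) = pact t (xi g)"
      using LSmult g by blast
    have b: "bracket H g (img (LSmult a t)) = a \<odot>\<^bsub>H\<^esub> bracket H g (img t)"
      using gc img_carrier by (subst J_inject[symmetric]) (simp_all add: J_simps J_img lbr_simps)
    show "(\<exists>g'. decomposes (bracket H g (img (LSmult a t))) (nact (LSmult a t) (xi g)) g') \<and>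
      xi (bracket H g (img (LSmult a t))) = pact (LSmult a t) (xi g)"
      using decomposes_smult[OF d, of a] x unfolding b nact_simps pact_simps
      by (auto simp: xi_smult decomposesD(3)[OF d])
  qed
next
  case (LBr s t)
  \<comment> \<open>One of the two double brackets in
    \<open>[g, [s, t]] = [[g, s], t] - [[g, t], s]\<close>, stated for arbitrary s and t so that
    both orders are covered. The negative part of \<open>[g, s]\<close> is bracketed with t inside
    the image of \<open>f(V)\<close>, which gives the \<open>LBr\<close> term; the nonnegative part
    falls under the hypothesis for t.\<close>
  have half: "\<exists>g'. decomposes (bracket H (bracket H g (img s)) (img t)) (LAdd (LBr (nact s (xi g)) t) (nact t (pact s (xi g)))) g' \<and>
      xi (bracket H (bracket H g (img s)) (img t)) = pact t (pact s (xi g))"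
    if g: "g \<in> Hnn"
      and s: "\<forall>g\<in>Hnn. (\<exists>g'. decomposes (bracket H g (img s)) (nact s (xi g)) g') \<and> xi (bracket H g (img s)) = pact s (xi g)"
      and t: "\<forall>g\<in>Hnn. (\<exists>g'. decomposes (bracket H g (img t)) (nact t (xi g)) g') \<and> xi (bracket H g (img t)) = pact t (xi g)"
    for s t g
  proof -
    obtain g1 where d: "decomposes (bracket H g (img s)) (nact s (xi g)) g1" and x: "xi (bracket H g (img s)) = pact s (xi g)"
      using s g by blast
    note D = decomposesD[OF d]
    obtain g2 where d2: "decomposes (bracket H g1 (img t)) (nact t (xi g1)) g2" and x2: "xi (bracket H g1 (img t)) = pact t (xi g1)"
      using t D(1) by blast
    have b: "bracket H (bracket H g (img s)) (img t) = img (LBr (nact s (xi g)) t) \<oplus>\<^bsub>H\<^esub> bracket H g1 (img t)"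
      using D img_carrier by (subst J_inject[symmetric]) (simp_all add: J_simps J_img lbr_simps)
    have "decomposes (bracket H (bracket H g (img s)) (img t)) (LAdd (LBr (nact s (xi g)) t) (nact t (xi g1))) (\<zero>\<^bsub>H\<^esub> \<oplus>\<^bsub>H\<^esub> g2)"
      unfolding b by (rule decomposes_add[OF decomposes_img d2])
    moreover have "xi g1 = pact s (xi g)" using D(5) x by simp
    moreover have "xi (bracket H (bracket H g (img s)) (img t)) = pact t (xi g1)"
      unfolding b using x2 decomposesD(3)[OF d2] by (simp add: xi_add img_carrier xi_img)
    ultimately show ?thesis by auto
  qed
  show ?case
  proof
    fix g assume g: "g \<in> Hnn"
    note gc = Hnn_carrier[OF g]
    obtain g1 where 1: "decomposes (bracket H (bracket H g (img s)) (img t)) (LAdd (LBr (nact s (xi g)) t) (nact t (pact s (xi g)))) g1"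
      "xi (bracket H (bracket H g (img s)) (img t)) = pact t (pact s (xi g))"
      using half[OF g LBr] by blast
    obtain g2 where 2: "decomposes (bracket H (bracket H g (img t)) (img s)) (LAdd (LBr (nact t (xi g)) s) (nact s (pact t (xi g)))) g2"
      "xi (bracket H (bracket H g (img t)) (img s)) = pact s (pact t (xi g))"
      using half[OF g LBr(2,1)] by blast
    have b: "bracket H g (img (LBr s t)) = bracket H (bracket H g (img s)) (img t) \<oplus>\<^bsub>H\<^esub>
        (- 1) \<odot>\<^bsub>H\<^esub> bracket H (bracket H g (img t)) (img s)"
      using gc img_carrier by (subst J_inject[symmetric]) (simp_all add: J_simps J_img lbr_lbr)
    have "xi (bracket H g (img (LBr s t))) = pact (LBr s t) (xi g)"
      unfolding b pact_simps using 1(2) 2(2) decomposesD(3)[OF 1(1)] decomposesD(3)[OF 2(1)]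
      by (simp add: xi_add xi_smult lie_algebra_closed[OF H_lie] fscale_neg_one)
    then show "(\<exists>g'. decomposes (bracket H g (img (LBr s t))) (nact (LBr s t) (xi g)) g') \<and>
      xi (bracket H g (img (LBr s t))) = pact (LBr s t) (xi g)"
      using decomposes_add[OF 1(1) decomposes_smult[OF 2(1), of "- 1"]] unfolding b nact_simps by blast
  qed
qed

text \<open>For k of degree \<open>q \<ge> 0\<close>, the component of \<open>[g, k]\<close> in
  degree \<open>r < 0\<close> is the bracket of the component of g in degree
  \<open>r - q < 0\<close> with k, which is zero; linearity in the second argument gives the general
  case.\<close>

lemma Hnn_bracket: "g \<in> Hnn \<Longrightarrow> h \<in> Hnn \<Longrightarrow> bracket H g h \<in> Hnn"
proof -
  assume g: "g \<in> Hnn" and h: "h \<in> Hnn"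
  note gc = Hnn_carrier[OF g] and hc = Hnn_carrier[OF h]
  have hom: "bracket H g k \<in> Hnn" if k: "k \<in> grade H q" "0 \<le> q" for k q
  proof -
    have "component H (bracket H g k) r = \<zero>\<^bsub>H\<^esub>" if "r < 0" for r
      using component_bracket[OF H_graded gc k(1), of r] g k that
      by (simp add: graded_part_iff[OF H_graded] lie_algebra_zero_bracket[OF H_lie] grade_carrier[OF H_graded k(1)])
    then show ?thesis
      using gc grade_carrier[OF H_graded k(1)] by (auto simp: graded_part_iff[OF H_graded] lie_algebra_closed[OF H_lie])
  qed
  let ?U = "{k \<in> carrier H. bracket H g k \<in> Hnn}"
  have U: "Module.submodule ?U (ring_of_type_algebra :: 'k ring) H"
    by (rule submodule_of_lieI[OF H_lie])
       (use gc Hnn_closed in \<open>auto simp: lie_algebra_closed[OF H_lie] lie_algebra_zero_bracket[OF H_lie]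
          lie_algebra.bracket_add_right[OF H_lie] lie_algebra.bracket_smult_right[OF H_lie]\<close>)
  have "component H h q \<in> ?U" for q
  proof (cases "0 \<le> q")
    case True
    then show ?thesis using hom component_grade[OF H_graded hc] component_carrier[OF H_graded hc] by blast
  next
    case False
    then show ?thesis
      using h gc by (simp add: graded_part_iff[OF H_graded] lie_algebra_closed[OF H_lie] lie_algebra_zero_bracket[OF H_lie])
        (simp add: component_zero[OF H_graded] lie_algebra_closed[OF H_lie])
  qed
  from mem_submodule_of_components[OF H_graded U hc this] show ?thesis by simp
qed

text \<open>The recursion of \<open>nonneg_bracket\<close>, recovered in H from the derivation rule
  for \<open>[[g, h], v]\<close>. In \<open>[g, v] = e (xi g [v]) + g'\<close> the first summand
  produces the extra term, an iterated bracket of h that begins with the vector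
  \<open>xi g [v]\<close>; likewise with g and h exchanged. For the empty list both sides are 0, as
  \<open>[g, h]\<close> has no part of degree \<open>-1\<close>.\<close>

lemma xi_bracket_raw: "\<forall>g\<in>Hnn. \<forall>h\<in>Hnn. val (chain vs (bracket H g h)) = nonneg_bracket vs (xi g) (xi h)"
proof (induction vs)
  case Nil
  show ?case
  proof (intro ballI)
    fix g h assume "g \<in> Hnn" "h \<in> Hnn"
    then have "bracket H g h \<in> Hnn" by (rule Hnn_bracket)
    then show "val (chain [] (bracket H g h)) = nonneg_bracket [] (xi g) (xi h)"
      using val_chain_component[of "bracket H g h" "[]"] by (simp add: graded_part_iff[OF H_graded])
  qed
next
  case (Cons v vs)
  show ?case
  proof (intro ballI)
    fix g h assume g: "g \<in> Hnn" and h: "h \<in> Hnn"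
    obtain g' where g': "decomposes (bracket H g (e v)) (LGen (xi g [v])) g'" using nonneg_bracket_e[OF g] .
    obtain h' where h': "decomposes (bracket H h (e v)) (LGen (xi h [v])) h'" using nonneg_bracket_e[OF h] .
    note D = decomposesD[OF g'] and D' = decomposesD[OF h']
    note gc = Hnn_carrier[OF g] and hc = Hnn_carrier[OF h] and ic = img_carrier
    have J1: "lbr (J g) (J (e v)) = J (e (xi g [v])) + J g'" "lbr (J h) (J (e v)) = J (e (xi h [v])) + J h'"
      using D(4) D'(4) gc hc ic by (simp_all add: J_simps)
    have "bracket H (bracket H g h) (e v) =
        (bracket H g' h \<oplus>\<^bsub>H\<^esub> (- 1) \<odot>\<^bsub>H\<^esub> bracket H h (e (xi g [v]))) \<oplus>\<^bsub>H\<^esub> (bracket H g h' \<oplus>\<^bsub>H\<^esub> bracket H g (e (xi h [v])))"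
    proof -
      have "lbr (lbr (J g) (J h)) (J (e v)) = lbr (lbr (J g) (J (e v))) (J h) + lbr (J g) (lbr (J h) (J (e v)))"
        by (simp add: lbr_lbr)
      then show ?thesis
        using gc hc ic D D' by (subst J_inject[symmetric])
          (simp_all add: J_simps J1 lbr_simps lbr_antisym[of "J (e _)" "J h"] algebra_simps)
    qed
    moreover have "contract (xi g) v = xi g'" "contract (xi h) v = xi h'" using D(5) D'(5) by (simp_all add: contract_xi)
    moreover have "val (chain vs (bracket H g' h)) = nonneg_bracket vs (xi g') (xi h)"
      "val (chain vs (bracket H g h')) = nonneg_bracket vs (xi g) (xi h')"
      using Cons.IH g h D(1) D'(1) by blast+
    moreover have "val (chain vs (bracket H h (e w))) = xi h (w # vs)" "val (chain vs (bracket H g (e w))) = xi g (w # vs)" for w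
      by (simp_all add: xi_def)
    ultimately show "val (chain (v # vs) (bracket H g h)) = nonneg_bracket (v # vs) (xi g) (xi h)"
      using gc hc ic D D'
      by (simp add: chain_add chain_smult val_add val_smult chain_carrier lie_algebra_closed[OF H_lie])
  qed
qed

lemma xi_bracket: "g \<in> Hnn \<Longrightarrow> h \<in> Hnn \<Longrightarrow> xi (bracket H g h) = nb (xi g) (xi h)"
proof
  fix vs assume "g \<in> Hnn" "h \<in> Hnn"
  then show "xi (bracket H g h) vs = nb (xi g) (xi h) vs"
    using xi_bracket_raw[of vs] by (cases vs) (auto simp: xi_def simp del: chain.simps nonneg_bracket.simps(2))
qed

text \<open>The term and the map are exactly those of \<open>F_bracket\<close> for the pairs formed
  by s and \<open>xi h\<close> and by s' and \<open>xi h'\<close>: splittings in H are bracketed by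
  the rule of F(V).\<close>

lemma decomposes_bracket:
  assumes "decomposes h s g" "decomposes h' s' g'"
  shows "\<exists>k. decomposes (bracket H h h')
      (LAdd (LAdd (LBr s s') (nact s' (xi h))) (LSmult (- 1) (nact s (xi h')))) k"
    and "xi (bracket H h h') = nb (xi h) (xi h') + pact s' (xi h) - pact s (xi h')"
proof -
  note D = decomposesD[OF assms(1)] and D' = decomposesD[OF assms(2)] and ic = img_carrier
  obtain k where k: "decomposes (bracket H g (img s')) (nact s' (xi h)) k" and xk: "xi (bracket H g (img s')) = pact s' (xi h)"
    using nonneg_bracket_img[of s'] D by auto
  obtain k' where k': "decomposes (bracket H g' (img s)) (nact s (xi h')) k'" and xk': "xi (bracket H g' (img s)) = pact s (xi h')"
    using nonneg_bracket_img[of s] D' by auto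
  have gg: "bracket H g g' \<in> Hnn" using D D' by (intro Hnn_bracket)
  have b: "bracket H h h' = ((img (LBr s s') \<oplus>\<^bsub>H\<^esub> bracket H g (img s')) \<oplus>\<^bsub>H\<^esub> (- 1) \<odot>\<^bsub>H\<^esub> bracket H g' (img s)) \<oplus>\<^bsub>H\<^esub> bracket H g g'"
    using D D' ic by (subst J_inject[symmetric])
      (simp_all add: J_simps J_img lbr_simps lbr_antisym[of "J (img s)" "J g'"] algebra_simps)
  note d = decomposes_add[OF decomposes_add[OF decomposes_add[OF decomposes_img k] decomposes_smult[OF k', of "- 1"]] decomposes_nonneg[OF gg]]
  \<comment> \<open>The bracket of the nonnegative parts contributes the summand
    \<open>LZero\<close>, removed here because \<open>decomposes\<close> depends on a term only
    through its image.\<close>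
  have "img (LAdd t LZero) = img t" for t by (rule img_cong) (simp add: cl_simps)
  then have "decomposes h (LAdd t LZero) g \<longleftrightarrow> decomposes h t g" for h t g by (simp add: decomposes_def)
  then show "\<exists>k. decomposes (bracket H h h') (LAdd (LAdd (LBr s s') (nact s' (xi h))) (LSmult (- 1) (nact s (xi h')))) k"
    using d unfolding b by blast
  have c: "img (LBr s s') \<in> carrier H" "bracket H g (img s') \<in> carrier H" "bracket H g' (img s) \<in> carrier H" "bracket H g g' \<in> carrier H"
    using D D' ic by (simp_all add: lie_algebra_closed[OF H_lie])
  show "xi (bracket H h h') = nb (xi h) (xi h') + pact s' (xi h) - pact s (xi h')"
    unfolding b using c D(1,5) D'(1,5) xk xk' xi_bracket
    by (simp add: xi_add xi_smult xi_img lie_algebra_closed[OF H_lie] fscale_neg_one)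
qed

text \<open>An element k of K is zero in H, so \<open>[g, img k] = 0\<close>. By
  \<open>nonneg_bracket_img\<close> the two parts of this bracket are those of
  \<open>[xi h, k]\<close>; uniqueness of the splitting puts the negative one into K, and the other
  one is \<open>xi \<zero> = 0\<close>. The term s is arbitrary, as the normalizer contains
  \<open>f(V)\<close>.\<close>

lemma xi_NN:
  assumes "h \<in> carrier H"
  shows "(lcls scale s, xi h) \<in> NN"
proof -
  obtain s' g where d: "decomposes h s' g" using ex_decomposes[OF assms] by blast
  note D = decomposesD[OF d]
  have "lcls scale (nact k (xi h)) \<in> K \<and> pact k (xi h) = 0" if k: "lcls scale k \<in> K" for k
  proof -
    have z: "bracket H g (img k) = \<zero>\<^bsub>H\<^esub>"
      using k D(2) by (simp add: img_eq_zero_iff[symmetric] lie_algebra_zero_bracket[OF H_lie])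
    obtain g' where g': "decomposes \<zero>\<^bsub>H\<^esub> (nact k (xi h)) g'" and x: "xi \<zero>\<^bsub>H\<^esub> = pact k (xi h)"
      using nonneg_bracket_img[of k] D(1,5) z by auto
    have "img (nact k (xi h)) = img LZero"
      by (rule decomposes_unique[OF g' decomposes_nonneg[OF Hnn_closed(1)]])
    also have "\<dots> = \<zero>\<^bsub>H\<^esub>"
      using submodule_of_lie_zero[OF fl_lie K_submodule] by (simp add: img_eq_zero_iff free_lie_ops(2))
    finally show ?thesis using x by (simp add: img_eq_zero_iff xi_zero)
  qed
  then show ?thesis using xi_multilinear_of_type[OF assms] by (simp add: NN_iff)
qed

section \<open>The comparison homomorphism\<close>

definition to_GA :: "'h \<Rightarrow> (('k, 'v) lterm set \<times> ('v list \<Rightarrow> 'v)) set" where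
  "to_GA h = q (lcls scale (SOME s. \<exists>g. decomposes h s g), xi h)"

lemma q_cong:
  assumes "img s = img s'" "h \<in> carrier H"
  shows "q (lcls scale s, xi h) = q (lcls scale s', xi h)"
proof -
  have "J (img (LAdd s (LSmult (- 1) s'))) = J \<zero>\<^bsub>H\<^esub>" using assms(1) by (simp add: J_img J_simps)
  then have "img (LAdd s (LSmult (- 1) s')) = \<zero>\<^bsub>H\<^esub>"
    using J_inject img_carrier lie_algebra_zero_closed[OF H_lie] by blast
  then have k: "lcls scale (LAdd s (LSmult (- 1) s')) \<in> K" by (simp add: img_eq_zero_iff)
  have m: "multilinear (xi h)" by (rule xi_multilinear[OF assms(2)])
  have n: "(lcls scale s, xi h) \<in> carrier NA" "(lcls scale s', xi h) \<in> carrier NA"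
    using xi_NN[OF assms(2)] by (simp_all add: NA_simps)
  have "(lcls scale s, xi h) \<ominus>\<^bsub>NA\<^esub> (lcls scale s', xi h) = (lcls scale s, xi h) \<oplus>\<^bsub>NA\<^esub> (- 1) \<odot>\<^bsub>NA\<^esub> (lcls scale s', xi h)"
    by (simp add: a_minus_def smult_neg_one[OF NA_lie n(2)])
  also have "\<dots> = incl (lcls scale (LAdd s (LSmult (- 1) s')))"
    by (simp add: NA_simps F_smult F_add incl_lcls fscale_neg_one)
  finally have "(lcls scale s, xi h) \<ominus>\<^bsub>NA\<^esub> (lcls scale s', xi h) \<in> incl ` K" using k by simp
  then show ?thesis by (rule coset_eqI[OF NA_lie incl_K_ideal n])
qed

text \<open>\<open>to_GA\<close> selects some splitting. By \<open>decomposes_unique\<close> any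
  other one changes s by an element of K, which is invisible in the quotient.\<close>

lemma to_GA_eq:
  assumes "decomposes h s g"
  shows "to_GA h = q (lcls scale s, xi h)"
proof -
  have "\<exists>g. decomposes h (SOME s. \<exists>g. decomposes h s g) g" by (rule someI_ex) (use assms in blast)
  then obtain g' where "decomposes h (SOME s. \<exists>g. decomposes h s g) g'" ..
  from decomposes_unique[OF this assms] show ?thesis
    unfolding to_GA_def by (rule q_cong[OF _ decomposesD(3)[OF assms]])
qed

lemma to_GA_hom: "to_GA \<in> graded_lie_hom H GA"
proof -
  have n: "(lcls scale s, xi h) \<in> carrier NA" if "h \<in> carrier H" for s h
    using xi_NN[OF that] by (simp add: NA_simps)
  have car: "to_GA h \<in> carrier GA" if "h \<in> carrier H" for h
    unfolding to_GA_def by (rule hom_carrier[OF q_hom n[OF that]])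
  have add: "to_GA (x \<oplus>\<^bsub>H\<^esub> y) = to_GA x \<oplus>\<^bsub>GA\<^esub> to_GA y" if xy: "x \<in> carrier H" "y \<in> carrier H" for x y
  proof -
    obtain s g t k where d: "decomposes x s g" "decomposes y t k" using ex_decomposes xy by blast
    show ?thesis
      unfolding to_GA_eq[OF d(1)] to_GA_eq[OF d(2)] to_GA_eq[OF decomposes_add[OF d]] hom_add[OF q_hom n[OF xy(1)] n[OF xy(2)], symmetric]
      by (simp add: NA_simps F_add xi_add xy)
  qed
  have sm: "to_GA (a \<odot>\<^bsub>H\<^esub> x) = a \<odot>\<^bsub>GA\<^esub> to_GA x" if x: "x \<in> carrier H" for a x
  proof -
    obtain s g where d: "decomposes x s g" using ex_decomposes x by blast
    show ?thesis
      unfolding to_GA_eq[OF d] to_GA_eq[OF decomposes_smult[OF d]] hom_smult[OF q_hom n[OF x], symmetric]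
      by (simp add: NA_simps F_smult xi_smult x)
  qed
  have br: "to_GA (bracket H x y) = bracket GA (to_GA x) (to_GA y)" if xy: "x \<in> carrier H" "y \<in> carrier H" for x y
  proof -
    obtain s g t k where d: "decomposes x s g" "decomposes y t k" using ex_decomposes xy by blast
    \<comment> \<open>This splitting of the bracket carries the term produced by
      \<open>F_bracket\<close>, so compatibility with brackets becomes an identity of
      representatives.\<close>
    obtain l where l: "decomposes (bracket H x y) (LAdd (LAdd (LBr s t) (nact t (xi x))) (LSmult (- 1) (nact s (xi y)))) l"
      using decomposes_bracket(1)[OF d] by blast
    show ?thesis
      unfolding to_GA_eq[OF d(1)] to_GA_eq[OF d(2)] to_GA_eq[OF l] hom_bracket[OF q_hom n[OF xy(1)] n[OF xy(2)], symmetric]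
      by (simp only: NA_simps F_bracket[OF xi_multilinear[OF xy(1)] xi_multilinear[OF xy(2)]] decomposes_bracket(2)[OF d])
  qed
  have gr: "to_GA h \<in> grade GA p" if h: "h \<in> grade H p" for h p
  proof (cases "p < 0")
    case True
    obtain t where t: "h = img t" "lcls scale t \<in> grade fl p" by (rule homogeneous_negative[OF h True])
    have "to_GA h = q (incl (lcls scale t))"
      unfolding t(1) to_GA_eq[OF decomposes_img] xi_img incl_lcls ..
    then show ?thesis using hom_grade[OF q_incl_hom t(2)] by simp
  next
    case False
    note hc = grade_carrier[OF H_graded h]
    have "h \<in> Hnn" using False by (intro grade_graded_part[OF H_graded h]) auto
    then have e: "to_GA h = q (lcls scale LZero, xi h)" by (rule to_GA_eq[OF decomposes_nonneg])
    \<comment> \<open>Arity \<open>p + 1\<close> corresponds to degree p; for other lengths the part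
      of degree \<open>-1\<close> of the iterated bracket comes from a component of h that
      vanishes.\<close>
    have "xi h vs = 0" if "length vs \<noteq> nat p + 1" for vs
    proof -
      have "int (length vs) - 1 \<noteq> p" using that False by linarith
      then show ?thesis
        using val_chain_component[OF hc, of vs] component_homogeneous[OF H_graded h] by (simp add: xi_def)
    qed
    then have "(lcls scale LZero, xi h) \<in> grade NA p"
      using False xi_multilinear[OF hc] xi_NN[OF hc] by (simp add: NA_simps F_grade multilinear_maps_iff)
    then show ?thesis unfolding e by (rule hom_grade[OF q_hom])
  qed
  show ?thesis unfolding graded_lie_hom_def using car add sm br gr by auto
qed

lemma to_GA_i: "x \<in> carrier M \<Longrightarrow> to_GA (i x) = m_to_g scale K L x"
proof -
  assume "x \<in> carrier M"
  then obtain t where t: "x = K +>\<^bsub>fl\<^esub> lcls scale t" by (auto simp: M_carrier free_lie_ops(1))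
  have "to_GA (img t) = q (incl (lcls scale t))"
    unfolding to_GA_eq[OF decomposes_img] xi_img incl_lcls ..
  then show ?thesis by (simp add: t img_def m_to_g_coset lcls_carrier)
qed

lemma xi_component: "h \<in> carrier H \<Longrightarrow> xi (component H h p) vs = (if int (length vs) = p + 1 then xi h vs else 0)"
proof -
  assume h: "h \<in> carrier H"
  note hc = component_carrier[OF H_graded h, of p] and hg = component_grade[OF H_graded h, of p]
  show ?thesis
  proof (cases "int (length vs) = p + 1")
    case True
    then have "component H (chain vs (component H h p)) (- 1) = component H (chain vs h) (- 1)"
      using component_homogeneous[OF H_graded hg] by (simp add: component_chain h hc)
    then show ?thesis using True by (simp add: xi_def val_def)
  next
    case False
    then show ?thesis
      using val_chain_component[OF hc, of vs] component_homogeneous[OF H_graded hg, of "int (length vs) - 1"] by (simp add: xi_def)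
  qed
qed

text \<open>Induction on the degree through effectivity. In degree 0, \<open>[h, v]\<close> equals
  \<open>e (xi h [v])\<close>, which is zero; in degree \<open>n + 1\<close>, \<open>[h, v]\<close>
  has degree n and its map is a contraction of that of h, so it vanishes by induction.\<close>

lemma xi_homogeneous_eq_zero: "h \<in> grade H (int n) \<Longrightarrow> xi h = 0 \<Longrightarrow> h = \<zero>\<^bsub>H\<^esub>"
proof (induction n arbitrary: h)
  case 0
  note hc = grade_carrier[OF H_graded 0(1)]
  show ?case
  proof (rule H_effective)
    show "h \<in> Hnn" by (rule grade_graded_part[OF H_graded 0(1)]) simp
    fix y assume "y \<in> grade H (- 1)"
    then obtain v where v: "y = e v" by (auto simp: grade_H_minus_one)
    have b: "bracket H h (e v) \<in> grade H (- 1)"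
      using graded_lie_algebra.bracket_grade[OF H_graded 0(1) e_grade, of v] by simp
    have bc: "bracket H h (e v) \<in> carrier H" by (rule grade_carrier[OF H_graded b])
    have "bracket H h (e v) = e (val (bracket H h (e v)))"
      using e_val[OF bc] component_homogeneous[OF H_graded b, of "- 1"] by simp
    also have "val (bracket H h (e v)) = xi h [v]" by (simp add: xi_def)
    also have "e (xi h [v]) = \<zero>\<^bsub>H\<^esub>"
      using 0(2) img_eq_zero_iff[of "LGen 0"] submodule_of_lie_zero[OF fl_lie K_submodule] lcls_eq_iff[of "LGen 0" LZero]
      by (simp add: free_lie_ops(2) cl_simps cl_LGen)
    finally show "bracket H h y = \<zero>\<^bsub>H\<^esub>" using v by simp
  qed
next
  case (Suc n)
  show ?case
  proof (rule H_effective)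
    show "h \<in> Hnn" by (rule grade_graded_part[OF H_graded Suc.prems(1)]) simp
    fix y assume "y \<in> grade H (- 1)"
    then obtain v where v: "y = e v" by (auto simp: grade_H_minus_one)
    have "bracket H h (e v) \<in> grade H (int n)"
      using graded_lie_algebra.bracket_grade[OF H_graded Suc.prems(1) e_grade, of v] by simp
    moreover have "xi (bracket H h (e v)) = 0"
      using contract_xi[of h v] Suc.prems(2) by (simp only: contract_simps)
    ultimately show "bracket H h y = \<zero>\<^bsub>H\<^esub>" unfolding v by (rule Suc.IH)
  qed
qed

text \<open>If the class vanishes, then s lies in K and \<open>xi h = 0\<close>: the first removes
  the negative part of h, the second all components of nonnegative degree.\<close>

lemma to_GA_inj: "inj_on to_GA (carrier H)"
proof (rule hom_inj_onI[OF to_GA_hom H_lie GA_lie])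
  fix h assume h: "h \<in> carrier H" and z: "to_GA h = \<zero>\<^bsub>GA\<^esub>"
  obtain s g where d: "decomposes h s g" using ex_decomposes[OF h] by blast
  have "(lcls scale s, xi h) \<in> incl ` K"
    using z q_eq_zero_iff[OF xi_NN[OF h]] unfolding to_GA_eq[OF d] by blast
  then have k: "lcls scale s \<in> K" "xi h = 0" by (simp_all add: incl_image_iff)
  then have "img s = \<zero>\<^bsub>H\<^esub>" by (simp add: img_eq_zero_iff)
  then have hn: "h \<in> Hnn" using d decomposesD(1,2)[OF d] by (simp add: decomposes_def lie_algebra_add_zero[OF H_lie])
  show "h = \<zero>\<^bsub>H\<^esub>"
  proof (rule eq_zero_of_components[OF H_graded h])
    fix p
    show "component H h p = \<zero>\<^bsub>H\<^esub>"
    proof (cases "p < 0")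
      case True
      then show ?thesis using hn by (auto simp: graded_part_iff[OF H_graded])
    next
      case False
      have "xi (component H h p) = 0" using xi_component[OF h] k(2) by (simp add: fun_eq_iff)
      then show ?thesis
        using False component_grade[OF H_graded h, of p] by (intro xi_homogeneous_eq_zero[of _ "nat p"]) simp_all
    qed
  qed
qed

end

section \<open>Maximality and uniqueness of the quotient\<close>

context ideal_space
begin

lemma GA_maximal:
  assumes "finite B" "span B = UNIV"
  shows "maximal_effective_prolongation TYPE('h) L (gen_m scale K) M (m_to_g scale K L) GA"
  unfolding maximal_effective_prolongation_def
proof (intro conjI allI impI GA_effective_prolongation[OF assms] GA_of_type)
  fix H :: "('k, 'h) graded_struct" and i
  assume "effective_prolongation M i H \<and> of_type L (i \<circ> gen_m scale K) H"
  then interpret competing_prolongation scale L K H i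
    by unfold_locales simp_all
  show "\<exists>f\<in>graded_lie_hom H GA. inj_on f (carrier H) \<and> (\<forall>x\<in>carrier M. f (i x) = m_to_g scale K L x)"
    using to_GA_hom to_GA_inj to_GA_i by blast
qed

text \<open>H is maximal among competitors whose elements have the type of those of
  \<open>g(K, L)\<close>, so \<open>g(K, L)\<close> itself embeds into H over \<open>m(K)\<close>.
  Followed by \<open>to_GA\<close>, this embedding is an endomorphism over \<open>m(K)\<close>,
  hence the identity; so \<open>to_GA\<close>, which is injective, is also onto.\<close>

lemma GA_maximal_unique:
  fixes H :: "('k, 'h) graded_struct"
  assumes B: "finite B" "span B = UNIV"
    and H: "maximal_effective_prolongation TYPE((('k, 'v) lterm set \<times> ('v list \<Rightarrow> 'v)) set) L (gen_m scale K) M i H"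
  shows "\<exists>f\<in>graded_lie_hom H GA. bij_betw f (carrier H) (carrier GA) \<and> (\<forall>x\<in>carrier M. f (i x) = m_to_g scale K L x)"
proof -
  have eff: "effective_prolongation M i H" "of_type L (i \<circ> gen_m scale K) H"
    using H by (simp_all add: maximal_effective_prolongation_def)
  then interpret competing_prolongation scale L K H i
    by unfold_locales
  obtain f where f: "f \<in> graded_lie_hom GA H" "\<forall>x\<in>carrier M. f (m_to_g scale K L x) = i x"
    using H GA_effective_prolongation[OF B] GA_of_type unfolding maximal_effective_prolongation_def by blast
  have id: "(to_GA \<circ> f) x = x" if "x \<in> carrier GA" for x
    by (rule effective_prolongation_endo_eq[OF GA_effective_prolongation[OF B] graded_lie_hom_comp[OF f(1) to_GA_hom] _ that])
       (simp add: f(2) to_GA_i)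
  have "carrier GA \<subseteq> to_GA ` carrier H"
  proof
    fix x assume x: "x \<in> carrier GA"
    have "x = to_GA (f x)" using id[OF x] by simp
    then show "x \<in> to_GA ` carrier H" using hom_carrier[OF f(1) x] by (rule image_eqI)
  qed
  moreover have "to_GA ` carrier H \<subseteq> carrier GA" using hom_carrier[OF to_GA_hom] by blast
  ultimately have "bij_betw to_GA (carrier H) (carrier GA)"
    using to_GA_inj unfolding bij_betw_def by (intro conjI equalityI)
  then show ?thesis using to_GA_hom to_GA_i by (intro bexI[of _ to_GA] conjI ballI)
qed

end

theorem theorem1p8:
  fixes scale :: "'k::field_char_0 \<Rightarrow> 'v::ab_group_add \<Rightarrow> 'v"
    and Basis :: "'v set"
    and L :: "('v \<Rightarrow> 'v) set"
    and \<K> :: "('k, 'v) lterm set set"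
  assumes V: "finite_dimensional_vector_space scale Basis"
    and n: "vector_space.dim scale (UNIV :: 'v set) \<ge> 2"
    and L: "lie_subalgebra L (gl_lie scale)"
    and \<K>: "graded_ideal \<K> (free_lie scale)"
      "\<K> \<subseteq> graded_part (free_lie scale) {..-2}"
  shows
    "lie_subalgebra (carrier (normalizer_alg scale \<K> L)) (full_prolongation scale) \<and>
     lie_ideal (incl ` \<K>) (normalizer_alg scale \<K> L) \<and>
     incl \<in> graded_lie_hom (free_lie scale) (normalizer_alg scale \<K> L) \<and>
     fgla (m_alg scale \<K>) \<and>
     m_to_g scale \<K> L \<in> graded_lie_hom (m_alg scale \<K>) (g_alg scale \<K> L) \<and>
     inj_on (m_to_g scale \<K> L) (carrier (m_alg scale \<K>)) \<and>
     effective_prolongation (m_alg scale \<K>) (m_to_g scale \<K> L) (g_alg scale \<K> L) \<and>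
     of_type L (m_to_g scale \<K> L \<circ> gen_m scale \<K>) (g_alg scale \<K> L) \<and>
     maximal_effective_prolongation TYPE('h) L (gen_m scale \<K>)
       (m_alg scale \<K>) (m_to_g scale \<K> L) (g_alg scale \<K> L) \<and>
     (\<forall>(H :: ('k, 'h) graded_struct) i.
        maximal_effective_prolongation TYPE((('k, 'v) lterm set \<times> ('v list \<Rightarrow> 'v)) set)
          L (gen_m scale \<K>) (m_alg scale \<K>) i H \<longrightarrow>
        (\<exists>f\<in>graded_lie_hom H (g_alg scale \<K> L).
           bij_betw f (carrier H) (carrier (g_alg scale \<K> L)) \<and>
           (\<forall>x\<in>carrier (m_alg scale \<K>). f (i x) = m_to_g scale \<K> L x)))"
  proof -
  interpret V: finite_dimensional_vector_space scale Basis by (rule V)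
  interpret base_space_type scale L
    by (rule base_space_typeI[OF V.vector_space_axioms L])
  interpret ideal_space scale L \<K>
    by unfold_locales (use \<K> in simp_all)
  note basis = V.finite_Basis V.span_Basis
  show ?thesis
  proof (intro conjI allI impI)
    show "lie_subalgebra (carrier (normalizer_alg scale \<K> L)) (full_prolongation scale)"
      using NN_subalgebra by (simp only: NA_simps)
    show "lie_ideal (incl ` \<K>) (normalizer_alg scale \<K> L)" by (rule incl_K_ideal)
    show "incl \<in> graded_lie_hom (free_lie scale) (normalizer_alg scale \<K> L)" by (rule incl_hom_NA)
    show "fgla (m_alg scale \<K>)" by (rule M_fgla[OF basis])
    show "m_to_g scale \<K> L \<in> graded_lie_hom (m_alg scale \<K>) (g_alg scale \<K> L)" by (rule m_to_g_hom)
    show "inj_on (m_to_g scale \<K> L) (carrier (m_alg scale \<K>))" by (rule m_to_g_inj)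
    show "effective_prolongation (m_alg scale \<K>) (m_to_g scale \<K> L) (g_alg scale \<K> L)"
      by (rule GA_effective_prolongation[OF basis])
    show "of_type L (m_to_g scale \<K> L \<circ> gen_m scale \<K>) (g_alg scale \<K> L)" by (rule GA_of_type)
    show "maximal_effective_prolongation TYPE('h) L (gen_m scale \<K>)
       (m_alg scale \<K>) (m_to_g scale \<K> L) (g_alg scale \<K> L)"
      by (rule GA_maximal[OF basis])
    fix H :: "('k, 'h) graded_struct" and i
    assume "maximal_effective_prolongation TYPE((('k, 'v) lterm set \<times> ('v list \<Rightarrow> 'v)) set)
          L (gen_m scale \<K>) (m_alg scale \<K>) i H"
    then show "\<exists>f\<in>graded_lie_hom H (g_alg scale \<K> L).
           bij_betw f (carrier H) (carrier (g_alg scale \<K> L)) \<and>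
           (\<forall>x\<in>carrier (m_alg scale \<K>). f (i x) = m_to_g scale \<K> L x)"
      by (rule GA_maximal_unique[OF basis])
  qed
qed

end
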